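(* For every $\mathbf{Top}$-graph $\Gamma$, the fundamental $\mathbf{Top}$-groupoid $\pi^{\tau}(\Gamma,\Gamma_0)$ is naturally isomorphic (as a $\mathbf{Top}$-groupoid) to the free $\mathbf{Top}$-groupoid $\mathscr F(\pi_0(\Gamma))$ on the path-component $\mathbf{Top}$-graph $\pi_0(\Gamma)$; the isomorphism is induced by sending the path component of an edge $e$ to the homotopy class of the canonical edge path $\alpha_e$.
   Context: A $\mathbf{Top}$-graph $\Gamma$: discrete vertex space $\Gamma_0$, edge space $\Gamma$, continuous $\partial_0,\partial_1:\Gamma\to\Gamma_0$; $\Gamma(x,y)=\partial_0^{-1}(x)\cap\partial_1^{-1}(y)$. Realization $|\Gamma|=\Gamma_0\sqcup(\Gamma\times[0,1])/((\alpha,i)\sim\partial_i(\alpha))$, topologized by the basis of vertex neighborhoods $B(x,r)$, $0<r<1$ (image of $(\partial_0^{-1}(x)\times[0,r))\cup(\partial_1^{-1}(x)\times(1-r,1])$) and edge neighborhoods (images of $U\times(a,b)$, $U$ open in some $\Gamma(x,y)$, $0<a<b<1$). For $e\in\Gamma(x,y)$, $\alpha_e(t)$ is the image of $(e,t)$. $\pi_0(\Gamma)$ is the $\mathbf{Top}$-graph with vertices $\Gamma_0$ and edge spaces $\pi_0(\Gamma(x,y))$ (path-component spaces, quotient topology). A $\mathbf{Top}$-groupoid is a groupoid with discrete object set, topologized hom-sets and continuous composition and inversion. The free $\mathbf{Top}$-groupoid $\mathscr F(\Delta)$ on a $\mathbf{Top}$-graph $\Delta$ is the $\mathbf{Top}$-groupoid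 with objects $\Delta_0$ and a $\mathbf{Top}$-graph morphism $\Delta\to\mathscr F(\Delta)$ through which every $\mathbf{Top}$-graph morphism into a $\mathbf{Top}$-groupoid factors uniquely by a hom-wise continuous functor. $\pi^{qtop}(\Gamma,\Gamma_0)$ is the fundamental groupoid of $|\Gamma|$ on the object set $\Gamma_0$ with each hom-set of homotopy classes of paths given the quotient topology of the compact-open path space; its composition is separately continuous and inversion continuous. The fundamental $\mathbf{Top}$-groupoid $\pi^\tau(\Gamma,\Gamma_0)$ is $\tau(\pi^{qtop}(\Gamma,\Gamma_0))$, where $\tau$ is the left adjoint (reflection) of the inclusion of $\mathbf{Top}$-groupoids into groupoids with topologized hom-sets, continuous inversion and separately continuous composition; $\tau$ does not change the underlying groupoid, and the identity $\pi^{qtop}\to\pi^\tau$ is continuous and universal for hom-wise continuous functors into $\mathbf{Top}$-groupoids. *)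

theory Defs
  imports "HOL-Analysis.Analysis"
begin

definition top_graph :: "'v set \<Rightarrow> 'e topology \<Rightarrow> ('e \<Rightarrow> 'v) \<Rightarrow> ('e \<Rightarrow> 'v) \<Rightarrow> bool" where
  "top_graph V E d0 d1 \<longleftrightarrow>
     continuous_map E (discrete_topology V) d0 \<and> continuous_map E (discrete_topology V) d1"

definition edges_between :: "'e topology \<Rightarrow> ('e \<Rightarrow> 'v) \<Rightarrow> ('e \<Rightarrow> 'v) \<Rightarrow> 'v \<Rightarrow> 'v \<Rightarrow> 'e set" where
  "edges_between E d0 d1 x y = {e \<in> topspace E. d0 e = x \<and> d1 e = y}"

text \<open>Quotient topology on the image of a map f (open iff the preimage is open).
The family below is already a topology, so generating from it changes nothing.\<close>
definition quotient_top :: "'a topology \<Rightarrow> ('a \<Rightarrow> 'b) \<Rightarrow> 'b topology" where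
  "quotient_top X f = topology_generated_by
     {U. U \<subseteq> f ` topspace X \<and> openin X {x \<in> topspace X. f x \<in> U}}"

text \<open>Points of |Gamma|: Inl x for a vertex x, Inr (e,t) for the interior point at
parameter 0 < t < 1 of the edge e (the points (e,0), (e,1) are identified with the
end vertices).\<close>

type_synonym ('v,'e) rpt = "'v + 'e \<times> real"

definition real_points :: "'v set \<Rightarrow> 'e topology \<Rightarrow> ('v,'e) rpt set" where
  "real_points V E = Inl ` V \<union> {Inr (e, t) | e t. e \<in> topspace E \<and> 0 < t \<and> t < 1}"

definition vertex_nbhd :: "'e topology \<Rightarrow> ('e \<Rightarrow> 'v) \<Rightarrow> ('e \<Rightarrow> 'v) \<Rightarrow> 'v \<Rightarrow> real \<Rightarrow> ('v,'e) rpt set" where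
  "vertex_nbhd E d0 d1 x r =
     {Inl x}
     \<union> {Inr (e, t) | e t. e \<in> topspace E \<and> d0 e = x \<and> 0 < t \<and> t < r}
     \<union> {Inr (e, t) | e t. e \<in> topspace E \<and> d1 e = x \<and> 1 - r < t \<and> t < 1}"

definition realization :: "'v set \<Rightarrow> 'e topology \<Rightarrow> ('e \<Rightarrow> 'v) \<Rightarrow> ('e \<Rightarrow> 'v) \<Rightarrow> ('v,'e) rpt topology" where
  "realization V E d0 d1 = topology_generated_by
     ({vertex_nbhd E d0 d1 x r | x r. x \<in> V \<and> 0 < r \<and> r < 1}
      \<union> {{Inr (e, t) | e t. e \<in> U \<and> a < t \<and> t < b} | U a b x y.
           x \<in> V \<and> y \<in> V \<and> openin (subtopology E (edges_between E d0 d1 x y)) U \<and>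
           0 < a \<and> a < b \<and> b < 1})"

definition edge_path :: "('e \<Rightarrow> 'v) \<Rightarrow> ('e \<Rightarrow> 'v) \<Rightarrow> 'e \<Rightarrow> real \<Rightarrow> ('v,'e) rpt" where
  "edge_path d0 d1 e t =
     (if t = 0 then Inl (d0 e) else if t = 1 then Inl (d1 e)
      else if 0 < t \<and> t < 1 then Inr (e, t) else undefined)"

definition unit_iv :: "real topology" where
  "unit_iv = subtopology euclideanreal {0..1}"

definition path_space_set :: "'a topology \<Rightarrow> 'a \<Rightarrow> 'a \<Rightarrow> (real \<Rightarrow> 'a) set" where
  "path_space_set X x y = {p. pathin X p \<and> p 0 = x \<and> p 1 = y \<and> (\<forall>t. t \<notin> {0..1} \<longrightarrow> p t = undefined)}"

definition compact_open_paths :: "'a topology \<Rightarrow> 'a \<Rightarrow> 'a \<Rightarrow> (real \<Rightarrow> 'a) topology" where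
  "compact_open_paths X x y = topology_generated_by
     {{p \<in> path_space_set X x y. p ` K \<subseteq> U} | K U. compactin unit_iv K \<and> openin X U}"

definition homotopic_rel_ends :: "'a topology \<Rightarrow> (real \<Rightarrow> 'a) \<Rightarrow> (real \<Rightarrow> 'a) \<Rightarrow> bool" where
  "homotopic_rel_ends X p q \<longleftrightarrow>
     homotopic_with (\<lambda>h. h 0 = p 0 \<and> h 1 = p 1) unit_iv X p q"

definition path_class :: "'a topology \<Rightarrow> 'a \<Rightarrow> 'a \<Rightarrow> (real \<Rightarrow> 'a) \<Rightarrow> (real \<Rightarrow> 'a) set" where
  "path_class X x y p = {q \<in> path_space_set X x y. homotopic_rel_ends X p q}"

definition join_path :: "(real \<Rightarrow> 'a) \<Rightarrow> (real \<Rightarrow> 'a) \<Rightarrow> real \<Rightarrow> 'a" where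
  "join_path p q t = (if t \<in> {0..1} then (if t \<le> 1/2 then p (2 * t) else q (2 * t - 1)) else undefined)"

definition rev_path :: "(real \<Rightarrow> 'a) \<Rightarrow> real \<Rightarrow> 'a" where
  "rev_path p t = (if t \<in> {0..1} then p (1 - t) else undefined)"

definition const_path :: "'a \<Rightarrow> real \<Rightarrow> 'a" where
  "const_path x t = (if t \<in> {0..1} then x else undefined)"

text \<open>Objects of type 'o, morphisms of type 'm; composition is written in diagrammatic
order: comp x y z f g is "f then g" for f : x \<rightarrow> y, g : y \<rightarrow> z.\<close>

record ('o,'m) tgpd =
  obj  :: "'o set"
  hom  :: "'o \<Rightarrow> 'o \<Rightarrow> 'm set"
  comp :: "'o \<Rightarrow> 'o \<Rightarrow> 'o \<Rightarrow> 'm \<Rightarrow> 'm \<Rightarrow> 'm"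
  idn  :: "'o \<Rightarrow> 'm"
  inv  :: "'o \<Rightarrow> 'o \<Rightarrow> 'm \<Rightarrow> 'm"
  htop :: "'o \<Rightarrow> 'o \<Rightarrow> 'm topology"

definition groupoid :: "('o,'m) tgpd \<Rightarrow> bool" where
  "groupoid G \<longleftrightarrow>
    (\<forall>x\<in>obj G. idn G x \<in> hom G x x) \<and>
    (\<forall>x\<in>obj G. \<forall>y\<in>obj G. \<forall>z\<in>obj G. \<forall>f\<in>hom G x y. \<forall>g\<in>hom G y z.
        comp G x y z f g \<in> hom G x z) \<and>
    (\<forall>x\<in>obj G. \<forall>y\<in>obj G. \<forall>z\<in>obj G. \<forall>w\<in>obj G.
       \<forall>f\<in>hom G x y. \<forall>g\<in>hom G y z. \<forall>h\<in>hom G z w.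
        comp G x z w (comp G x y z f g) h = comp G x y w f (comp G y z w g h)) \<and>
    (\<forall>x\<in>obj G. \<forall>y\<in>obj G. \<forall>f\<in>hom G x y.
        comp G x x y (idn G x) f = f \<and> comp G x y y f (idn G y) = f) \<and>
    (\<forall>x\<in>obj G. \<forall>y\<in>obj G. \<forall>f\<in>hom G x y.
        inv G x y f \<in> hom G y x \<and>
        comp G x y x f (inv G x y f) = idn G x \<and> comp G y x y (inv G x y f) f = idn G y)"

definition top_groupoid :: "('o,'m) tgpd \<Rightarrow> bool" where
  "top_groupoid G \<longleftrightarrow> groupoid G \<and>
    (\<forall>x\<in>obj G. \<forall>y\<in>obj G. topspace (htop G x y) = hom G x y) \<and>
    (\<forall>x\<in>obj G. \<forall>y\<in>obj G. \<forall>z\<in>obj G.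
       continuous_map (prod_topology (htop G x y) (htop G y z)) (htop G x z)
         (\<lambda>(f, g). comp G x y z f g)) \<and>
    (\<forall>x\<in>obj G. \<forall>y\<in>obj G. continuous_map (htop G x y) (htop G y x) (inv G x y))"

text \<open>The reflection tau: the finest hom-set topologies that are coarser than the given
ones and make the groupoid a Top-groupoid (the join of all such families).\<close>
definition tau_top :: "('o,'m) tgpd \<Rightarrow> 'o \<Rightarrow> 'o \<Rightarrow> 'm topology" where
  "tau_top G x y = topology_generated_by
     (\<Union>{{U. openin (T x y) U} | T.
         (\<forall>a\<in>obj G. \<forall>b\<in>obj G. \<forall>U. openin (T a b) U \<longrightarrow> openin (htop G a b) U) \<and>
         top_groupoid (G\<lparr>htop := T\<rparr>)})"

definition tau :: "('o,'m) tgpd \<Rightarrow> ('o,'m) tgpd" where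
  "tau G = G\<lparr>htop := tau_top G\<rparr>"

type_synonym ('v,'e) pclass = "(real \<Rightarrow> ('v,'e) rpt) set"

definition pi_qtop :: "'v set \<Rightarrow> 'e topology \<Rightarrow> ('e \<Rightarrow> 'v) \<Rightarrow> ('e \<Rightarrow> 'v) \<Rightarrow> ('v, ('v,'e) pclass) tgpd" where
  "pi_qtop V E d0 d1 =
    (let R = realization V E d0 d1;
         cls = (\<lambda>x y. path_class R (Inl x) (Inl y))
     in \<lparr> obj = V,
          hom = (\<lambda>x y. cls x y ` path_space_set R (Inl x) (Inl y)),
          comp = (\<lambda>x y z a b. cls x z (join_path (SOME p. p \<in> a) (SOME q. q \<in> b))),
          idn = (\<lambda>x. cls x x (const_path (Inl x))),
          inv = (\<lambda>x y a. cls y x (rev_path (SOME p. p \<in> a))),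
          htop = (\<lambda>x y. quotient_top (compact_open_paths R (Inl x) (Inl y)) (cls x y)) \<rparr>)"

definition pi_tau :: "'v set \<Rightarrow> 'e topology \<Rightarrow> ('e \<Rightarrow> 'v) \<Rightarrow> ('e \<Rightarrow> 'v) \<Rightarrow> ('v, ('v,'e) pclass) tgpd" where
  "pi_tau V E d0 d1 = tau (pi_qtop V E d0 d1)"

definition pi0_comp :: "'e topology \<Rightarrow> ('e \<Rightarrow> 'v) \<Rightarrow> ('e \<Rightarrow> 'v) \<Rightarrow> 'v \<Rightarrow> 'v \<Rightarrow> 'e \<Rightarrow> 'e set" where
  "pi0_comp E d0 d1 x y e = path_component_of_set (subtopology E (edges_between E d0 d1 x y)) e"

definition pi0_edges :: "'e topology \<Rightarrow> ('e \<Rightarrow> 'v) \<Rightarrow> ('e \<Rightarrow> 'v) \<Rightarrow> 'v \<Rightarrow> 'v \<Rightarrow> 'e set topology" where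
  "pi0_edges E d0 d1 x y =
     quotient_top (subtopology E (edges_between E d0 d1 x y)) (pi0_comp E d0 d1 x y)"

definition canon_map :: "'v set \<Rightarrow> 'e topology \<Rightarrow> ('e \<Rightarrow> 'v) \<Rightarrow> ('e \<Rightarrow> 'v) \<Rightarrow> 'v \<Rightarrow> 'v \<Rightarrow> 'e set \<Rightarrow> ('v,'e) pclass" where
  "canon_map V E d0 d1 x y C =
     path_class (realization V E d0 d1) (Inl x) (Inl y) (edge_path d0 d1 (SOME e. e \<in> C))"

text \<open>A Top-graph is presented by its vertex set V and the edge spaces D x y = Delta(x,y)
(a Top-graph with discrete vertex space is the topological sum of these).
A Top-graph morphism into a Top-groupoid H: vertex map f0, edge maps f1 x y
continuous Delta(x,y) \<rightarrow> H(f0 x, f0 y).\<close>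
definition graph_morphism_to ::
  "'v set \<Rightarrow> ('v \<Rightarrow> 'v \<Rightarrow> 'd topology) \<Rightarrow> ('o,'m) tgpd \<Rightarrow> ('v \<Rightarrow> 'o) \<Rightarrow> ('v \<Rightarrow> 'v \<Rightarrow> 'd \<Rightarrow> 'm) \<Rightarrow> bool" where
  "graph_morphism_to V D H f0 f1 \<longleftrightarrow>
     (\<forall>x\<in>V. f0 x \<in> obj H) \<and>
     (\<forall>x\<in>V. \<forall>y\<in>V. continuous_map (D x y) (htop H (f0 x) (f0 y)) (f1 x y))"

definition cont_functor :: "('o,'m) tgpd \<Rightarrow> ('p,'n) tgpd \<Rightarrow> ('o \<Rightarrow> 'p) \<Rightarrow> ('o \<Rightarrow> 'o \<Rightarrow> 'm \<Rightarrow> 'n) \<Rightarrow> bool" where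
  "cont_functor G H F0 F1 \<longleftrightarrow>
     (\<forall>x\<in>obj G. F0 x \<in> obj H) \<and>
     (\<forall>x\<in>obj G. \<forall>y\<in>obj G. continuous_map (htop G x y) (htop H (F0 x) (F0 y)) (F1 x y)) \<and>
     (\<forall>x\<in>obj G. F1 x x (idn G x) = idn H (F0 x)) \<and>
     (\<forall>x\<in>obj G. \<forall>y\<in>obj G. \<forall>z\<in>obj G. \<forall>f\<in>hom G x y. \<forall>g\<in>hom G y z.
        F1 x z (comp G x y z f g) = comp H (F0 x) (F0 y) (F0 z) (F1 x y f) (F1 y z g))"

text \<open>Universal property of the free Top-groupoid on (V, D) with universal graph
morphism (identity on vertices, iota on edges), tested against one Top-groupoid H.
The theorem quantifies over all H of arbitrary types.\<close>
definition free_wrt ::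
  "'v set \<Rightarrow> ('v \<Rightarrow> 'v \<Rightarrow> 'd topology) \<Rightarrow> ('v,'m) tgpd \<Rightarrow> ('v \<Rightarrow> 'v \<Rightarrow> 'd \<Rightarrow> 'm)
   \<Rightarrow> ('p,'n) tgpd \<Rightarrow> bool" where
  "free_wrt V D G iota H \<longleftrightarrow>
     (top_groupoid H \<longrightarrow>
       (\<forall>f0 f1. graph_morphism_to V D H f0 f1 \<longrightarrow>
          (\<exists>F1. cont_functor G H f0 F1 \<and>
                (\<forall>x\<in>V. \<forall>y\<in>V. \<forall>d\<in>topspace (D x y). F1 x y (iota x y d) = f1 x y d) \<and>
                (\<forall>F1'. cont_functor G H f0 F1' \<and>
                       (\<forall>x\<in>V. \<forall>y\<in>V. \<forall>d\<in>topspace (D x y). F1' x y (iota x y d) = f1 x y d)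
                   \<longrightarrow> (\<forall>x\<in>V. \<forall>y\<in>V. \<forall>m\<in>hom G x y. F1' x y m = F1 x y m)))))"

end

(*
A graph morphism from pi_0(Gamma) to a Top-groupoid H is a map phi on edges, continuous on each
Gamma(x,y) and constant on path components. Cover |Gamma| by open stars of radius 1/2 and by the sets
of open edges leaving a vertex; phi defines an H-valued cocycle on this cover (identity on the first
half of an edge, phi(e) on the second half) that is constant along every path inside an overlap. Such
a flat cocycle has a parallel transport along paths, which depends continuously on the path for the
compact-open topology; the same argument with the hom-sets of H made discrete shows that it is constant
under homotopies. Transport is therefore a continuous functor on pi^qtop, and hence on pi^tau, because
pulling the topologies of H back along it gives an admissible family for the reflection. Conversely, a
functor with value phi(e) on the class of each edge path e is transport: apply it to the paths that run
along a given path up to time t and then radially to the centre of a chart. The values form a parallel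
section, since the charts contract radially, and parallel sections are determined by their initial value.
*)

theory Submission
  imports Defs
begin

section \<open>Paths and homotopies in abstract spaces\<close>

text \<open>The map phi may vary inside Gamma(x,y), whose topology is arbitrary, so the transition
  functions need not be locally constant. They are constant only along paths inside an overlap, and
  transport is built on this weak flatness. Two charts of the same kind are related by identities.
  The overlap of a star with an out-set omits the midpoints t = 1/2, so a path in it either stays in
  the half where the transition is an identity, or stays in the other half and moves through edges
  of one fixed Gamma(x,y), hence inside one path component.

  Transport is read off a section that is given in all charts along the whole path. No subdivision
  is chosen, so nothing has to be shown independent of it, and uniqueness of sections yields
  functoriality, the value on edge paths and the uniqueness of the extension.

  Composition in pi^qtop is in general only separately continuous, since a product of quotient maps
  need not be a quotient map. The topology of pi^tau is never described explicitly: maps into it are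
  tested on all admissible families, and maps out of it through one admissible family.\<close>

lemma topspace_unit_iv [simp]: "topspace unit_iv = {0..1}"
  by (simp add: unit_iv_def)

lemma pathin_unit_iv: "pathin X p \<longleftrightarrow> continuous_map unit_iv X p"
  by (simp add: pathin_def unit_iv_def)

text \<open>Connectedness of [0,1] for an arbitrary value type. With a predicate for
  \<open>f\<close> it acts as an induction along a path: a property that is locally constant in time
  and true at 0 is true at 1.\<close>

lemma unit_interval_locally_constant:
  fixes f :: "real \<Rightarrow> 'a"
  assumes "\<And>t. t \<in> {0..1} \<Longrightarrow> \<exists>d>0. \<forall>t'\<in>{0..1}. \<bar>t' - t\<bar> < d \<longrightarrow> f t' = f t"
  shows "f 0 = f 1"
proof (rule connected_local_const[of "{0..1::real}"])
  show "\<forall>a\<in>{0..1}. \<forall>\<^sub>F b in at a within {0..1}. f a = f b"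
  proof
    fix a :: real assume "a \<in> {0..1}"
    from assms[OF this] obtain d where d: "d > 0" "\<forall>t'\<in>{0..1}. \<bar>t' - a\<bar> < d \<longrightarrow> f t' = f a"
      by blast
    then show "\<forall>\<^sub>F b in at a within {0..1}. f a = f b"
      unfolding eventually_at by (intro exI[of _ d]) (auto simp: dist_real_def)
  qed
qed auto

text \<open>\<open>homotopic_with\<close> asks for agreement at every real parameter. The end
  condition reads only 0 and 1, so agreement on [0,1] is enough, and values of paths outside the
  interval never enter a homotopy.\<close>

lemma homotopic_rel_endsI:
  assumes h: "continuous_map (prod_topology unit_iv unit_iv) X h"
    and "\<And>t. t \<in> {0..1} \<Longrightarrow> h (0, t) = p t" "\<And>t. t \<in> {0..1} \<Longrightarrow> h (1, t) = q t"
    and "\<And>s. s \<in> {0..1} \<Longrightarrow> h (s, 0) = p 0" "\<And>s. s \<in> {0..1} \<Longrightarrow> h (s, 1) = p 1"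
  shows "homotopic_rel_ends X p q"
  unfolding homotopic_rel_ends_def
  by (subst homotopic_with; simp) (use assms in \<open>auto simp: unit_iv_def intro!: exI[of _ h]\<close>)

lemma homotopic_rel_ends_iff:
  "homotopic_rel_ends X p q \<longleftrightarrow> (\<exists>h. continuous_map (prod_topology unit_iv unit_iv) X h \<and>
    (\<forall>t\<in>{0..1}. h (0, t) = p t) \<and> (\<forall>t\<in>{0..1}. h (1, t) = q t) \<and>
    (\<forall>s\<in>{0..1}. h (s, 0) = p 0) \<and> (\<forall>s\<in>{0..1}. h (s, 1) = p 1))"
  unfolding homotopic_rel_ends_def
  by (subst homotopic_with; simp add: unit_iv_def) blast

lemma homotopic_rel_ends_endpoints:
  fixes X :: "'a topology"
  assumes "homotopic_rel_ends X p q" shows "q 0 = p 0" "q 1 = p 1"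
proof -
  from assms obtain h :: "real \<times> real \<Rightarrow> 'a"
    where "\<forall>t\<in>{0..1}. h (1, t) = q t" "\<forall>s\<in>{0..1}. h (s, 0) = p 0" "\<forall>s\<in>{0..1}. h (s, 1) = p 1"
    unfolding homotopic_rel_ends_iff by blast
  then show "q 0 = p 0" "q 1 = p 1"
    by (metis atLeastAtMost_iff order_refl zero_le_one)+
qed

lemma homotopic_rel_ends_refl: "pathin X p \<Longrightarrow> homotopic_rel_ends X p p"
  by (simp add: homotopic_rel_ends_def pathin_unit_iv)

lemma homotopic_rel_ends_sym:
  assumes "homotopic_rel_ends X p q" shows "homotopic_rel_ends X q p"
  using homotopic_with_symD[OF assms[unfolded homotopic_rel_ends_def]]
  by (simp add: homotopic_rel_ends_def homotopic_rel_ends_endpoints[OF assms])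

lemma homotopic_rel_ends_trans:
  assumes pq: "homotopic_rel_ends X p q" and qr: "homotopic_rel_ends X q r"
  shows "homotopic_rel_ends X p r"
  using homotopic_with_trans[OF pq[unfolded homotopic_rel_ends_def]
      qr[unfolded homotopic_rel_ends_def homotopic_rel_ends_endpoints[OF pq]]]
  by (simp add: homotopic_rel_ends_def)

lemma continuous_map_unit_square:
  "continuous_map (prod_topology unit_iv unit_iv) (top_of_set S) f \<longleftrightarrow>
   continuous_on ({0..1} \<times> {0..1}) f \<and> f ` ({0..1} \<times> {0..1}) \<subseteq> S"
  by (auto simp: unit_iv_def prod_topology_subtopology_eu)

text \<open>Every reparametrisation homotopy needed for the fundamental groupoid is an instance of
this straight-line homotopy in a convex parameter domain.\<close>

lemma homotopic_rel_ends_convex: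
  fixes u v :: "real \<Rightarrow> 'b::real_normed_vector"
  assumes K: "continuous_map (top_of_set C) X K" and C: "convex C"
    and u: "continuous_on {0..1} u" "u ` {0..1} \<subseteq> C"
    and v: "continuous_on {0..1} v" "v ` {0..1} \<subseteq> C"
    and ends: "u 0 = v 0" "u 1 = v 1"
    and p: "\<And>t. t \<in> {0..1} \<Longrightarrow> p t = K (u t)" and q: "\<And>t. t \<in> {0..1} \<Longrightarrow> q t = K (v t)"
  shows "homotopic_rel_ends X p q"
proof (rule homotopic_rel_endsI)
  let ?w = "\<lambda>(s::real, t). (1 - s) *\<^sub>R u t + s *\<^sub>R v t"
  have "continuous_on ({0..1} \<times> {0..1}) ?w"
    unfolding case_prod_beta
    by (auto intro!: continuous_on_scaleR continuous_on_add continuous_on_diff continuous_on_const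
      continuous_on_fst continuous_on_snd continuous_on_id continuous_on_compose2[OF u(1)] continuous_on_compose2[OF v(1)])
  moreover have "?w ` ({0..1} \<times> {0..1}) \<subseteq> C"
    using u(2) v(2) by (auto simp: image_subset_iff intro!: convexD[OF C])
  ultimately have "continuous_map (prod_topology unit_iv unit_iv) (top_of_set C) ?w"
    by (simp add: continuous_map_unit_square)
  from continuous_map_compose[OF this K]
  show "continuous_map (prod_topology unit_iv unit_iv) X (K \<circ> ?w)" .
qed (use ends p q in \<open>simp_all add: scaleR_left_diff_distrib\<close>)

text \<open>Pasting along the closed slice t = 1/2. Constant families give joins of single paths;
  genuine families over \<open>unit_iv\<close> give joins of homotopies and the moving tails of
  \<open>tail_path_homotopic\<close>.\<close>

lemma continuous_map_join_family:
  assumes h1: "continuous_map (prod_topology A unit_iv) X (\<lambda>(a, t). h1 a t)"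
    and h2: "continuous_map (prod_topology A unit_iv) X (\<lambda>(a, t). h2 a t)"
    and eq: "\<And>a. a \<in> topspace A \<Longrightarrow> h1 a 1 = h2 a 0"
  shows "continuous_map (prod_topology A unit_iv) X (\<lambda>(a, t). join_path (h1 a) (h2 a) t)"
proof -
  let ?P = "prod_topology A unit_iv"
  have snd: "continuous_map ?P euclideanreal snd"
    using continuous_map_snd[of A unit_iv] by (simp add: unit_iv_def continuous_map_in_subtopology)
  have "continuous_map ?P X (\<lambda>z. if snd z \<le> 1/2 then h1 (fst z) (2 * snd z) else h2 (fst z) (2 * snd z - 1))"
  proof (rule continuous_map_cases_le)
    let ?S = "subtopology ?P {x \<in> topspace ?P. snd x \<le> 1/2}"
    have "continuous_map ?S ?P (\<lambda>z. (fst z, 2 * snd z))"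
      unfolding continuous_map_pairwise o_def fst_conv snd_conv
    proof
      show "continuous_map ?S unit_iv (\<lambda>x. 2 * snd x)"
        unfolding unit_iv_def
        by (intro continuous_map_into_subtopology continuous_map_real_mult continuous_map_from_subtopology)
           (use snd in \<open>auto simp: unit_iv_def\<close>)
    qed (intro continuous_map_from_subtopology continuous_map_fst)
    from continuous_map_compose[OF this h1]
    show "continuous_map ?S X (\<lambda>z. h1 (fst z) (2 * snd z))"
      by (simp add: o_def)
    let ?S = "subtopology ?P {x \<in> topspace ?P. 1/2 \<le> snd x}"
    have "continuous_map ?S ?P (\<lambda>z. (fst z, 2 * snd z - 1))"
      unfolding continuous_map_pairwise o_def fst_conv snd_conv
    proof
      show "continuous_map ?S unit_iv (\<lambda>x. 2 * snd x - 1)"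
        unfolding unit_iv_def
        by (intro continuous_map_into_subtopology continuous_map_diff continuous_map_real_mult continuous_map_from_subtopology)
           (use snd in \<open>auto simp: unit_iv_def\<close>)
    qed (intro continuous_map_from_subtopology continuous_map_fst)
    from continuous_map_compose[OF this h2]
    show "continuous_map ?S X (\<lambda>z. h2 (fst z) (2 * snd z - 1))"
      by (simp add: o_def)
    show "h1 (fst x) (2 * snd x) = h2 (fst x) (2 * snd x - 1)" if "x \<in> topspace ?P" "snd x = 1/2" for x
    proof -
      have "snd x = 1/2" using that by simp
      then show ?thesis using that eq[of "fst x"] by (simp only: mem_Times_iff topspace_prod_topology) simp
    qed
  qed (rule snd, simp)
  then show ?thesis
    by (rule continuous_map_eq) (auto simp: join_path_def)
qed

lemma continuous_map_prod_snd:
  "continuous_map Y Z f \<Longrightarrow> continuous_map (prod_topology X Y) Z (\<lambda>(a, t). f t)"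
  using continuous_map_compose[OF continuous_map_snd, of Y Z f X] by (simp add: case_prod_unfold o_def)

lemma pathin_join:
  assumes "pathin X p" "pathin X q" "p 1 = q 0"
  shows "pathin X (join_path p q)"
proof -
  have "continuous_map (prod_topology unit_iv unit_iv) X (\<lambda>(a, t). join_path p q t)"
    by (rule continuous_map_join_family; (rule continuous_map_prod_snd)?)
      (use assms in \<open>simp_all add: pathin_unit_iv\<close>)
  moreover have "continuous_map unit_iv (prod_topology unit_iv unit_iv) (\<lambda>t. (0::real, t))"
    unfolding continuous_map_pairwise o_def fst_conv snd_conv by simp
  ultimately show ?thesis
    using continuous_map_compose[of unit_iv "prod_topology unit_iv unit_iv" "\<lambda>t. (0, t)" X]
    unfolding pathin_unit_iv by (fastforce simp: o_def)
qed

lemma homotopic_rel_ends_join: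
  assumes "homotopic_rel_ends X p p'" "homotopic_rel_ends X q q'" "p 1 = q 0"
  shows "homotopic_rel_ends X (join_path p q) (join_path p' q')"
proof -
  from assms(1) obtain h where h: "continuous_map (prod_topology unit_iv unit_iv) X h"
    "\<forall>t\<in>{0..1}. h (0, t) = p t" "\<forall>t\<in>{0..1}. h (1, t) = p' t"
    "\<forall>s\<in>{0..1}. h (s, 0) = p 0" "\<forall>s\<in>{0..1}. h (s, 1) = p 1"
    unfolding homotopic_rel_ends_iff by blast
  from assms(2) obtain k where k: "continuous_map (prod_topology unit_iv unit_iv) X k"
    "\<forall>t\<in>{0..1}. k (0, t) = q t" "\<forall>t\<in>{0..1}. k (1, t) = q' t"
    "\<forall>s\<in>{0..1}. k (s, 0) = q 0" "\<forall>s\<in>{0..1}. k (s, 1) = q 1"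
    unfolding homotopic_rel_ends_iff by blast
  show ?thesis
  proof (rule homotopic_rel_endsI)
    show "continuous_map (prod_topology unit_iv unit_iv) X
      (\<lambda>(s, t). join_path (\<lambda>t. h (s, t)) (\<lambda>t. k (s, t)) t)"
      by (rule continuous_map_join_family) (use h k assms(3) in \<open>simp_all add: case_prod_unfold\<close>)
  qed (use h k in \<open>auto simp: join_path_def\<close>)
qed

lemma pathin_rev: "pathin X p \<Longrightarrow> pathin X (rev_path p)"
  unfolding pathin_unit_iv
proof -
  assume p: "continuous_map unit_iv X p"
  have "continuous_map unit_iv unit_iv (\<lambda>t. 1 - t)"
    unfolding unit_iv_def by (auto intro!: continuous_intros)
  from continuous_map_compose[OF this p] show "continuous_map unit_iv X (rev_path p)"
    by (rule continuous_map_eq) (auto simp: rev_path_def)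
qed

lemma homotopic_rel_ends_rev:
  assumes "homotopic_rel_ends X p q"
  shows "homotopic_rel_ends X (rev_path p) (rev_path q)"
proof -
  from assms obtain h where h: "continuous_map (prod_topology unit_iv unit_iv) X h"
    "\<forall>t\<in>{0..1}. h (0, t) = p t" "\<forall>t\<in>{0..1}. h (1, t) = q t"
    "\<forall>s\<in>{0..1}. h (s, 0) = p 0" "\<forall>s\<in>{0..1}. h (s, 1) = p 1"
    unfolding homotopic_rel_ends_iff by blast
  have "continuous_map (prod_topology unit_iv unit_iv) (prod_topology unit_iv unit_iv) (\<lambda>z. (fst z, 1 - snd z))"
    by (auto simp: unit_iv_def prod_topology_subtopology_eu intro!: continuous_intros)
  from continuous_map_compose[OF this h(1)]
  show ?thesis
    by (rule homotopic_rel_endsI) (use h in \<open>auto simp: rev_path_def\<close>)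
qed

lemma pathin_const_path: "x \<in> topspace X \<Longrightarrow> pathin X (const_path x)"
  unfolding pathin_unit_iv
  by (rule continuous_map_eq[of _ _ "\<lambda>_. x"]) (auto simp: const_path_def)

section \<open>The groupoid laws up to homotopy, by reparametrisation\<close>

lemma homotopic_rel_ends_reparam:
  fixes u v :: "real \<Rightarrow> real"
  assumes "pathin X w" "continuous_on {0..1} u" "u ` {0..1} \<subseteq> {0..1}"
    "continuous_on {0..1} v" "v ` {0..1} \<subseteq> {0..1}" "u 0 = v 0" "u 1 = v 1"
    "\<And>t. t \<in> {0..1} \<Longrightarrow> p t = w (u t)" "\<And>t. t \<in> {0..1} \<Longrightarrow> q t = w (v t)"
  shows "homotopic_rel_ends X p q"
  using assms by (intro homotopic_rel_ends_convex[of "{0..1::real}" X w u v]) (auto simp: pathin_def)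

lemma join_path_left: "0 \<le> t \<Longrightarrow> t \<le> 1/2 \<Longrightarrow> join_path p q t = p (2 * t)"
  by (simp add: join_path_def)

lemma join_path_right: "p 1 = q 0 \<Longrightarrow> 1/2 \<le> t \<Longrightarrow> t \<le> 1 \<Longrightarrow> join_path p q t = q (2 * t - 1)"
  by (cases "2 * t = 1") (auto simp: join_path_def)

lemma join_const_left:
  assumes "pathin X p"
  shows "homotopic_rel_ends X (join_path (const_path (p 0)) p) p"
proof (rule homotopic_rel_ends_reparam[OF assms, of "\<lambda>t. max 0 (2 * t - 1)" "\<lambda>t. t"])
  show "join_path (const_path (p 0)) p t = p (max 0 (2 * t - 1))" if "t \<in> {0..1}" for t
    using that by (cases "t \<le> 1/2") (auto simp: join_path_def const_path_def)
qed (auto intro!: continuous_intros)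

lemma join_const_right:
  assumes "pathin X p"
  shows "homotopic_rel_ends X (join_path p (const_path (p 1))) p"
proof (rule homotopic_rel_ends_reparam[OF assms, of "\<lambda>t. min 1 (2 * t)" "\<lambda>t. t"])
  show "join_path p (const_path (p 1)) t = p (min 1 (2 * t))" if "t \<in> {0..1}" for t
    using that by (cases "t \<le> 1/2") (auto simp: join_path_def const_path_def)
qed (auto intro!: continuous_intros)

lemma join_rev_right:
  assumes "pathin X p"
  shows "homotopic_rel_ends X (join_path p (rev_path p)) (const_path (p 0))"
\<comment> \<open>A tent: out to parameter 1 and back to 0, hence deformable to the constant
  parameter 0.\<close>
proof (rule homotopic_rel_ends_reparam[OF assms, of "\<lambda>t. min (2 * t) (2 - 2 * t)" "\<lambda>t. 0"])
  show "join_path p (rev_path p) t = p (min (2 * t) (2 - 2 * t))" if "t \<in> {0..1}" for t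
    using that by (cases "t \<le> 1/2") (auto simp: join_path_def rev_path_def)
  show "const_path (p 0) t = p 0" if "t \<in> {0..1}" for t
    using that by (auto simp: const_path_def)
qed (auto intro!: continuous_intros)

lemma join_rev_left:
  assumes "pathin X p"
  shows "homotopic_rel_ends X (join_path (rev_path p) p) (const_path (p 1))"
proof (rule homotopic_rel_ends_reparam[OF assms, of "\<lambda>t. max (1 - 2 * t) (2 * t - 1)" "\<lambda>t. 1"])
  show "join_path (rev_path p) p t = p (max (1 - 2 * t) (2 * t - 1))" if "t \<in> {0..1}" for t
    using that by (cases "t \<le> 1/2") (auto simp: join_path_def rev_path_def)
  show "const_path (p 1) t = p 1" if "t \<in> {0..1}" for t
    using that by (auto simp: const_path_def)
qed (auto intro!: continuous_intros)

lemma join_assoc: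
  assumes "pathin X p" "pathin X q" "pathin X r" "p 1 = q 0" "q 1 = r 0"
  shows "homotopic_rel_ends X (join_path (join_path p q) r) (join_path p (join_path q r))"
proof (rule homotopic_rel_ends_reparam)
  let ?w = "join_path (join_path p q) r"
  \<comment> \<open>Both bracketings are reparametrisations of the left one. \<open>?u\<close> has
    slopes 1/2, 1, 2 with breaks at 1/2 and 3/4; being convex it is the maximum of its three pieces,
    so its continuity needs no case distinction.\<close>
  let ?u = "\<lambda>t. max (max (t / 2) (t - 1/4)) (2 * t - 1) :: real"
  have e: "join_path p q 1 = r 0" "p 1 = join_path q r 0" using assms by (simp_all add: join_path_def)
  with assms show "pathin X ?w" by (intro pathin_join) auto
  show "join_path p (join_path q r) t = ?w (?u t)" if t: "t \<in> {0..1}" for t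
  proof -
    consider "t \<le> 1/2" | "t \<ge> 1/2" "t \<le> 3/4" | "t \<ge> 3/4" by linarith
    then show ?thesis
    proof cases
      case 1
      then have "?u t = t / 2" by simp
      with 1 t show ?thesis by (simp add: join_path_left)
    next
      case 2
      then have "?u t = t - 1/4" by simp
      with 2 t e assms show ?thesis
        by (simp add: join_path_left join_path_right algebra_simps)
    next
      case 3
      then have "?u t = 2 * t - 1" by simp
      with 3 t e assms show ?thesis
        by (simp add: join_path_right)
    qed
  qed
  show "?w t = ?w t" for t ..
qed (auto intro!: continuous_intros)

section \<open>The fundamental groupoid\<close>

lemma path_class_eqI:
  assumes "homotopic_rel_ends X p q"
  shows "path_class X x y p = path_class X x y q"
  using assms unfolding path_class_def by (meson homotopic_rel_ends_sym homotopic_rel_ends_trans)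

text \<open>\<open>comp\<close> and \<open>inv\<close> of \<open>pi_qtop\<close> act on
  representatives picked by \<open>SOME\<close>; this controls the choice up to homotopy.\<close>

lemma some_path_class:
  assumes "p \<in> path_space_set X x y"
  shows "(SOME q. q \<in> path_class X x y p) \<in> path_space_set X x y"
    and "homotopic_rel_ends X p (SOME q. q \<in> path_class X x y p)"
proof -
  have "p \<in> path_class X x y p"
    using assms by (simp add: path_class_def path_space_set_def homotopic_rel_ends_refl)
  then have "(SOME q. q \<in> path_class X x y p) \<in> path_class X x y p" by (rule someI[of "\<lambda>q. q \<in> path_class X x y p"])
  then show "(SOME q. q \<in> path_class X x y p) \<in> path_space_set X x y"
    "homotopic_rel_ends X p (SOME q. q \<in> path_class X x y p)"
    by (simp_all add: path_class_def)
qed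

lemma join_path_space_set:
  assumes "p \<in> path_space_set X x y" "q \<in> path_space_set X y z"
  shows "join_path p q \<in> path_space_set X x z"
  using assms pathin_join[of X p q] by (auto simp: path_space_set_def join_path_def)

lemma rev_path_space_set: "p \<in> path_space_set X x y \<Longrightarrow> rev_path p \<in> path_space_set X y x"
  using pathin_rev[of X p] by (auto simp: path_space_set_def rev_path_def)

lemma const_path_space_set: "x \<in> topspace X \<Longrightarrow> const_path x \<in> path_space_set X x x"
  using pathin_const_path[of x X] by (auto simp: path_space_set_def const_path_def)

lemma path_class_join_some:
  assumes "p \<in> path_space_set X x y" "q \<in> path_space_set X y z"
  shows "path_class X x z (join_path (SOME p'. p' \<in> path_class X x y p) (SOME q'. q' \<in> path_class X y z q))
    = path_class X x z (join_path p q)"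
  using assms some_path_class[OF assms(1)] some_path_class[OF assms(2)]
  by (intro path_class_eqI homotopic_rel_ends_join)
    (auto simp: path_space_set_def intro: homotopic_rel_ends_sym)

lemma path_class_rev_some:
  assumes "p \<in> path_space_set X x y"
  shows "path_class X y x (rev_path (SOME p'. p' \<in> path_class X x y p)) = path_class X y x (rev_path p)"
  using some_path_class[OF assms] by (metis path_class_eqI homotopic_rel_ends_rev homotopic_rel_ends_sym)

context
  fixes V :: "'v set" and E :: "'e topology" and d0 d1 :: "'e \<Rightarrow> 'v"
begin

abbreviation (input) "RR \<equiv> realization V E d0 d1"
abbreviation (input) "GG \<equiv> pi_qtop V E d0 d1"

lemma pi_qtop_sel:
  "obj GG = V"
  "hom GG x y = path_class RR (Inl x) (Inl y) ` path_space_set RR (Inl x) (Inl y)"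
  "idn GG x = path_class RR (Inl x) (Inl x) (const_path (Inl x))"
  "htop GG x y = quotient_top (compact_open_paths RR (Inl x) (Inl y)) (path_class RR (Inl x) (Inl y))"
  by (simp_all add: pi_qtop_def Let_def)

lemma pi_qtop_comp:
  assumes "p \<in> path_space_set RR (Inl x) (Inl y)" "q \<in> path_space_set RR (Inl y) (Inl z)"
  shows "comp GG x y z (path_class RR (Inl x) (Inl y) p) (path_class RR (Inl y) (Inl z) q)
    = path_class RR (Inl x) (Inl z) (join_path p q)"
  using path_class_join_some[OF assms] by (simp add: pi_qtop_def Let_def)

lemma pi_qtop_inv:
  assumes "p \<in> path_space_set RR (Inl x) (Inl y)"
  shows "inv GG x y (path_class RR (Inl x) (Inl y) p) = path_class RR (Inl y) (Inl x) (rev_path p)"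
  using path_class_rev_some[OF assms] by (simp add: pi_qtop_def Let_def)

text \<open>The laws are homotopy theory in an arbitrary space. The realization contributes that
  vertices are points, which provides the constant paths.\<close>

lemma groupoid_pi_qtop:
  assumes V: "\<And>x. x \<in> V \<Longrightarrow> Inl x \<in> topspace RR"
  shows "groupoid GG"
proof -
  have c: "const_path (Inl x) \<in> path_space_set RR (Inl x) (Inl x)" if "x \<in> V" for x
    using V[OF that] by (rule const_path_space_set)
  have 1: "comp GG x z w (comp GG x y z f g) h = comp GG x y w f (comp GG y z w g h)"
    if "f \<in> hom GG x y" "g \<in> hom GG y z" "h \<in> hom GG z w" for x y z w f g h
  proof -
    from that obtain p q r where p: "p \<in> path_space_set RR (Inl x) (Inl y)" "f = path_class RR (Inl x) (Inl y) p"
      and q: "q \<in> path_space_set RR (Inl y) (Inl z)" "g = path_class RR (Inl y) (Inl z) q"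
      and r: "r \<in> path_space_set RR (Inl z) (Inl w)" "h = path_class RR (Inl z) (Inl w) r"
      by (auto simp: pi_qtop_sel)
    have "path_class RR (Inl x) (Inl w) (join_path (join_path p q) r) =
      path_class RR (Inl x) (Inl w) (join_path p (join_path q r))"
      using p q r by (intro path_class_eqI join_assoc) (auto simp: path_space_set_def)
    then show ?thesis
      using p q r by (simp add: pi_qtop_comp join_path_space_set)
  qed
  have 2: "comp GG x x y (idn GG x) f = f \<and> comp GG x y y f (idn GG y) = f \<and>
     inv GG x y f \<in> hom GG y x \<and>
        comp GG x y x f (inv GG x y f) = idn GG x \<and> comp GG y x y (inv GG x y f) f = idn GG y"
    if "f \<in> hom GG x y" "x \<in> V" "y \<in> V" for x y f
  proof -
    from that obtain p where p: "p \<in> path_space_set RR (Inl x) (Inl y)" "f = path_class RR (Inl x) (Inl y) p"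
      by (auto simp: pi_qtop_sel)
    then have e: "pathin RR p" "p 0 = Inl x" "p 1 = Inl y" by (auto simp: path_space_set_def)
    show ?thesis
      using p c[OF that(2)] c[OF that(3)] e
        path_class_eqI[OF join_const_left[OF e(1)]] path_class_eqI[OF join_const_right[OF e(1)]]
        path_class_eqI[OF join_rev_left[OF e(1)]] path_class_eqI[OF join_rev_right[OF e(1)]]
      by (simp add: pi_qtop_comp pi_qtop_inv rev_path_space_set pi_qtop_sel(2,3))
  qed
  have 3: "comp GG x y z f g \<in> hom GG x z" if "f \<in> hom GG x y" "g \<in> hom GG y z" for x y z f g
    using that by (auto simp: pi_qtop_sel(2) pi_qtop_comp join_path_space_set)
  have 4: "idn GG x \<in> hom GG x x" if "x \<in> V" for x
    using c[OF that] by (simp add: pi_qtop_sel)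
  show ?thesis
    unfolding groupoid_def pi_qtop_sel(1) by (intro conjI ballI) (simp_all only: 1 2 3 4)
qed

end

section \<open>Quotient topologies and the reflection\<close>

lemma continuous_map_pointwiseI:
  assumes "\<And>z. z \<in> topspace Z \<Longrightarrow> f z \<in> topspace Y"
    and "\<And>z W. z \<in> topspace Z \<Longrightarrow> openin Y W \<Longrightarrow> f z \<in> W \<Longrightarrow> \<exists>N. openin Z N \<and> z \<in> N \<and> f ` N \<subseteq> W"
  shows "continuous_map Z Y f"
  unfolding continuous_map_def
proof (intro conjI allI impI)
  show "f \<in> topspace Z \<rightarrow> topspace Y" using assms(1) by auto
  fix W assume W: "openin Y W"
  show "openin Z {x \<in> topspace Z. f x \<in> W}"
  proof (subst openin_subopen, intro ballI)
    fix z assume "z \<in> {x \<in> topspace Z. f x \<in> W}"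
    then obtain N where N: "openin Z N" "z \<in> N" "f ` N \<subseteq> W" using assms(2)[OF _ W] by blast
    with openin_subset[OF N(1)] show "\<exists>T. openin Z T \<and> z \<in> T \<and> T \<subseteq> {x \<in> topspace Z. f x \<in> W}"
      by (intro exI[of _ N]) auto
  qed
qed

text \<open>Lets a pointwise continuity proof use a formula that is valid only on an open piece
  \<open>S\<close>, as for rays away from the centre of a chart.\<close>

lemma continuous_map_open_subtopology_nbhd:
  assumes "openin Z S" "continuous_map (subtopology Z S) Y f" "z \<in> S" "openin Y W" "f z \<in> W"
  shows "\<exists>N. openin Z N \<and> z \<in> N \<and> N \<subseteq> S \<and> f ` N \<subseteq> W"
proof (intro exI conjI)
  let ?N = "{x \<in> topspace (subtopology Z S). f x \<in> W}"
  show "openin Z ?N"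
    using openin_continuous_map_preimage[OF assms(2,4)] assms(1) openin_trans_full by blast
  show "z \<in> ?N" using assms openin_subset[OF assms(1)] by auto
qed (use openin_subset[OF assms(1)] in auto)

text \<open>Generation adds no open sets, because preimages commute with intersections and
  unions.\<close>

lemma openin_quotient_top:
  "openin (quotient_top X f) U \<longleftrightarrow> U \<subseteq> f ` topspace X \<and> openin X {x \<in> topspace X. f x \<in> U}"
proof -
  define P where "P U \<longleftrightarrow> U \<subseteq> f ` topspace X \<and> openin X {x \<in> topspace X. f x \<in> U}" for U
  have "istopology P"
    unfolding istopology_def
  proof (intro conjI allI impI)
    fix S T assume "P S" "P T"
    moreover have "{x \<in> topspace X. f x \<in> S \<inter> T} = {x \<in> topspace X. f x \<in> S} \<inter> {x \<in> topspace X. f x \<in> T}"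
      by auto
    ultimately show "P (S \<inter> T)" unfolding P_def by auto
  next
    fix K assume K: "\<forall>k\<in>K. P k"
    have "{x \<in> topspace X. f x \<in> \<Union>K} = (\<Union>k\<in>K. {x \<in> topspace X. f x \<in> k})"
      by auto
    with K show "P (\<Union>K)" unfolding P_def by auto
  qed
  then have "openin (quotient_top X f) U \<longleftrightarrow> P U" for U
    unfolding quotient_top_def openin_topology_generated_by_iff P_def[symmetric]
    using generate_topology_on_coarsest[of P "{U. P U}" U] by (auto intro: generate_topology_on.Basis)
  then show ?thesis by (simp add: P_def)
qed

lemma topspace_quotient_top [simp]: "topspace (quotient_top X f) = f ` topspace X"
proof
  show "topspace (quotient_top X f) \<subseteq> f ` topspace X"
    using openin_quotient_top[of X f "topspace (quotient_top X f)"] by simp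
  have "openin (quotient_top X f) (f ` topspace X)"
    by (simp add: openin_quotient_top cong: conj_cong)
  then show "f ` topspace X \<subseteq> topspace (quotient_top X f)" by (rule openin_subset)
qed

lemma continuous_map_quotient_top: "continuous_map X (quotient_top X f) f"
  by (auto simp: continuous_map_def openin_quotient_top)

lemma continuous_map_from_quotient_top:
  assumes "continuous_map X Y (\<lambda>x. g (f x))"
  shows "continuous_map (quotient_top X f) Y g"
  unfolding continuous_map_def
proof (intro conjI allI impI)
  show "g \<in> topspace (quotient_top X f) \<rightarrow> topspace Y"
    using continuous_map_funspace[OF assms] by auto
  fix U assume "openin Y U"
  then have "openin X {x \<in> topspace X. g (f x) \<in> U}"
    by (rule openin_continuous_map_preimage[OF assms])
  moreover have "{x \<in> topspace X. g (f x) \<in> U} =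
    {x \<in> topspace X. f x \<in> {z \<in> topspace (quotient_top X f). g z \<in> U}}" by auto
  ultimately show "openin (quotient_top X f) {x \<in> topspace (quotient_top X f). g x \<in> U}"
    by (auto simp: openin_quotient_top)
qed

lemma groupoid_htop_update [simp]: "groupoid (G\<lparr>htop := T\<rparr>) \<longleftrightarrow> groupoid G"
  by (simp add: groupoid_def)

text \<open>The union of the topologies is a subbasis of their supremum, so continuity is tested on
  each of them; \<open>A \<noteq> {}\<close> is what puts the image into the topspace.\<close>

lemma continuous_map_topology_generated_by_Union:
  assumes "\<And>T. T \<in> A \<Longrightarrow> continuous_map X T f" "A \<noteq> {}" 
  shows "continuous_map X (topology_generated_by (\<Union>{{U. openin T U} | T. T \<in> A})) f"
proof (rule continuous_on_generated_topo)
  fix U assume "U \<in> \<Union>{{U. openin T U} | T. T \<in> A}"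
  then obtain T where "T \<in> A" "openin T U" by auto
  then have "openin X {x \<in> topspace X. f x \<in> U}"
    using assms(1) openin_continuous_map_preimage by blast
  then show "openin X (f -` U \<inter> topspace X)" by (simp add: vimage_def Int_def conj_commute)
next
  from assms(2) obtain T where "T \<in> A" by auto
  then have "topspace T \<in> \<Union>{{U. openin T U} | T. T \<in> A}" by blast
  moreover have "f ` topspace X \<subseteq> topspace T"
    using assms(1)[OF \<open>T \<in> A\<close>] by (rule continuous_map_image_subset_topspace)
  ultimately show "f ` topspace X \<subseteq> \<Union> (\<Union>{{U. openin T U} | T. T \<in> A})" by blast
qed

section \<open>The reflection as the supremum of the admissible families\<close>

locale tau_reflection =
  fixes G :: "('o,'m) tgpd"
  assumes groupoid: "groupoid G"
    and topspace_htop: "\<And>x y. x \<in> obj G \<Longrightarrow> y \<in> obj G \<Longrightarrow> topspace (htop G x y) = hom G x y"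
begin

definition admissible :: "('o \<Rightarrow> 'o \<Rightarrow> 'm topology) \<Rightarrow> bool" where
  "admissible T \<longleftrightarrow> (\<forall>a\<in>obj G. \<forall>b\<in>obj G. \<forall>U. openin (T a b) U \<longrightarrow> openin (htop G a b) U) \<and>
         top_groupoid (G\<lparr>htop := T\<rparr>)"

lemma tau_top_eq: "tau_top G x y = topology_generated_by (\<Union>{{U. openin T U} | T. T \<in> {T x y | T. admissible T}})"
  unfolding tau_top_def admissible_def by (rule arg_cong[where f=topology_generated_by]) auto

lemma admissible_topspace: "admissible T \<Longrightarrow> x \<in> obj G \<Longrightarrow> y \<in> obj G \<Longrightarrow> topspace (T x y) = hom G x y"
  by (simp add: admissible_def top_groupoid_def)

lemma groupoid_closed:
  "x \<in> obj G \<Longrightarrow> y \<in> obj G \<Longrightarrow> z \<in> obj G \<Longrightarrow> f \<in> hom G x y \<Longrightarrow> g \<in> hom G y z \<Longrightarrow> comp G x y z f g \<in> hom G x z"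
  "x \<in> obj G \<Longrightarrow> y \<in> obj G \<Longrightarrow> f \<in> hom G x y \<Longrightarrow> inv G x y f \<in> hom G y x"
  using groupoid by (simp_all add: groupoid_def)

text \<open>Makes the supremum \<open>tau_top\<close> run over a nonempty set of families, so that
  its topspaces are the full hom-sets.\<close>

lemma admissible_indiscrete: "admissible (\<lambda>x y. topology (\<lambda>U. U = {} \<or> U = hom G x y))"
proof -
  let ?T = "\<lambda>x y. topology (\<lambda>U. U = {} \<or> U = hom G x y)"
  have "istopology (\<lambda>U. U = {} \<or> U = A)" for A :: "'m set"
  proof -
    have "\<Union>K = {} \<or> \<Union>K = A" if "\<forall>k\<in>K. k = {} \<or> k = A" for K
      using that by (cases "A \<in> K") auto
    then show ?thesis unfolding istopology_def by auto
  qed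
  then have o: "openin (?T x y) U \<longleftrightarrow> U = {} \<or> U = hom G x y" for x y U by simp
  have t: "topspace (?T x y) = hom G x y" for x y
    using o[of x y] unfolding topspace_def by auto
  have c: "continuous_map X (?T x y) f" if f: "f \<in> topspace X \<rightarrow> hom G x y" for X :: "'c topology" and f x y
    unfolding continuous_map_def t
  proof (intro conjI allI impI f)
    fix U assume "openin (?T x y) U"
    then consider "U = {}" | "U = hom G x y" using o by blast
    then show "openin X {u \<in> topspace X. f u \<in> U}"
    proof cases
      case 2
      then have "{u \<in> topspace X. f u \<in> U} = topspace X" using f by auto
      then show ?thesis by simp
    qed simp
  qed
  have 1: "openin (htop G a b) U" if "a \<in> obj G" "b \<in> obj G" "openin (?T a b) U" for a b U
    using that openin_topspace[of "htop G a b"] by (auto simp only: o topspace_htop openin_empty)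
  have 2: "continuous_map (prod_topology (?T x y) (?T y z)) (?T x z) (\<lambda>(f, g). comp G x y z f g)"
    if "x \<in> obj G" "y \<in> obj G" "z \<in> obj G" for x y z
    by (rule c) (use that groupoid_closed in \<open>auto simp only: t topspace_prod_topology\<close>)
  have 3: "continuous_map (?T x y) (?T y x) (inv G x y)" if "x \<in> obj G" "y \<in> obj G" for x y
    by (rule c) (use that groupoid_closed in \<open>auto simp only: t\<close>)
  show ?thesis
    unfolding admissible_def top_groupoid_def
    by (intro conjI ballI allI impI) (simp_all add: groupoid t 2 3, rule 1)
qed

lemma continuous_map_into_tau_top:
  assumes "\<And>T. admissible T \<Longrightarrow> continuous_map X (T x y) f"
  shows "continuous_map X (tau_top G x y) f"
  unfolding tau_top_eq
  by (rule continuous_map_topology_generated_by_Union) (use assms admissible_indiscrete in auto)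

lemma openin_tau_topI: "admissible T \<Longrightarrow> openin (T x y) U \<Longrightarrow> openin (tau_top G x y) U"
  unfolding tau_top_eq by (rule topology_generated_by_Basis) blast

lemma topspace_tau_top:
  assumes "x \<in> obj G" "y \<in> obj G"
  shows "topspace (tau_top G x y) = hom G x y"
proof
  show "topspace (tau_top G x y) \<subseteq> hom G x y"
  proof
    fix f assume "f \<in> topspace (tau_top G x y)"
    then obtain T U where "admissible T" "openin (T x y) U" "f \<in> U"
      unfolding tau_top_eq topology_generated_by_topspace by blast
    then show "f \<in> hom G x y"
      using admissible_topspace[OF _ assms] openin_subset by blast
  qed
  show "hom G x y \<subseteq> topspace (tau_top G x y)"
    using openin_tau_topI[OF admissible_indiscrete openin_topspace, of x y]
    unfolding admissible_topspace[OF admissible_indiscrete assms] by (rule openin_subset)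
qed

lemma continuous_map_from_tau_top:
  assumes "admissible T" "x \<in> obj G" "y \<in> obj G"
  shows "continuous_map (tau_top G x y) (T x y) id"
  unfolding continuous_map_def topspace_tau_top[OF assms(2,3)] admissible_topspace[OF assms]
proof (intro conjI allI impI)
  fix U assume U: "openin (T x y) U"
  then have "{z \<in> hom G x y. id z \<in> U} = U"
    using openin_subset[OF U] admissible_topspace[OF assms] by auto
  then show "openin (tau_top G x y) {z \<in> hom G x y. id z \<in> U}"
    using openin_tau_topI[of T, OF assms(1) U] by simp
qed auto

text \<open>A supremum of groupoid topologies is again one: continuity into \<open>tau_top\<close>
  is tested at each admissible \<open>T\<close>, where composition and inversion are continuous
  already for the coarser topologies of \<open>T\<close> on the source.\<close>

theorem top_groupoid_tau: "top_groupoid (tau G)"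
proof -
  have "continuous_map (prod_topology (tau_top G x y) (tau_top G y z)) (tau_top G x z) (\<lambda>(f, g). comp G x y z f g)"
    if xyz: "x \<in> obj G" "y \<in> obj G" "z \<in> obj G" for x y z
  proof (rule continuous_map_into_tau_top)
    fix T assume T: "admissible T"
    have "continuous_map (prod_topology (T x y) (T y z)) (T x z) (\<lambda>(f, g). comp G x y z f g)"
      using T xyz by (simp add: admissible_def top_groupoid_def)
    moreover have "continuous_map (prod_topology (tau_top G x y) (tau_top G y z)) (prod_topology (T x y) (T y z)) (\<lambda>(f, g). (id f, id g))"
      using continuous_map_from_tau_top[OF T] xyz by (subst continuous_map_prod_top) auto
    ultimately have "continuous_map (prod_topology (tau_top G x y) (tau_top G y z)) (T x z)
        ((\<lambda>(f, g). comp G x y z f g) \<circ> (\<lambda>(f, g). (id f, id g)))"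
      by (rule continuous_map_compose[rotated])
    then show "continuous_map (prod_topology (tau_top G x y) (tau_top G y z)) (T x z) (\<lambda>(f, g). comp G x y z f g)"
      by (rule continuous_map_eq) auto
  qed
  moreover have "continuous_map (tau_top G x y) (tau_top G y x) (inv G x y)"
    if xy: "x \<in> obj G" "y \<in> obj G" for x y
  proof (rule continuous_map_into_tau_top)
    fix T assume T: "admissible T"
    then have "continuous_map (T x y) (T y x) (inv G x y)"
      using xy by (simp add: admissible_def top_groupoid_def)
    from continuous_map_compose[OF continuous_map_from_tau_top[OF T xy] this]
    show "continuous_map (tau_top G x y) (T y x) (inv G x y)" by simp
  qed
  ultimately show ?thesis
    unfolding top_groupoid_def tau_def using groupoid by (simp add: topspace_tau_top)
qed

text \<open>The unit of the reflection: every admissible topology is coarser than the given one,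
  hence so is their supremum.\<close>

lemma continuous_map_htop_tau:
  assumes "x \<in> obj G" "y \<in> obj G"
  shows "continuous_map (htop G x y) (htop (tau G) x y) id"
proof -
  have "continuous_map (htop G x y) (T x y) id" if "admissible T" for T
    unfolding continuous_map_def
  proof (intro conjI allI impI)
    show "id \<in> topspace (htop G x y) \<rightarrow> topspace (T x y)"
      using that assms by (simp add: admissible_topspace topspace_htop)
    fix U assume U: "openin (T x y) U"
    then have "openin (htop G x y) U" using that assms by (simp add: admissible_def)
    moreover have "{z \<in> topspace (htop G x y). id z \<in> U} = U"
      using openin_subset[OF calculation] by auto
    ultimately show "openin (htop G x y) {z \<in> topspace (htop G x y). id z \<in> U}" by simp
  qed
  then show ?thesis by (simp add: tau_def continuous_map_into_tau_top)
qed

theorem cont_functor_tau: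
  assumes F: "cont_functor G H F0 F1" and H: "top_groupoid H"
  shows "cont_functor (tau G) H F0 F1"
proof -
  define T where "T x y = pullback_topology (hom G x y) (F1 x y) (htop H (F0 x) (F0 y))" for x y
  have F0: "F0 x \<in> obj H" if "x \<in> obj G" for x
    using F that by (simp add: cont_functor_def)
  have Fc: "continuous_map (htop G x y) (htop H (F0 x) (F0 y)) (F1 x y)" if "x \<in> obj G" "y \<in> obj G" for x y
    using F that by (simp add: cont_functor_def)
  have Fcomp: "F1 x z (comp G x y z f g) = comp H (F0 x) (F0 y) (F0 z) (F1 x y f) (F1 y z g)"
    if "x \<in> obj G" "y \<in> obj G" "z \<in> obj G" "f \<in> hom G x y" "g \<in> hom G y z" for x y z f g
    using F that by (simp add: cont_functor_def)
  have Fid: "F1 x x (idn G x) = idn H (F0 x)" if "x \<in> obj G" for x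
    using F that by (simp add: cont_functor_def)
  have tH: "topspace (htop H (F0 x) (F0 y)) = hom H (F0 x) (F0 y)" if "x \<in> obj G" "y \<in> obj G" for x y
    using H F0 that by (simp add: top_groupoid_def)
  have Fh: "F1 x y f \<in> hom H (F0 x) (F0 y)" if "x \<in> obj G" "y \<in> obj G" "f \<in> hom G x y" for x y f
    using Fc[OF that(1,2)] that topspace_htop[OF that(1,2)] tH by (auto simp: continuous_map_def)
  have gH: "groupoid H" using H by (simp add: top_groupoid_def)
  \<comment> \<open>\<open>cont_functor\<close> has no clause for inverses. Uniqueness of inverses
    in \<open>H\<close> supplies it, and continuity of inversion for the pulled back topologies
    rests on it.\<close>
  have Finv: "F1 y x (inv G x y f) = inv H (F0 x) (F0 y) (F1 x y f)"
    if xy: "x \<in> obj G" "y \<in> obj G" and f: "f \<in> hom G x y" for x y f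
  proof -
    let ?i = "inv G x y f" and ?a = "F1 x y f"
    have i: "?i \<in> hom G y x" "comp G y x y ?i f = idn G y"
      using groupoid xy f by (simp_all add: groupoid_def)
    have Fi: "F1 y x ?i \<in> hom H (F0 y) (F0 x)" and a: "?a \<in> hom H (F0 x) (F0 y)"
      using Fh xy f i by auto
    let ?b = "inv H (F0 x) (F0 y) ?a"
    have b: "?b \<in> hom H (F0 y) (F0 x)" "comp H (F0 x) (F0 y) (F0 x) ?a ?b = idn H (F0 x)"
      using gH F0 xy a by (simp_all add: groupoid_def)
    have "F1 y x ?i = comp H (F0 y) (F0 x) (F0 x) (F1 y x ?i) (comp H (F0 x) (F0 y) (F0 x) ?a ?b)"
      using gH F0 xy Fi b by (simp add: groupoid_def)
    also have "\<dots> = comp H (F0 y) (F0 y) (F0 x) (comp H (F0 y) (F0 x) (F0 y) (F1 y x ?i) ?a) ?b"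
      using gH F0 xy Fi b a by (simp add: groupoid_def)
    also have "comp H (F0 y) (F0 x) (F0 y) (F1 y x ?i) ?a = idn H (F0 y)"
      using Fcomp[OF xy(2,1,2) i(1) f] i(2) Fid xy by simp
    also have "comp H (F0 y) (F0 y) (F0 x) (idn H (F0 y)) ?b = ?b"
      using gH F0 xy b by (simp add: groupoid_def)
    finally show ?thesis .
  qed
  have tT: "topspace (T x y) = hom G x y" if "x \<in> obj G" "y \<in> obj G" for x y
    using Fh tH that by (auto simp: T_def topspace_pullback_topology)
  have into: "continuous_map X (T x y) g" if "continuous_map X (htop H (F0 x) (F0 y)) (\<lambda>z. F1 x y (g z))"
     "g ` topspace X \<subseteq> hom G x y" for X :: "'z topology" and x y g
    unfolding T_def using that by (intro continuous_map_pullback') (auto simp: o_def)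
  have out: "continuous_map (T x y) (htop H (F0 x) (F0 y)) (F1 x y)" for x y
    unfolding T_def continuous_map_def topspace_pullback_topology openin_pullback_topology by auto
  have adm: "admissible T"
    unfolding admissible_def top_groupoid_def
  proof (intro conjI ballI allI impI, simp_all add: groupoid tT)
    fix a b U assume ab: "a \<in> obj G" "b \<in> obj G" and U: "openin (T a b) U"
    then obtain W where W: "openin (htop H (F0 a) (F0 b)) W" "U = F1 a b -` W \<inter> hom G a b"
      by (auto simp: T_def openin_pullback_topology)
    have "U = {x \<in> topspace (htop G a b). F1 a b x \<in> W}" using W(2) topspace_htop[OF ab] by auto
    with openin_continuous_map_preimage[OF Fc[OF ab] W(1)] show "openin (htop G a b) U" by simp
  next
    fix x y z assume xyz: "x \<in> obj G" "y \<in> obj G" "z \<in> obj G"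
    show "continuous_map (prod_topology (T x y) (T y z)) (T x z) (\<lambda>(f, g). comp G x y z f g)"
    proof (rule into)
      have "continuous_map (prod_topology (T x y) (T y z)) (prod_topology (htop H (F0 x) (F0 y)) (htop H (F0 y) (F0 z)))
        (\<lambda>(f, g). (F1 x y f, F1 y z g))"
        using out by (subst continuous_map_prod_top) auto
      moreover have "continuous_map (prod_topology (htop H (F0 x) (F0 y)) (htop H (F0 y) (F0 z))) (htop H (F0 x) (F0 z))
         (\<lambda>(f, g). comp H (F0 x) (F0 y) (F0 z) f g)"
        using H F0 xyz by (simp add: top_groupoid_def)
      ultimately have "continuous_map (prod_topology (T x y) (T y z)) (htop H (F0 x) (F0 z))
         ((\<lambda>(f, g). comp H (F0 x) (F0 y) (F0 z) f g) \<circ> (\<lambda>(f, g). (F1 x y f, F1 y z g)))"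
        by (rule continuous_map_compose)
      then show "continuous_map (prod_topology (T x y) (T y z)) (htop H (F0 x) (F0 z))
           (\<lambda>u. F1 x z (case u of (f, g) \<Rightarrow> comp G x y z f g))"
        by (rule continuous_map_eq) (use xyz in \<open>auto simp: tT Fcomp\<close>)
      show "(\<lambda>(f, g). comp G x y z f g) ` topspace (prod_topology (T x y) (T y z)) \<subseteq> hom G x z"
        using xyz by (auto simp: tT groupoid_closed)
    qed
  next
    fix x y assume xy: "x \<in> obj G" "y \<in> obj G"
    show "continuous_map (T x y) (T y x) (inv G x y)"
    proof (rule into)
      have "continuous_map (htop H (F0 x) (F0 y)) (htop H (F0 y) (F0 x)) (inv H (F0 x) (F0 y))"
        using H F0 xy by (simp add: top_groupoid_def)
      from continuous_map_compose[OF out this]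
      show "continuous_map (T x y) (htop H (F0 y) (F0 x)) (\<lambda>z. F1 y x (inv G x y z))"
        by (rule continuous_map_eq) (use xy in \<open>auto simp: tT Finv\<close>)
      show "inv G x y ` topspace (T x y) \<subseteq> hom G y x"
        using xy by (auto simp: tT groupoid_closed)
    qed
  qed
  then have "continuous_map (tau_top G x y) (htop H (F0 x) (F0 y)) (F1 x y)" if "x \<in> obj G" "y \<in> obj G" for x y
    using continuous_map_compose[OF continuous_map_from_tau_top[OF adm that] out] by simp
  then show ?thesis
    using F by (simp add: cont_functor_def tau_def)
qed

end

section \<open>Parallel transport for flat groupoid cocycles\<close>

lemma groupoidD:
  assumes "groupoid G"
  shows "x \<in> obj G \<Longrightarrow> idn G x \<in> hom G x x"
    and "x \<in> obj G \<Longrightarrow> y \<in> obj G \<Longrightarrow> z \<in> obj G \<Longrightarrow> f \<in> hom G x y \<Longrightarrow> g \<in> hom G y z \<Longrightarrow> comp G x y z f g \<in> hom G x z"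
    and "x \<in> obj G \<Longrightarrow> y \<in> obj G \<Longrightarrow> z \<in> obj G \<Longrightarrow> w \<in> obj G \<Longrightarrow> f \<in> hom G x y \<Longrightarrow> g \<in> hom G y z \<Longrightarrow> h \<in> hom G z w \<Longrightarrow>
        comp G x z w (comp G x y z f g) h = comp G x y w f (comp G y z w g h)"
    and "x \<in> obj G \<Longrightarrow> y \<in> obj G \<Longrightarrow> f \<in> hom G x y \<Longrightarrow> comp G x x y (idn G x) f = f"
    and "x \<in> obj G \<Longrightarrow> y \<in> obj G \<Longrightarrow> f \<in> hom G x y \<Longrightarrow> comp G x y y f (idn G y) = f"
    and "x \<in> obj G \<Longrightarrow> y \<in> obj G \<Longrightarrow> f \<in> hom G x y \<Longrightarrow> inv G x y f \<in> hom G y x"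
    and "x \<in> obj G \<Longrightarrow> y \<in> obj G \<Longrightarrow> f \<in> hom G x y \<Longrightarrow> comp G x y x f (inv G x y f) = idn G x"
    and "x \<in> obj G \<Longrightarrow> y \<in> obj G \<Longrightarrow> f \<in> hom G x y \<Longrightarrow> comp G y x y (inv G x y f) f = idn G y"
  using assms by (simp_all add: groupoid_def)

lemma pathin_nbhd:
  assumes p: "pathin X p" and W: "openin X W" and t: "t \<in> {0..1}" "p t \<in> W"
  obtains d where "d > 0" "\<And>t'. t' \<in> {0..1} \<Longrightarrow> \<bar>t' - t\<bar> < d \<Longrightarrow> p t' \<in> W"
proof -
  let ?S = "{x \<in> topspace (top_of_set {0..1}). p x \<in> W}"
  have "openin (top_of_set {0..1}) ?S"
    by (rule openin_continuous_map_preimage[OF _ W]) (use p in \<open>simp add: pathin_def\<close>)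
  moreover have "t \<in> ?S" using t by simp
  ultimately obtain d where "d > 0" "\<forall>t'\<in>{0..1}. dist t' t < d \<longrightarrow> t' \<in> ?S"
    unfolding openin_euclidean_subtopology_iff by blast
  then show ?thesis using that[of d] by (simp add: dist_real_def)
qed

text \<open>\<open>g c c' z\<close> turns a value in chart \<open>c\<close> into the value in chart
  \<open>c'\<close>. Flatness is asked only along paths, since the transitions of a graph may vary
  with the edge. No topology on \<open>H\<close> is fixed, so that transport can be studied for
  several of them.\<close>

locale flat_cocycle =
  fixes X :: "'a topology" and C :: "'c set" and U :: "'c \<Rightarrow> 'a set"
    and H :: "('o,'m) tgpd" and m :: "'c \<Rightarrow> 'o" and g :: "'c \<Rightarrow> 'c \<Rightarrow> 'a \<Rightarrow> 'm"
  assumes groupoid_H: "groupoid H"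
    and openin_U: "c \<in> C \<Longrightarrow> openin X (U c)"
    and cover: "z \<in> topspace X \<Longrightarrow> \<exists>c\<in>C. z \<in> U c"
    and m: "c \<in> C \<Longrightarrow> m c \<in> obj H"
    and g_hom: "\<lbrakk>c \<in> C; c' \<in> C; z \<in> U c; z \<in> U c'\<rbrakk> \<Longrightarrow> g c c' z \<in> hom H (m c) (m c')"
    and g_id: "\<lbrakk>c \<in> C; z \<in> U c\<rbrakk> \<Longrightarrow> g c c z = idn H (m c)"
    and cocycle: "\<lbrakk>c \<in> C; c' \<in> C; c'' \<in> C; z \<in> U c; z \<in> U c'; z \<in> U c''\<rbrakk> \<Longrightarrow>
      comp H (m c) (m c') (m c'') (g c c' z) (g c' c'' z) = g c c'' z"
    and flat: "\<lbrakk>pathin X p; 0 \<le> a; a \<le> b; b \<le> 1; c \<in> C; c' \<in> C; p ` {a..b} \<subseteq> U c \<inter> U c'\<rbrakk> \<Longrightarrow>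
      g c c' (p a) = g c c' (p b)"
begin

lemmas gpd = groupoidD[OF groupoid_H]

text \<open>A section carries one value for every chart that contains \<open>p t\<close>, all with
  source \<open>x\<close>; where \<open>p t\<close> is outside \<open>U c\<close>, the value
  \<open>S c t\<close> is arbitrary. Keeping all charts at once is what avoids a subdivision of the
  interval.\<close>

definition parallel :: "(real \<Rightarrow> 'a) \<Rightarrow> 'o \<Rightarrow> real \<Rightarrow> real \<Rightarrow> ('c \<Rightarrow> real \<Rightarrow> 'm) \<Rightarrow> bool" where
  "parallel p x a b S \<longleftrightarrow>
    (\<forall>c\<in>C. \<forall>t\<in>{a..b}. p t \<in> U c \<longrightarrow> S c t \<in> hom H x (m c)) \<and>
    (\<forall>c\<in>C. \<forall>c'\<in>C. \<forall>t\<in>{a..b}. p t \<in> U c \<longrightarrow> p t \<in> U c' \<longrightarrow>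
        S c' t = comp H x (m c) (m c') (S c t) (g c c' (p t))) \<and>
    (\<forall>c\<in>C. \<forall>t t'. a \<le> t \<longrightarrow> t \<le> t' \<longrightarrow> t' \<le> b \<longrightarrow> p ` {t..t'} \<subseteq> U c \<longrightarrow> S c t = S c t')"

lemma parallelD:
  assumes "parallel p x a b S" "c \<in> C"
  shows "\<lbrakk>a \<le> t; t \<le> b; p t \<in> U c\<rbrakk> \<Longrightarrow> S c t \<in> hom H x (m c)"
    and "\<lbrakk>a \<le> t; t \<le> b; p t \<in> U c; p t \<in> U c'; c' \<in> C\<rbrakk> \<Longrightarrow> S c' t = comp H x (m c) (m c') (S c t) (g c c' (p t))"
    and "\<lbrakk>a \<le> t; t \<le> t'; t' \<le> b; p ` {t..t'} \<subseteq> U c\<rbrakk> \<Longrightarrow> S c t = S c t'"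
proof -
  show "S c t \<in> hom H x (m c)" if "a \<le> t" "t \<le> b" "p t \<in> U c"
    using assms(1)[unfolded parallel_def, THEN conjunct1] assms(2) that by simp
  show "S c' t = comp H x (m c) (m c') (S c t) (g c c' (p t))"
    if "a \<le> t" "t \<le> b" "p t \<in> U c" "p t \<in> U c'" "c' \<in> C"
    using assms(1)[unfolded parallel_def, THEN conjunct2, THEN conjunct1] assms(2) that(3-5)
      atLeastAtMost_iff[THEN iffD2, OF conjI[OF that(1,2)]] by blast
  show "S c t = S c t'" if "a \<le> t" "t \<le> t'" "t' \<le> b" "p ` {t..t'} \<subseteq> U c"
    using assms(1)[unfolded parallel_def, THEN conjunct2, THEN conjunct2] assms(2) that by blast
qed

text \<open>Precomposition acts on sections because the transitions act on the other side. Together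
  with uniqueness it expresses every section through the one that starts at an identity.\<close>

lemma parallel_translate:
  assumes S: "parallel p x a b S" and h: "h \<in> hom H y x" and xy: "x \<in> obj H" "y \<in> obj H"
  shows "parallel p y a b (\<lambda>c t. comp H y x (m c) h (S c t))"
  unfolding parallel_def
proof (intro conjI ballI allI impI)
  fix c t assume "c \<in> C" "t \<in> {a..b}" "p t \<in> U c"
  then show "comp H y x (m c) h (S c t) \<in> hom H y (m c)"
    using parallelD(1)[OF S] by (intro gpd m xy h) auto
next
  fix c c' t assume c: "c \<in> C" "c' \<in> C" "t \<in> {a..b}" "p t \<in> U c" "p t \<in> U c'"
  then have "S c' t = comp H x (m c) (m c') (S c t) (g c c' (p t))" "S c t \<in> hom H x (m c)"
    using parallelD(1)[OF S c(1), of t] parallelD(2)[OF S c(1), of t c'] by auto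
  then show "comp H y x (m c') h (S c' t) = comp H y (m c) (m c') (comp H y x (m c) h (S c t)) (g c c' (p t))"
    using gpd(3)[OF xy(2,1) m[OF c(1)] m[OF c(2)] h _ g_hom[OF c(1,2,4,5)]] by simp
next
  fix c t t' assume "c \<in> C" "a \<le> t" "t \<le> t'" "t' \<le> b" "p ` {t..t'} \<subseteq> U c"
  then show "comp H y x (m c) h (S c t) = comp H y x (m c) h (S c t')"
    using parallelD(3)[OF S, of c t t'] by simp
qed

text \<open>Used to restrict a section along \<open>join_path p q\<close> to its two halves, which
  are affine images of [0,1].\<close>

lemma parallel_reparam:
  assumes S: "parallel p x a b S" and k: "k > 0" and eq: "\<And>t. a' \<le> t \<Longrightarrow> t \<le> b' \<Longrightarrow> q t = p (k * t + l)"
    and le: "a \<le> k * a' + l" "k * b' + l \<le> b"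
  shows "parallel q x a' b' (\<lambda>c t. S c (k * t + l))"
proof -
  have k_mono: "k * t \<le> k * t' \<longleftrightarrow> t \<le> t'" for t t' using k by simp
  have in': "a \<le> k * t + l" "k * t + l \<le> b" if "a' \<le> t" "t \<le> b'" for t
    using that le k_mono[of a' t] k_mono[of t b'] by linarith+
  have im: "p ` {k * t + l..k * t' + l} \<subseteq> U c" if "q ` {t..t'} \<subseteq> U c" "a' \<le> t" "t' \<le> b'" for c t t'
  proof
    fix z assume "z \<in> p ` {k * t + l..k * t' + l}"
    then obtain s where s: "z = p s" "k * t + l \<le> s" "s \<le> k * t' + l" by auto
    define s' where "s' = (s - l) / k"
    then have s': "s = k * s' + l" using k by simp
    then have "s' \<in> {t..t'}" using s k_mono[of t s'] k_mono[of s' t'] by auto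
    then show "z \<in> U c" using that eq[of s'] s s' by force
  qed
  show ?thesis
    unfolding parallel_def
  proof (intro conjI ballI allI impI)
    fix c t t' assume "c \<in> C" "a' \<le> t" "t \<le> t'" "t' \<le> b'" "q ` {t..t'} \<subseteq> U c"
    then show "S c (k * t + l) = S c (k * t' + l)"
      using im[of t t' c] in'[of t] in'[of t'] k_mono[of t t'] by (intro parallelD(3)[OF S]) auto
  next
    fix c t assume *: "c \<in> C" "t \<in> {a'..b'}" "q t \<in> U c"
    then show "S c (k * t + l) \<in> hom H x (m c)"
      using in'[of t] eq[of t] parallelD(1)[OF S *(1), of "k * t + l"] by simp
  next
    fix c c' t assume *: "c \<in> C" "c' \<in> C" "t \<in> {a'..b'}" "q t \<in> U c" "q t \<in> U c'"
    then show "S c' (k * t + l) = comp H x (m c) (m c') (S c (k * t + l)) (g c c' (q t))"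
      using in'[of t] eq[of t] parallelD(2)[OF S *(1), of "k * t + l" c'] by simp
  qed
qed

lemma parallel_exists_local:
  assumes p: "pathin X p" and ab: "0 \<le> a" "a \<le> b" "b \<le> 1" and c1: "c1 \<in> C" "p ` {a..b} \<subseteq> U c1"
    and c: "c \<in> C" "p a \<in> U c" and x: "x \<in> obj H" and h: "h \<in> hom H x (m c)"
  shows "\<exists>S. parallel p x a b S \<and> S c a = h"
proof -
  \<comment> \<open>Move the initial value from \<open>c\<close> to the chart \<open>c1\<close> that
    contains the whole piece, keep it constant there, and read it off in every other chart through
    \<open>g\<close>.\<close>
  let ?k = "comp H x (m c) (m c1) h (g c c1 (p a))"
  let ?S = "\<lambda>c' t. comp H x (m c1) (m c') ?k (g c1 c' (p t))"
  have pa: "p a \<in> U c1" using c1 ab by auto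
  have k: "?k \<in> hom H x (m c1)" using pa c c1 x h by (intro gpd m g_hom) auto
  have pU: "p t \<in> U c1" if "t \<in> {a..b}" for t using c1 that by auto
  have "?S c a = comp H x (m c) (m c) h (comp H (m c) (m c1) (m c) (g c c1 (p a)) (g c1 c (p a)))"
    using pa c c1 x h by (intro gpd m g_hom) auto
  then have *: "?S c a = h"
    using pa c c1 x h by (simp add: cocycle g_id gpd m)
  have "parallel p x a b ?S"
    unfolding parallel_def
  proof (intro conjI ballI allI impI)
    fix c' t assume "c' \<in> C" "t \<in> {a..b}" "p t \<in> U c'"
    then show "?S c' t \<in> hom H x (m c')"
      using pU c1 by (intro gpd m g_hom x k) auto
  next
    fix c' c'' t assume c': "c' \<in> C" "c'' \<in> C" "t \<in> {a..b}" "p t \<in> U c'" "p t \<in> U c''"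
    then have "comp H x (m c') (m c'') (?S c' t) (g c' c'' (p t)) =
      comp H x (m c1) (m c'') ?k (comp H (m c1) (m c') (m c'') (g c1 c' (p t)) (g c' c'' (p t)))"
      using pU[OF c'(3)] c1 by (intro gpd m g_hom x k) auto
    also have "\<dots> = ?S c'' t" using pU[OF c'(3)] c1 c' by (simp add: cocycle)
    finally show "?S c'' t = comp H x (m c') (m c'') (?S c' t) (g c' c'' (p t))" ..
  next
    fix c' t t' assume c': "c' \<in> C" "a \<le> t" "t \<le> t'" "t' \<le> b" "p ` {t..t'} \<subseteq> U c'"
    have "g c1 c' (p t) = g c1 c' (p t')"
      using c' ab pU by (intro flat[OF p _ _ _ c1(1) c'(1)]) auto
    then show "?S c' t = ?S c' t'" by simp
  qed
  with * show ?thesis by (intro exI[of _ ?S] conjI)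
qed

lemma parallel_glue:
  assumes S1: "parallel p x a b S1" and S2: "parallel p x b d S2" and ab: "a \<le> b" "b \<le> d"
    and c: "c \<in> C" "p b \<in> U c" and eq: "S1 c b = S2 c b"
  shows "parallel p x a d (\<lambda>c t. if t \<le> b then S1 c t else S2 c t)"
proof -
  \<comment> \<open>Agreement in one chart at the joint spreads to all charts through
    \<open>p b\<close>; it serves intervals that straddle \<open>b\<close>.\<close>
  have eq': "S1 c' b = S2 c' b" if "c' \<in> C" "p b \<in> U c'" for c'
    using parallelD(2)[OF S1 c(1) _ _ c(2) that(2,1)] parallelD(2)[OF S2 c(1) _ _ c(2) that(2,1)] eq ab by auto
  show ?thesis
    unfolding parallel_def
  proof (intro conjI ballI allI impI)
    fix c t t' assume *: "c \<in> C" "a \<le> t" "t \<le> t'" "t' \<le> d" "p ` {t..t'} \<subseteq> U c"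
    show "(if t \<le> b then S1 c t else S2 c t) = (if t' \<le> b then S1 c t' else S2 c t')"
    proof (cases "t \<le> b \<and> b < t'")
      case True
      then have "p ` {t..b} \<subseteq> U c" "p ` {b..t'} \<subseteq> U c" "p b \<in> U c" using * by auto
      then have "S1 c t = S1 c b" "S2 c b = S2 c t'"
        using * True parallelD(3)[OF S1, of c t b] parallelD(3)[OF S2, of c b t'] by auto
      with True eq'[OF *(1) \<open>p b \<in> U c\<close>] show ?thesis by simp
    next
      case False
      then show ?thesis
        using * parallelD(3)[OF S1, of c t t'] parallelD(3)[OF S2, of c t t'] by auto
    qed
  next
    fix c t assume *: "c \<in> C" "t \<in> {a..d}" "p t \<in> U c"
    then show "(if t \<le> b then S1 c t else S2 c t) \<in> hom H x (m c)"
      using parallelD(1)[OF S1 *(1), of t] parallelD(1)[OF S2 *(1), of t] by simp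
  next
    fix c c' t assume *: "c \<in> C" "c' \<in> C" "t \<in> {a..d}" "p t \<in> U c" "p t \<in> U c'"
    then show "(if t \<le> b then S1 c' t else S2 c' t) =
        comp H x (m c) (m c') (if t \<le> b then S1 c t else S2 c t) (g c c' (p t))"
      using parallelD(2)[OF S1 *(1), of t c'] parallelD(2)[OF S2 *(1), of t c'] by simp
  qed
qed

text \<open>\<open>Bolzano\<close> takes the place of a Lebesgue number: existence holds on short
  intervals and is additive. The statement ranges over all initial charts and values, so that the
  second piece can start where the first one ends.\<close>

lemma parallel_exists:
  assumes p: "pathin X p" and c: "c \<in> C" "p 0 \<in> U c" and x: "x \<in> obj H" and h: "h \<in> hom H x (m c)"
  shows "\<exists>S. parallel p x 0 1 S \<and> S c 0 = h"
proof -
  let ?Q = "\<lambda>a b. 0 \<le> a \<longrightarrow> a \<le> b \<longrightarrow> b \<le> 1 \<longrightarrow>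
    (\<forall>c\<in>C. p a \<in> U c \<longrightarrow> (\<forall>h\<in>hom H x (m c). \<exists>S. parallel p x a b S \<and> S c a = h))"
  have pX: "p t \<in> topspace X" if "t \<in> {0..1}" for t
    using p that by (auto simp: pathin_unit_iv continuous_map_def)
  have "?Q 0 1"
  proof (rule Bolzano[of 0 1 ?Q])
    fix a b d assume Q: "?Q a b" "?Q b d" and abd: "a \<le> b" "b \<le> d"
    show "?Q a d"
    proof (intro impI ballI)
      fix c h assume *: "0 \<le> a" "a \<le> d" "d \<le> 1" "c \<in> C" "p a \<in> U c" "h \<in> hom H x (m c)"
      have b: "0 \<le> b" "b \<le> 1" using abd * by auto
      from Q(1) * abd b obtain S1 where S1: "parallel p x a b S1" "S1 c a = h" by blast
      obtain c1 where c1: "c1 \<in> C" "p b \<in> U c1" using cover[OF pX[of b]] b by auto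
      have "S1 c1 b \<in> hom H x (m c1)" using parallelD(1)[OF S1(1) c1(1), of b] c1 abd by simp
      with Q(2) * b abd c1 obtain S2 where S2: "parallel p x b d S2" "S2 c1 b = S1 c1 b" by blast
      show "\<exists>S. parallel p x a d S \<and> S c a = h"
        using parallel_glue[OF S1(1) S2(1) abd c1 S2(2)[symmetric]] S1(2) abd by auto
    qed
  next
    fix t :: real assume t: "0 \<le> t" "t \<le> 1"
    obtain c1 where c1: "c1 \<in> C" "p t \<in> U c1" using cover[OF pX[of t]] t by auto
    obtain d where d: "d > 0" "\<And>t'. t' \<in> {0..1} \<Longrightarrow> \<bar>t' - t\<bar> < d \<Longrightarrow> p t' \<in> U c1"
      using pathin_nbhd[OF p openin_U[OF c1(1)] _ c1(2)] t by auto
    show "\<exists>d>0. \<forall>a b. a \<le> t \<and> t \<le> b \<and> b - a < d \<longrightarrow> ?Q a b"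
    proof (intro exI[of _ d] conjI d(1) allI impI ballI)
      fix a b c h assume *: "a \<le> t \<and> t \<le> b \<and> b - a < d" "0 \<le> a" "a \<le> b" "b \<le> 1" "c \<in> C" "p a \<in> U c" "h \<in> hom H x (m c)"
      then have "p ` {a..b} \<subseteq> U c1" by (auto intro!: d(2))
      with * c1 show "\<exists>S. parallel p x a b S \<and> S c a = h"
        by (intro parallel_exists_local[OF p _ _ _ c1(1)] x)
    qed
  qed simp
  with c h show ?thesis by auto
qed

lemma parallel_unique:
  assumes p: "pathin X p" and S: "parallel p x 0 1 S" and S': "parallel p x 0 1 S'"
    and c: "c \<in> C" "p 0 \<in> U c" "S c 0 = S' c 0" and c': "c' \<in> C" "p 1 \<in> U c'"
  shows "S c' 1 = S' c' 1"
proof -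
  \<comment> \<open>Agreement in all charts at time t. By the change of charts this equals agreement
    in one chart, so around each time a single chart decides, and in it both sections are
    constant.\<close>
  let ?A = "\<lambda>t. \<forall>c\<in>C. p t \<in> U c \<longrightarrow> S c t = S' c t"
  have pX: "p t \<in> topspace X" if "t \<in> {0..1}" for t
    using p that by (auto simp: pathin_unit_iv continuous_map_def)
  have A: "?A t" if "c \<in> C" "p t \<in> U c" "S c t = S' c t" "0 \<le> t" "t \<le> 1" for c t
  proof (intro ballI impI)
    fix c' assume c': "c' \<in> C" "p t \<in> U c'"
    have "S c' t = comp H x (m c) (m c') (S' c t) (g c c' (p t))"
      using parallelD(2)[OF S that(1,4,5,2) c'(2,1)] unfolding that(3) .
    also have "\<dots> = S' c' t"
      using parallelD(2)[OF S' that(1,4,5,2) c'(2,1)] by (rule sym)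
    finally show "S c' t = S' c' t" .
  qed
  have "?A 0 = ?A 1"
  proof (rule unit_interval_locally_constant)
    fix t :: real assume t: "t \<in> {0..1}"
    obtain c1 where c1: "c1 \<in> C" "p t \<in> U c1" using cover[OF pX[OF t]] by auto
    obtain d where d: "d > 0" "\<And>t'. t' \<in> {0..1} \<Longrightarrow> \<bar>t' - t\<bar> < d \<Longrightarrow> p t' \<in> U c1"
      using pathin_nbhd[OF p openin_U[OF c1(1)] t c1(2)] by auto
    show "\<exists>d>0. \<forall>t'\<in>{0..1}. \<bar>t' - t\<bar> < d \<longrightarrow> ?A t' = ?A t"
    proof (intro exI[of _ d] conjI d(1) ballI impI)
      fix t' assume t': "t' \<in> {0..1}" "\<bar>t' - t\<bar> < d"
      have "p ` {min t t'..max t t'} \<subseteq> U c1" using t t' by (auto intro!: d(2))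
      then have "S c1 (min t t') = S c1 (max t t')" "S' c1 (min t t') = S' c1 (max t t')"
        using t t' parallelD(3)[OF S c1(1), of "min t t'" "max t t'"] parallelD(3)[OF S' c1(1), of "min t t'" "max t t'"]
        by auto
      then have "S c1 t = S' c1 t \<longleftrightarrow> S c1 t' = S' c1 t'"
        by (auto simp: min_def max_def split: if_splits)
      then show "?A t' = ?A t"
        using A[OF c1] A[OF c1(1) d(2)[OF t']] c1 d(2)[OF t'] t t'(1) by (metis atLeastAtMost_iff)
    qed
  qed
  moreover have "?A 0" by (rule A[OF c]) auto
  ultimately show ?thesis using c' by metis
qed

text \<open>The section is picked by \<open>SOME\<close>; by \<open>parallel_unique\<close> its
  value at time 1 does not depend on the choice in any chart \<open>c'\<close> containing
  \<open>p 1\<close>.\<close>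

definition transport :: "(real \<Rightarrow> 'a) \<Rightarrow> 'c \<Rightarrow> 'c \<Rightarrow> 'm" where
  "transport p c c' = (SOME S. parallel p (m c) 0 1 S \<and> S c 0 = idn H (m c)) c' 1"

lemma transport_parallel:
  assumes p: "pathin X p" and c: "c \<in> C" "p 0 \<in> U c"
  obtains S where "parallel p (m c) 0 1 S" "S c 0 = idn H (m c)"
    "\<And>c'. transport p c c' = S c' 1"
proof -
  define T where "T = (SOME S. parallel p (m c) 0 1 S \<and> S c 0 = idn H (m c))"
  have "\<exists>S. parallel p (m c) 0 1 S \<and> S c 0 = idn H (m c)"
    using c m by (intro parallel_exists[OF p c]) (simp_all add: gpd)
  from someI_ex[OF this] have "parallel p (m c) 0 1 T \<and> T c 0 = idn H (m c)"
    by (simp add: T_def)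
  then show ?thesis using that[of T] by (simp add: transport_def T_def)
qed

text \<open>The means of computing transport: exhibit any section along \<open>p\<close> and compare
  its two ends.\<close>

lemma transport_eq:
  assumes p: "pathin X p" and S: "parallel p x 0 1 S" and x: "x \<in> obj H"
    and c: "c \<in> C" "p 0 \<in> U c" and c': "c' \<in> C" "p 1 \<in> U c'"
  shows "S c' 1 = comp H x (m c) (m c') (S c 0) (transport p c c')"
proof -
  obtain T where T: "parallel p (m c) 0 1 T" "T c 0 = idn H (m c)"
    and tr: "\<And>c'. transport p c c' = T c' 1"
    using transport_parallel[OF p c] by metis
  have h: "S c 0 \<in> hom H x (m c)" using parallelD(1)[OF S c(1)] c by auto
  have "S c' 1 = comp H x (m c) (m c') (S c 0) (T c' 1)"
    by (rule parallel_unique[OF p S parallel_translate[OF T(1) h m[OF c(1)] x] c _ c'])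
       (use T h x c m in \<open>simp add: gpd\<close>)
  then show ?thesis by (simp add: tr)
qed

lemma transport_hom:
  assumes p: "pathin X p" and c: "c \<in> C" "p 0 \<in> U c" and c': "c' \<in> C" "p 1 \<in> U c'"
  shows "transport p c c' \<in> hom H (m c) (m c')"
  using transport_parallel[OF p c] parallelD(1)[OF _ c'(1)] c'(2)
  by (metis order_refl zero_le_one)

lemma transport_in_chart:
  assumes p: "pathin X p" and c: "c \<in> C" "p ` {0..1} \<subseteq> U c" and c': "c' \<in> C" "p 1 \<in> U c'"
  shows "transport p c c' = g c c' (p 1)"
proof -
  have pc: "p 0 \<in> U c" "p 1 \<in> U c" using c by auto
  obtain S where S: "parallel p (m c) 0 1 S" "S c 0 = idn H (m c)" "\<And>c'. transport p c c' = S c' 1"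
    using transport_parallel[OF p c(1) pc(1)] by blast
  have "S c 1 = idn H (m c)" using parallelD(3)[OF S(1) c(1) _ _ _ c(2)] S(2) by simp
  moreover have "S c' 1 = comp H (m c) (m c) (m c') (S c 1) (g c c' (p 1))"
    using parallelD(2)[OF S(1) c(1) _ _ pc(2) c'(2,1)] by simp
  ultimately show ?thesis using S(3) c c' pc by (simp add: gpd m g_hom)
qed

lemma transport_join:
  assumes p: "pathin X p" and q: "pathin X q" and pq: "p 1 = q 0"
    and c: "c \<in> C" "p 0 \<in> U c" and c': "c' \<in> C" "p 1 \<in> U c'" and c'': "c'' \<in> C" "q 1 \<in> U c''"
  shows "transport (join_path p q) c c'' = comp H (m c) (m c') (m c'') (transport p c c') (transport q c' c'')"
proof -
  let ?j = "join_path p q"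
  have j: "pathin X ?j" "?j 0 = p 0" "?j 1 = q 1"
    using pathin_join[OF p q pq] by (auto simp: join_path_def)
  obtain S where S: "parallel ?j (m c) 0 1 S" "S c 0 = idn H (m c)" "\<And>c'. transport ?j c c' = S c' 1"
    using transport_parallel[OF j(1) c(1)] c(2) j(2) by metis
  \<comment> \<open>One section along the joined path restricts to both halves. The first
    restriction starts at the identity, the second at the transport along \<open>p\<close>, which
    \<open>transport_eq\<close> then splits off.\<close>
  have S1: "parallel p (m c) 0 1 (\<lambda>c t. S c (1/2 * t + 0))"
    by (rule parallel_reparam[OF S(1)]) (auto simp: join_path_def)
  have S2: "parallel q (m c) 0 1 (\<lambda>c t. S c (1/2 * t + 1/2))"
  proof (rule parallel_reparam[OF S(1)])
    show "q t = ?j (1/2 * t + 1/2)" if "0 \<le> t" "t \<le> 1" for t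
      using that join_path_right[of p q "1/2 * t + 1/2", OF pq] by simp
  qed auto
  have h: "S c' (1/2) \<in> hom H (m c) (m c')"
    using parallelD(1)[OF S1 c'(1), of 1] c' by simp
  have "S c' (1/2) = transport p c c'"
    using transport_eq[OF p S1 m[OF c(1)] c c'] transport_hom[OF p c c'] c c' S(2) by (simp add: gpd m)
  moreover have "S c'' 1 = comp H (m c) (m c') (m c'') (S c' (1/2)) (transport q c' c'')"
    using transport_eq[OF q S2 m[OF c(1)] c'(1) _ c''] c' pq by simp
  ultimately show ?thesis using S(3) by simp
qed

text \<open>Used with T the given hom-topologies (continuity of transport on the path space) and with
T discrete (homotopy invariance).\<close>

lemma transport_family_continuous:
  fixes Y :: "'s topology" and P :: "'s \<Rightarrow> real \<Rightarrow> 'a" and T :: "'o \<Rightarrow> 'o \<Rightarrow> 'm topology"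
  assumes comp_T: "\<And>x y z. \<lbrakk>x \<in> obj H; y \<in> obj H; z \<in> obj H\<rbrakk> \<Longrightarrow>
      continuous_map (prod_topology (T x y) (T y z)) (T x z) (\<lambda>(f, g). comp H x y z f g)"
    and top_T: "\<And>x y. \<lbrakk>x \<in> obj H; y \<in> obj H\<rbrakk> \<Longrightarrow> topspace (T x y) = hom H x y"
    and P: "\<And>s. s \<in> topspace Y \<Longrightarrow> pathin X (P s)"
    and joint: "\<And>s t W. \<lbrakk>s \<in> topspace Y; t \<in> {0..1}; openin X W; P s t \<in> W\<rbrakk> \<Longrightarrow>
      \<exists>N d. openin Y N \<and> s \<in> N \<and> d > 0 \<and> (\<forall>s'\<in>N. \<forall>t'\<in>{0..1}. \<bar>t' - t\<bar> < d \<longrightarrow> P s' t' \<in> W)"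
    and g_cont: "\<And>s t c c' W. \<lbrakk>s \<in> topspace Y; t \<in> {0..1}; c \<in> C; c' \<in> C; P s t \<in> U c; P s t \<in> U c';
        openin (T (m c) (m c')) W; g c c' (P s t) \<in> W\<rbrakk> \<Longrightarrow>
      \<exists>N. openin Y N \<and> s \<in> N \<and> (\<forall>s'\<in>N. P s' t \<in> U c \<and> P s' t \<in> U c' \<and> g c c' (P s' t) \<in> W)"
    and c0: "c0 \<in> C" "\<And>s. s \<in> topspace Y \<Longrightarrow> P s 0 \<in> U c0"
    and c1: "c1 \<in> C" "\<And>s. s \<in> topspace Y \<Longrightarrow> P s 1 \<in> U c1"
  shows "continuous_map Y (T (m c0) (m c1)) (\<lambda>s. transport (P s) c0 c1)"
proof -
  let ?x = "m c0"
  have "\<exists>S. parallel (P s) ?x 0 1 S \<and> S c0 0 = idn H ?x \<and> (\<forall>c'. transport (P s) c0 c' = S c' 1)"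
    if "s \<in> topspace Y" for s
    using transport_parallel[OF P[OF that] c0(1) c0(2)[OF that]] by metis
  then obtain S where S: "\<And>s. s \<in> topspace Y \<Longrightarrow> parallel (P s) ?x 0 1 (S s)"
    "\<And>s. s \<in> topspace Y \<Longrightarrow> S s c0 0 = idn H ?x"
    "\<And>s c'. s \<in> topspace Y \<Longrightarrow> transport (P s) c0 c' = S s c' 1"
    by metis
  have PX: "P s t \<in> topspace X" if "s \<in> topspace Y" "t \<in> {0..1}" for s t
    using P[OF that(1)] that(2) by (auto simp: pathin_unit_iv continuous_map_def)
  have x: "?x \<in> obj H" using m c0 by simp
  \<comment> \<open>Continuity at \<open>s\<close> of the value in chart \<open>c\<close> at the
    fixed time \<open>t\<close>, with a neighbourhood that may depend on \<open>W\<close>. It holds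
    at time 0, where the value in \<open>c0\<close> is a constant identity, and is then carried
    along the path.\<close>
  define near where "near s t c \<longleftrightarrow> (\<forall>W. openin (T ?x (m c)) W \<longrightarrow> S s c t \<in> W \<longrightarrow>
      (\<exists>N. openin Y N \<and> s \<in> N \<and> (\<forall>s'\<in>N. P s' t \<in> U c \<and> S s' c t \<in> W)))" for s t c
  have near_change: "near s t c'"
    if s: "s \<in> topspace Y" and t: "t \<in> {0..1}" and c: "c \<in> C" "P s t \<in> U c" and c': "c' \<in> C" "P s t \<in> U c'"
      and n: "near s t c" for s t c c'
    unfolding near_def
  proof (intro allI impI)
    fix W assume W: "openin (T ?x (m c')) W" "S s c' t \<in> W"
    let ?D = "prod_topology (T ?x (m c)) (T (m c) (m c'))"
    let ?f = "\<lambda>(f, g). comp H ?x (m c) (m c') f g"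
    \<comment> \<open>Near \<open>s\<close> the new value is a composite of the old value and the
      transition. Continuity of composition splits \<open>W\<close> into a rectangle of conditions
      on the two factors.\<close>
    have opn: "openin ?D {z \<in> topspace ?D. ?f z \<in> W}"
      using openin_continuous_map_preimage[OF comp_T W(1)] x m c c' by blast
    have "S s c' t = ?f (S s c t, g c c' (P s t))"
      using parallelD(2)[OF S(1)[OF s] c(1), of t c'] c c' t by simp
    moreover have "S s c t \<in> hom H ?x (m c)" using parallelD(1)[OF S(1)[OF s] c(1), of t] c t by simp
    moreover have "g c c' (P s t) \<in> hom H (m c) (m c')" using g_hom c c' by simp
    ultimately have "(S s c t, g c c' (P s t)) \<in> {z \<in> topspace ?D. ?f z \<in> W}"
      using W(2) top_T x m[OF c(1)] m[OF c'(1)] by simp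
    with opn[unfolded openin_prod_topology_alt]
    obtain A D where A: "openin (T ?x (m c)) A" "S s c t \<in> A"
      and D: "openin (T (m c) (m c')) D" "g c c' (P s t) \<in> D" and AD: "A \<times> D \<subseteq> {z \<in> topspace ?D. ?f z \<in> W}"
      by blast
    obtain N1 where N1: "openin Y N1" "s \<in> N1" "\<forall>s'\<in>N1. P s' t \<in> U c \<and> S s' c t \<in> A"
      using n A unfolding near_def by blast
    obtain N2 where N2: "openin Y N2" "s \<in> N2" "\<forall>s'\<in>N2. P s' t \<in> U c \<and> P s' t \<in> U c' \<and> g c c' (P s' t) \<in> D"
      using g_cont[OF s t c(1) c'(1) c(2) c'(2) D] by blast
    have "S s' c' t \<in> W" if "s' \<in> N1 \<inter> N2" for s'
    proof -
      have "s' \<in> topspace Y" using that N1(1) openin_subset by blast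
      then have "S s' c' t = ?f (S s' c t, g c c' (P s' t))"
        using parallelD(2)[OF S(1) c(1), of s' t c'] c' t that N2(3) by simp
      moreover have "(S s' c t, g c c' (P s' t)) \<in> A \<times> D" using that N1(3) N2(3) by auto
      ultimately show ?thesis using AD by auto
    qed
    then show "\<exists>N. openin Y N \<and> s \<in> N \<and> (\<forall>s'\<in>N. P s' t \<in> U c' \<and> S s' c' t \<in> W)"
      using N1 N2 by (intro exI[of _ "N1 \<inter> N2"]) auto
  qed
  have near1: "near s 1 c1" if s: "s \<in> topspace Y" for s
  proof -
    let ?A = "\<lambda>t. \<forall>c\<in>C. P s t \<in> U c \<longrightarrow> near s t c"
    have "?A 0 = ?A 1"
    proof (rule unit_interval_locally_constant)
      fix t :: real assume t: "t \<in> {0..1}"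
      obtain c where c: "c \<in> C" "P s t \<in> U c" using cover[OF PX[OF s t]] by auto
      obtain N d where N: "openin Y N" "s \<in> N" and d: "d > 0"
        and Nd: "\<And>s' t'. s' \<in> N \<Longrightarrow> t' \<in> {0..1} \<Longrightarrow> \<bar>t' - t\<bar> < d \<Longrightarrow> P s' t' \<in> U c"
        using joint[OF s t openin_U[OF c(1)] c(2)] by blast
      show "\<exists>d>0. \<forall>t'\<in>{0..1}. \<bar>t' - t\<bar> < d \<longrightarrow> ?A t' = ?A t"
      proof (intro exI[of _ d] conjI d ballI impI)
        fix t' assume t': "t' \<in> {0..1}" "\<bar>t' - t\<bar> < d"
        \<comment> \<open>Joint continuity gives one time interval that works for all parameters in
          \<open>N\<close>; in it every section is constant in chart \<open>c\<close>, so continuity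
          at \<open>t\<close> and at \<open>t'\<close> are equivalent.\<close>
        have same: "S s' c t' = S s' c t" if "s' \<in> N" for s'
        proof -
          have s': "s' \<in> topspace Y" using that N(1) openin_subset by blast
          have "P s' ` {min t t'..max t t'} \<subseteq> U c" using t t' that by (auto intro!: Nd)
          then have "S s' c (min t t') = S s' c (max t t')"
            using t t' by (intro parallelD(3)[OF S(1)[OF s'] c(1)]) auto
          then show ?thesis by (auto simp: min_def max_def split: if_splits)
        qed
        have tr: "near s t2 c" if n: "near s t1 c" and t2: "t2 \<in> {0..1}" "\<bar>t2 - t\<bar> < d"
          and e: "\<And>s'. s' \<in> N \<Longrightarrow> S s' c t1 = S s' c t2" for t1 t2
          unfolding near_def
        proof (intro allI impI)
          fix W assume "openin (T ?x (m c)) W" "S s c t2 \<in> W"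
          then obtain M where "openin Y M" "s \<in> M" "\<forall>s'\<in>M. P s' t1 \<in> U c \<and> S s' c t1 \<in> W"
            using n e[OF N(2)] unfolding near_def by metis
          then show "\<exists>N. openin Y N \<and> s \<in> N \<and> (\<forall>s'\<in>N. P s' t2 \<in> U c \<and> S s' c t2 \<in> W)"
            using N Nd[OF _ t2] e by (intro exI[of _ "M \<inter> N"]) auto
        qed
        have "near s t' c \<longleftrightarrow> near s t c"
          using tr[of t' t] tr[of t t'] t t' d same by auto
        moreover have "?A t \<longleftrightarrow> near s t c"
          using near_change[OF s t c] c by blast
        moreover have "?A t' \<longleftrightarrow> near s t' c"
          using near_change[OF s t'(1) c(1) Nd[OF N(2) t']] c(1) Nd[OF N(2) t'] by blast
        ultimately show "?A t' = ?A t" by simp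
      qed
    qed
    moreover have "near s 0 c0"
      unfolding near_def using S(2) s c0 by (auto intro!: exI[of _ "topspace Y"])
    then have "?A 0" using near_change[OF s _ c0(1) c0(2)[OF s]] by auto
    ultimately show ?thesis using c1 s by blast
  qed
  show ?thesis
  proof (rule continuous_map_pointwiseI)
    fix s assume s: "s \<in> topspace Y"
    show "transport (P s) c0 c1 \<in> topspace (T ?x (m c1))"
      using transport_hom[OF P[OF s] c0(1) c0(2)[OF s] c1(1) c1(2)[OF s]] top_T x m c1 by simp
    fix W assume W: "openin (T ?x (m c1)) W" "transport (P s) c0 c1 \<in> W"
    then obtain N where N: "openin Y N" "s \<in> N" "\<forall>s'\<in>N. P s' 1 \<in> U c1 \<and> S s' c1 1 \<in> W"
      using near1[OF s] unfolding near_def S(3)[OF s] by blast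
    have "transport (P s') c0 c1 \<in> W" if "s' \<in> N" for s'
      using S(3)[of s' c1] N that openin_subset[OF N(1)] by auto
    then show "\<exists>N. openin Y N \<and> s \<in> N \<and> (\<lambda>s. transport (P s) c0 c1) ` N \<subseteq> W"
      using N by blast
  qed
qed

end

section \<open>The realization\<close>

locale topological_graph =
  fixes V :: "'v set" and E :: "'e topology" and d0 d1 :: "'e \<Rightarrow> 'v"
  assumes top_graph: "top_graph V E d0 d1"
begin

abbreviation "R \<equiv> realization V E d0 d1"
abbreviation "B \<equiv> vertex_nbhd E d0 d1"

lemma endpoints_in_V: "e \<in> topspace E \<Longrightarrow> d0 e \<in> V" "e \<in> topspace E \<Longrightarrow> d1 e \<in> V"
  using top_graph by (auto simp: top_graph_def continuous_map_def)

lemma openin_endpoint: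
  "openin E {e \<in> topspace E. d0 e = x}" "openin E {e \<in> topspace E. d1 e = x}"
proof -
  have "openin E {e \<in> topspace E. d e = x}" if d: "continuous_map E (discrete_topology V) d" for d
  proof (cases "x \<in> V")
    case True
    then show ?thesis
      using openin_continuous_map_preimage[OF d, of "{x}"] by simp
  next
    case False
    then have "{e \<in> topspace E. d e = x} = {}" using continuous_map_funspace[OF d] by auto
    then show ?thesis by (simp only: openin_empty)
  qed
  then show "openin E {e \<in> topspace E. d0 e = x}" "openin E {e \<in> topspace E. d1 e = x}"
    using top_graph by (auto simp: top_graph_def)
qed

lemma openin_edges_between: "openin E (edges_between E d0 d1 x y)"
proof -
  have "edges_between E d0 d1 x y = {e \<in> topspace E. d0 e = x} \<inter> {e \<in> topspace E. d1 e = y}"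
    by (auto simp: edges_between_def)
  then show ?thesis using openin_endpoint by auto
qed

text \<open>A direct criterion for openness in |Gamma|, shown equal to the generated topology in
  \<open>openin_realization\<close>: stars at the vertices, and the ordinary product topology on the
  open edges. Intervals and open sets of a single Gamma(x,y) suffice as edge neighbourhoods because
  each Gamma(x,y) is open in the edge space.\<close>

definition real_open :: "('v,'e) rpt set \<Rightarrow> bool" where
  "real_open W \<longleftrightarrow> W \<subseteq> real_points V E \<and>
     (\<forall>x. Inl x \<in> W \<longrightarrow> (\<exists>r>0. r < 1 \<and> B x r \<subseteq> W)) \<and>
     openin (prod_topology E euclideanreal) {z. Inr z \<in> W}"

lemma real_open_vertex_nbhd:
  assumes "x \<in> V" "0 < r" "r < 1"
  shows "real_open (B x r)"
  unfolding real_open_def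
proof (intro conjI allI impI)
  show "B x r \<subseteq> real_points V E" using assms by (auto simp: vertex_nbhd_def real_points_def)
  show "\<exists>s>0. s < 1 \<and> B y s \<subseteq> B x r" if "Inl y \<in> B x r" for y
    using that assms by (intro exI[of _ r]) (auto simp: vertex_nbhd_def)
  have "{z. Inr z \<in> B x r} = {e \<in> topspace E. d0 e = x} \<times> {0<..<r} \<union> {e \<in> topspace E. d1 e = x} \<times> {1-r<..<1}"
    by (auto simp: vertex_nbhd_def)
  then show "openin (prod_topology E euclideanreal) {z. Inr z \<in> B x r}"
    using openin_endpoint by (auto simp: openin_prod_Times_iff)
qed

lemma istopology_real_open: "istopology real_open"
  unfolding istopology_def
proof (intro conjI allI impI)
  fix S T assume S: "real_open S" and T: "real_open T"
  show "real_open (S \<inter> T)"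
    unfolding real_open_def
  proof (intro conjI allI impI)
    show "S \<inter> T \<subseteq> real_points V E" using S by (auto simp: real_open_def)
    fix x assume "Inl x \<in> S \<inter> T"
    with S T obtain r s where "r > 0" "r < 1" "B x r \<subseteq> S" "s > 0" "s < 1" "B x s \<subseteq> T"
      unfolding real_open_def by blast
    moreover have "B x (min r s) \<subseteq> B x r" "B x (min r s) \<subseteq> B x s" by (auto simp: vertex_nbhd_def)
    ultimately show "\<exists>r>0. r < 1 \<and> B x r \<subseteq> S \<inter> T"
      by (intro exI[of _ "min r s"]) auto
  next
    have "{z. Inr z \<in> S \<inter> T} = {z. Inr z \<in> S} \<inter> {z. Inr z \<in> T}" by auto
    then show "openin (prod_topology E euclideanreal) {z. Inr z \<in> S \<inter> T}"
      using S T by (auto simp: real_open_def)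
  qed
next
  fix K assume K: "\<forall>k\<in>K. real_open k"
  show "real_open (\<Union>K)"
    unfolding real_open_def
  proof (intro conjI allI impI)
    show "\<Union>K \<subseteq> real_points V E" using K by (auto simp: real_open_def)
    fix x assume "Inl x \<in> \<Union>K"
    with K show "\<exists>r>0. r < 1 \<and> B x r \<subseteq> \<Union>K" unfolding real_open_def by (meson UnionE Union_upper order_trans)
  next
    have "{z. Inr z \<in> \<Union>K} = (\<Union>k\<in>K. {z. Inr z \<in> k})" by auto
    then show "openin (prod_topology E euclideanreal) {z. Inr z \<in> \<Union>K}"
      using K by (auto simp: real_open_def)
  qed
qed

lemma openin_vertex_nbhd: "x \<in> V \<Longrightarrow> 0 < r \<Longrightarrow> r < 1 \<Longrightarrow> openin R (B x r)"
  unfolding realization_def by (rule topology_generated_by_Basis) blast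

lemma openin_Inr:
  assumes W: "openin (prod_topology E euclideanreal) W" and sub: "W \<subseteq> topspace E \<times> {0<..<1}"
  shows "openin R (Inr ` W)"
proof (subst openin_subopen, intro ballI)
  fix z :: "('v,'e) rpt" assume "z \<in> Inr ` W"
  then obtain e t where z: "z = Inr (e, t)" and et: "(e, t) \<in> W" by auto
  from W et obtain A C where A: "openin E A" "e \<in> A" and C: "open C" "t \<in> C" and AC: "A \<times> C \<subseteq> W"
    unfolding openin_prod_topology_alt by force
  have t: "0 < t" "t < 1" and e: "e \<in> topspace E" using et sub by auto
  have "open (C \<inter> {0<..<1})" "t \<in> C \<inter> {0<..<1}" using C t by auto
  then obtain d where d: "d > 0" "ball t d \<subseteq> C \<inter> {0<..<1}" using openE by blast
  let ?U = "A \<inter> edges_between E d0 d1 (d0 e) (d1 e)"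
  let ?N = "{Inr (e', t') | e' t'. e' \<in> ?U \<and> t - d/2 < t' \<and> t' < t + d/2} :: ('v,'e) rpt set"
  \<comment> \<open>A basic edge neighbourhood has 0 < a and b < 1 strictly. Half the radius ensures
    this, while t - d and t + d could be 0 and 1.\<close>
  have "t - d/2 \<in> ball t d" "t + d/2 \<in> ball t d" using d(1) by (auto simp: dist_real_def)
  then have "t - d/2 \<in> {0<..<1}" "t + d/2 \<in> {0<..<1}" using d(2) by blast+
  then have b: "0 < t - d/2" "t + d/2 < 1" "t - d/2 < t + d/2" using d(1) by auto
  have "openin (subtopology E (edges_between E d0 d1 (d0 e) (d1 e))) ?U"
    using A(1) by (simp add: openin_subtopology_Int)
  then have "openin R ?N"
    unfolding realization_def using endpoints_in_V[OF e] b by (intro topology_generated_by_Basis) blast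
  moreover have "z \<in> ?N"
    using z A(2) e d(1) by (auto simp: edges_between_def)
  moreover have "?N \<subseteq> Inr ` W"
  proof
    fix w assume "w \<in> ?N"
    then obtain e' t' where w: "w = Inr (e', t')" "e' \<in> A" "t - d/2 < t'" "t' < t + d/2" by auto
    then have "t' \<in> ball t d" using d(1) by (auto simp: dist_real_def abs_if)
    then have "(e', t') \<in> W" using w(2) AC d(2) by blast
    then show "w \<in> Inr ` W" using w(1) by simp
  qed
  ultimately show "\<exists>T. openin R T \<and> z \<in> T \<and> T \<subseteq> Inr ` W" by blast
qed

lemma openin_realization: "openin R W \<longleftrightarrow> real_open W"
proof
  assume "openin R W"
  then have "generate_topology_on ({vertex_nbhd E d0 d1 x r | x r. x \<in> V \<and> 0 < r \<and> r < 1}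
      \<union> {{Inr (e, t) | e t. e \<in> U \<and> a < t \<and> t < b} | U a b x y.
           x \<in> V \<and> y \<in> V \<and> openin (subtopology E (edges_between E d0 d1 x y)) U \<and>
           0 < a \<and> a < b \<and> b < 1}) W"
    unfolding realization_def openin_topology_generated_by_iff .
  then show "real_open W"
  proof (rule generate_topology_on_coarsest[OF istopology_real_open, rotated])
    fix S :: "('v,'e) rpt set"
    assume "S \<in> {vertex_nbhd E d0 d1 x r | x r. x \<in> V \<and> 0 < r \<and> r < 1}
      \<union> {{Inr (e, t) | e t. e \<in> U \<and> a < t \<and> t < b} | U a b x y.
           x \<in> V \<and> y \<in> V \<and> openin (subtopology E (edges_between E d0 d1 x y)) U \<and>
           0 < a \<and> a < b \<and> b < 1}"
    then consider (v) x r where "x \<in> V" "0 < r" "r < 1" "S = B x r"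
      | (e) U a b x y where "openin (subtopology E (edges_between E d0 d1 x y)) U" "0 < a" "a < b" "b < 1"
         "S = {Inr (e, t) | e t. e \<in> U \<and> a < t \<and> t < b}" by blast
    then show "real_open S"
    proof cases
      case v
      then show ?thesis using real_open_vertex_nbhd by simp
    next
      case e
      then have U: "openin E U" using openin_edges_between openin_trans_full by blast
      have "{z. Inr z \<in> S} = U \<times> {a<..<b}" using e by auto
      then show ?thesis
        using e U openin_subset[OF U] unfolding real_open_def
        by (auto simp: openin_prod_Times_iff real_points_def)
    qed
  qed
next
  assume W: "real_open W"
  show "openin R W"
  proof (subst openin_subopen, intro ballI)
    fix z assume z: "z \<in> W"
    show "\<exists>T. openin R T \<and> z \<in> T \<and> T \<subseteq> W"
    proof (cases z)
      case (Inl x)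
      with z W obtain r where "r > 0" "r < 1" "B x r \<subseteq> W" "x \<in> V"
        unfolding real_open_def real_points_def by blast
      then show ?thesis
        using Inl openin_vertex_nbhd[of x r] by (intro exI[of _ "B x r"]) (simp add: vertex_nbhd_def)
    next
      case (Inr w)
      have "openin R (Inr ` {z. Inr z \<in> W})"
        using W by (intro openin_Inr) (auto simp: real_open_def real_points_def)
      then show ?thesis using Inr z by (intro exI[of _ "Inr ` {z. Inr z \<in> W}"]) auto
    qed
  qed
qed

lemma topspace_realization [simp]: "topspace R = real_points V E"
proof -
  have "{z. Inr z \<in> real_points V E} = topspace E \<times> {0<..<1}"
    by (auto simp: real_points_def)
  moreover have "B x (1/2) \<subseteq> real_points V E" if "x \<in> V" for x
    using that by (auto simp: vertex_nbhd_def real_points_def)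
  moreover have "\<exists>r>0. r < 1 \<and> B x r \<subseteq> real_points V E" if "Inl x \<in> real_points V E" for x
    using that calculation(2)[of x] by (intro exI[of _ "1/2"]) (auto simp: real_points_def)
  ultimately have "real_open (real_points V E)"
    unfolding real_open_def by (simp add: openin_prod_Times_iff)
  then show ?thesis
    by (metis openin_realization openin_subset openin_topspace real_open_def subset_antisym)
qed

lemma vertex_nbhd_basis:
  assumes "openin R W" "Inl x \<in> W"
  obtains r where "0 < r" "r < 1" "B x r \<subseteq> W"
  using assms unfolding openin_realization real_open_def by blast

lemma continuous_map_Inr_coordinates:
  "continuous_map (subtopology R (range Inr)) (prod_topology E euclideanreal) projr"
  unfolding continuous_map_def
proof (intro conjI allI impI)
  show "projr \<in> topspace (subtopology R (range Inr)) \<rightarrow> topspace (prod_topology E euclideanreal)"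
    by (auto simp: real_points_def)
  fix W assume W: "openin (prod_topology E euclideanreal) W"
  have "{z \<in> topspace (subtopology R (range Inr)). projr z \<in> W} = Inr ` (W \<inter> topspace E \<times> {0<..<1})"
    by (auto simp: real_points_def)
  moreover have "openin R (Inr ` (W \<inter> topspace E \<times> {0<..<1}))"
    using W by (intro openin_Inr openin_Int) (auto simp: openin_prod_Times_iff)
  ultimately show "openin (subtopology R (range Inr)) {z \<in> topspace (subtopology R (range Inr)). projr z \<in> W}"
    by (auto simp: openin_subtopology)
qed

section \<open>Edges as paths in the realization\<close>

lemma openin_prod_unit_iv:
  assumes "openin E A" "open C"
  shows "openin (prod_topology E unit_iv) (A \<times> (C \<inter> {0..1}))"
  using assms by (auto simp: openin_prod_Times_iff unit_iv_def openin_subtopology)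

lemma edge_path_in_vertex_nbhd:
  assumes "e \<in> topspace E" "t \<in> {0..1}" "d0 e = x \<and> t < r \<or> d1 e = x \<and> 1 - r < t" "r < 1"
  shows "edge_path d0 d1 e t \<in> B x r"
  using assms by (auto simp: edge_path_def vertex_nbhd_def)

text \<open>The canonical map from the edge space times [0,1] to |Gamma|. At an end vertex a whole
  strip over the open fibre of \<open>d0\<close> or \<open>d1\<close> lands in a star; elsewhere the
  map is the inclusion of an open product.\<close>

lemma continuous_map_edge_path_pair:
  "continuous_map (prod_topology E unit_iv) R (\<lambda>(e, t). edge_path d0 d1 e t)"
proof (rule continuous_map_pointwiseI)
  fix z assume "z \<in> topspace (prod_topology E unit_iv)"
  then obtain e t where z: "z = (e, t)" "e \<in> topspace E" "t \<in> {0..1}" by auto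
  then show "(case z of (e, t) \<Rightarrow> edge_path d0 d1 e t) \<in> topspace R"
    using endpoints_in_V by (auto simp: edge_path_def real_points_def)
  fix W assume W: "openin R W" and "(case z of (e, t) \<Rightarrow> edge_path d0 d1 e t) \<in> W"
  then have zW: "edge_path d0 d1 e t \<in> W" using z by simp
  let ?P = "\<lambda>N. openin (prod_topology E unit_iv) N \<and> z \<in> N \<and> (\<lambda>(e, t). edge_path d0 d1 e t) ` N \<subseteq> W"
  consider "t = 0" | "t = 1" | "0 < t" "t < 1" using z(3) by fastforce
  then show "\<exists>N. ?P N"
  proof cases
    case 1
    then have "Inl (d0 e) \<in> W" using zW by (simp add: edge_path_def)
    from vertex_nbhd_basis[OF W this] obtain r where r: "0 < r" "r < 1" "B (d0 e) r \<subseteq> W" .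
    have "?P ({e' \<in> topspace E. d0 e' = d0 e} \<times> ({..<r} \<inter> {0..1}))"
      using openin_prod_unit_iv[OF openin_endpoint(1)] z r 1
        edge_path_in_vertex_nbhd[where x="d0 e" and r=r] by (auto 0 3)
    then show ?thesis ..
  next
    case 2
    then have "Inl (d1 e) \<in> W" using zW by (simp add: edge_path_def)
    from vertex_nbhd_basis[OF W this] obtain r where r: "0 < r" "r < 1" "B (d1 e) r \<subseteq> W" .
    have "?P ({e' \<in> topspace E. d1 e' = d1 e} \<times> ({1-r<..} \<inter> {0..1}))"
      using openin_prod_unit_iv[OF openin_endpoint(2)] z r 2
        edge_path_in_vertex_nbhd[where x="d1 e" and r=r] by (auto 0 3)
    then show ?thesis ..
  next
    case 3
    let ?N = "{z. Inr z \<in> W}"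
    have N: "openin (prod_topology E euclideanreal) ?N" "?N \<subseteq> topspace E \<times> {0<..<1}"
      using W by (auto simp: openin_realization real_open_def real_points_def)
    have "prod_topology E unit_iv = subtopology (prod_topology E euclideanreal) (topspace E \<times> {0..1})"
      using prod_topology_subtopology(2)[of E euclideanreal "{0..1}"]
      by (simp add: unit_iv_def)
    moreover have "?N = ?N \<inter> (topspace E \<times> {0..1})" using N(2) by auto
    ultimately have "openin (prod_topology E unit_iv) ?N"
      using N(1) by (metis openin_subtopology)
    moreover have "z \<in> ?N" using zW 3 z by (simp add: edge_path_def)
    moreover have "(\<lambda>(e, t). edge_path d0 d1 e t) ` ?N \<subseteq> W"
      using N(2) by (force simp: edge_path_def)
    ultimately show ?thesis by blast
  qed
qed

lemma pathin_edge_path: "e \<in> topspace E \<Longrightarrow> pathin R (edge_path d0 d1 e)"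
proof -
  assume e: "e \<in> topspace E"
  have "continuous_map unit_iv (prod_topology E unit_iv) (\<lambda>t. (e, t))"
    using e unfolding continuous_map_pairwise o_def fst_conv snd_conv by simp
  from continuous_map_compose[OF this continuous_map_edge_path_pair]
  show ?thesis by (simp add: o_def pathin_unit_iv)
qed

lemma edge_path_space_set:
  "e \<in> edges_between E d0 d1 x y \<Longrightarrow> edge_path d0 d1 e \<in> path_space_set R (Inl x) (Inl y)"
  using pathin_edge_path by (auto simp: path_space_set_def edges_between_def edge_path_def)

end

section \<open>The compact-open topology\<close>

lemma topspace_compact_open_paths [simp]: "topspace (compact_open_paths X x y) = path_space_set X x y"
proof -
  have "path_space_set X x y \<in> {{p \<in> path_space_set X x y. p ` K \<subseteq> U} | K U. compactin unit_iv K \<and> openin X U}"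
    by (intro CollectI exI[of _ "{}"]) auto
  then show ?thesis
    unfolding compact_open_paths_def topology_generated_by_topspace by blast
qed

text \<open>The currying half of the exponential law: by the tube lemma, an open set that contains
  {s} times the compact \<open>K\<close> contains a neighbourhood of \<open>s\<close> times
  \<open>K\<close>.\<close>

lemma continuous_map_into_compact_open_paths:
  assumes F: "continuous_map (prod_topology Y unit_iv) X (\<lambda>(s, t). F s t)"
    and path: "\<And>s. s \<in> topspace Y \<Longrightarrow> F s \<in> path_space_set X x y"
  shows "continuous_map Y (compact_open_paths X x y) F"
  unfolding compact_open_paths_def
proof (rule continuous_on_generated_topo)
  fix S assume "S \<in> {{p \<in> path_space_set X x y. p ` K \<subseteq> U} | K U. compactin unit_iv K \<and> openin X U}"
  then obtain K U where K: "compactin unit_iv K" and U: "openin X U"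
    and S: "S = {p \<in> path_space_set X x y. p ` K \<subseteq> U}" by blast
  let ?W = "{z \<in> topspace (prod_topology Y unit_iv). (case z of (s, t) \<Rightarrow> F s t) \<in> U}"
  have W: "openin (prod_topology Y unit_iv) ?W" by (rule openin_continuous_map_preimage[OF F U])
  show "openin Y (F -` S \<inter> topspace Y)"
  proof (subst openin_subopen, intro ballI)
    fix s assume s: "s \<in> F -` S \<inter> topspace Y"
    have sY: "s \<in> topspace Y" and sK: "{s} \<times> K \<subseteq> ?W"
      using s S compactin_subset_topspace[OF K] by auto
    obtain N M where N: "openin Y N" "s \<in> N" "K \<subseteq> M" "N \<times> M \<subseteq> ?W"
      using tube_lemma_right[OF W K sY sK] by blast
    have "F s' \<in> S" if "s' \<in> N" for s'
    proof -
      have "F s' t \<in> U" if "t \<in> K" for t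
      proof -
        have "(s', t) \<in> N \<times> M" using N(3) that \<open>s' \<in> N\<close> by auto
        then have "(s', t) \<in> ?W" using N(4) by (rule subsetD[rotated])
        then show ?thesis by simp
      qed
      then show ?thesis using path[of s'] that openin_subset[OF N(1)] by (auto simp: S)
    qed
    then have "N \<subseteq> F -` S \<inter> topspace Y"
      using openin_subset[OF N(1)] by auto
    with N show "\<exists>T. openin Y T \<and> s \<in> T \<and> T \<subseteq> F -` S \<inter> topspace Y" by blast
  qed
next
  show "F ` topspace Y \<subseteq> \<Union> {{p \<in> path_space_set X x y. p ` K \<subseteq> U} | K U. compactin unit_iv K \<and> openin X U}"
    using path topspace_compact_open_paths[of X x y]
    unfolding compact_open_paths_def topology_generated_by_topspace by blast
qed

text \<open>Evaluation is jointly continuous because [0,1] is locally compact: the subbasic set of a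
  closed interval around \<open>t\<close>, of half the radius provided by continuity of
  \<open>p\<close>, does it. The form is that of the hypothesis \<open>joint\<close> of
  \<open>transport_family_continuous\<close>.\<close>

lemma compact_open_paths_evaluation:
  assumes p: "p \<in> path_space_set X x y" and t: "t \<in> {0..1}" and W: "openin X W" "p t \<in> W"
  shows "\<exists>N d. openin (compact_open_paths X x y) N \<and> p \<in> N \<and> d > 0 \<and>
    (\<forall>q\<in>N. \<forall>t'\<in>{0..1}. \<bar>t' - t\<bar> < d \<longrightarrow> q t' \<in> W)"
proof -
  have "pathin X p" using p by (simp add: path_space_set_def)
  from pathin_nbhd[OF this W(1) t W(2)] obtain d where d: "d > 0"
    "\<And>t'. t' \<in> {0..1} \<Longrightarrow> \<bar>t' - t\<bar> < d \<Longrightarrow> p t' \<in> W" by blast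
  let ?K = "{0..1} \<inter> {t - d/2..t + d/2}"
  let ?N = "{q \<in> path_space_set X x y. q ` ?K \<subseteq> W}"
  have "compactin unit_iv ?K" by (simp add: unit_iv_def compactin_subtopology compact_Int)
  then have "openin (compact_open_paths X x y) ?N"
    unfolding compact_open_paths_def using W(1) by (intro topology_generated_by_Basis) blast
  moreover have "p \<in> ?N" using p d by (auto intro!: d(2))
  moreover have "q t' \<in> W" if "q \<in> ?N" "t' \<in> {0..1}" "\<bar>t' - t\<bar> < d/2" for q t'
  proof -
    have "t - d/2 \<le> t'" "t' \<le> t + d/2" using that(3) by linarith+
    then have "t' \<in> ?K" using that(2) by auto
    then show ?thesis using that(1) by blast
  qed
  ultimately show ?thesis using d(1) by (intro exI[of _ ?N] exI[of _ "d/2"]) auto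
qed

lemma pathin_subpath:
  assumes p: "pathin X p" and ab: "0 \<le> a" "a \<le> b" "b \<le> 1"
  shows "pathin X (\<lambda>u. p (a + (b - a) * u))"
proof -
  have 1: "0 \<le> a + (b - a) * u \<and> a + (b - a) * u \<le> b" if "0 \<le> u" "u \<le> 1" for u
    using ab that mult_left_le[of u "b - a"] by (auto simp: mult.commute intro!: add_nonneg_nonneg mult_nonneg_nonneg)
  have "continuous_map unit_iv unit_iv (\<lambda>u. a + (b - a) * u)"
    unfolding unit_iv_def by (auto intro!: continuous_intros) (use ab 1 in force)+
  from continuous_map_compose[OF this] p show ?thesis
    by (simp add: pathin_unit_iv o_def)
qed

text \<open>Cancels \<open>rev_path b\<close> against \<open>b\<close> in the middle. In the
  application \<open>a\<close> is an initial piece of a path, and \<open>b\<close>,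
  \<open>b'\<close> are the rays of two charts to its end point.\<close>

lemma homotopic_rel_ends_insert:
  assumes a: "pathin X a" and b: "pathin X b" "a 1 = b 1" and b': "pathin X b'" "a 1 = b' 1"
  shows "homotopic_rel_ends X (join_path (join_path a (rev_path b)) (join_path b (rev_path b')))
    (join_path a (rev_path b'))"
proof -
  let ?r = "rev_path b" and ?r' = "rev_path b'"
  note r = pathin_rev[OF b(1)] and r' = pathin_rev[OF b'(1)]
  have e: "?r 0 = b 1" "?r 1 = b 0" "?r' 0 = b' 1" "?r' 1 = b' 0"
    "join_path b ?r' 0 = b 0" "join_path ?r b 1 = b 1" "const_path (b 1) 1 = b 1" "const_path (b 1) 0 = b 1"
    by (simp_all add: rev_path_def join_path_def const_path_def)
  have jb: "pathin X (join_path b ?r')" using b b' e r' by (intro pathin_join) auto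
  have "homotopic_rel_ends X (join_path ?r (join_path b ?r')) (join_path (join_path ?r b) ?r')"
    using b b' e r r' by (intro homotopic_rel_ends_sym[OF join_assoc]) auto
  moreover have "homotopic_rel_ends X (join_path (join_path ?r b) ?r') (join_path (const_path (b 1)) ?r')"
    using b b' e r' join_rev_left[OF b(1)] by (intro homotopic_rel_ends_join homotopic_rel_ends_refl) auto
  moreover have "homotopic_rel_ends X (join_path (const_path (b 1)) ?r') ?r'"
    using join_const_left[OF r'] e b b' by simp
  ultimately have "homotopic_rel_ends X (join_path ?r (join_path b ?r')) ?r'"
    by (meson homotopic_rel_ends_trans)
  then have "homotopic_rel_ends X (join_path a (join_path ?r (join_path b ?r'))) (join_path a ?r')"
    using a b e by (intro homotopic_rel_ends_join homotopic_rel_ends_refl) (auto simp: join_path_def)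
  moreover have "homotopic_rel_ends X (join_path (join_path a ?r) (join_path b ?r')) (join_path a (join_path ?r (join_path b ?r')))"
    using a b e r jb by (intro join_assoc) auto
  ultimately show ?thesis by (meson homotopic_rel_ends_trans)
qed

section \<open>Contractible charts of the realization\<close>

context topological_graph
begin

text \<open>Charts are indexed by pairs: (True, x) is the open star of radius 1/2 around the vertex x, and
(False, x) is the union of the open edges leaving x. Both contract radially onto x in the realization;
the radius 1/2 keeps the two ends of a loop at x apart.\<close>

definition chart :: "bool \<times> 'v \<Rightarrow> ('v,'e) rpt set" where
  "chart c = (if fst c then B (snd c) (1/2)
     else {Inr (e, t) | e t. e \<in> topspace E \<and> d0 e = snd c \<and> 0 < t \<and> t < 1})"

text \<open>The points of a star that are reached from its centre against the orientation of their edge.\<close>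

definition far :: "bool \<times> 'v \<Rightarrow> ('v,'e) rpt \<Rightarrow> bool" where
  "far c z \<longleftrightarrow> fst c \<and> (\<exists>e t. z = Inr (e, t) \<and> 1/2 < t)"

text \<open>The radial path from the centre (s = 0) to \<open>z\<close> (s = 1): the edge parameter
  is scaled towards 0, or towards 1 at far points. The value outside [0,1] is fixed so that rays
  agreeing on the interval are equal functions.\<close>

definition ray :: "bool \<times> 'v \<Rightarrow> ('v,'e) rpt \<Rightarrow> real \<Rightarrow> ('v,'e) rpt" where
  "ray c z s = (if s \<in> {0..1} then
     (case z of Inl v \<Rightarrow> Inl v
      | Inr (e, t) \<Rightarrow> edge_path d0 d1 e (if fst c \<and> 1/2 < t then 1 - (1 - t) * s else t * s))
     else undefined)"

lemma chart_cases:
  assumes "z \<in> chart c"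
  obtains (vertex) "fst c" "z = Inl (snd c)"
  | (near) e t where "z = Inr (e, t)" "e \<in> topspace E" "d0 e = snd c" "0 < t" "t < 1" "fst c \<Longrightarrow> t < 1/2"
  | (far) e t where "z = Inr (e, t)" "e \<in> topspace E" "d1 e = snd c" "1/2 < t" "t < 1" "fst c"
  using assms unfolding chart_def vertex_nbhd_def by (cases "fst c") auto

lemma openin_chart: "snd c \<in> V \<Longrightarrow> openin R (chart c)"
proof (cases "fst c")
  case False
  have "openin R (Inr ` ({e \<in> topspace E. d0 e = snd c} \<times> {0<..<1}))"
    by (rule openin_Inr) (auto simp: openin_prod_Times_iff openin_endpoint)
  moreover have "Inr ` ({e \<in> topspace E. d0 e = snd c} \<times> {0<..<1}) = chart c"
    using False by (auto simp: chart_def)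
  ultimately show ?thesis by simp
qed (simp add: chart_def openin_vertex_nbhd)

lemma chart_subset: "snd c \<in> V \<Longrightarrow> chart c \<subseteq> real_points V E"
  using openin_subset[OF openin_chart] by simp

lemma chart_cover:
  assumes "z \<in> real_points V E"
  shows "\<exists>c\<in>{c. snd c \<in> V}. z \<in> chart c"
proof (cases z)
  case (Inl x)
  with assms have "x \<in> V" "z \<in> chart (True, x)" by (auto simp: real_points_def chart_def vertex_nbhd_def)
  then show ?thesis by (intro bexI[of _ "(True, x)"]) auto
next
  case (Inr w)
  then obtain e t where w: "z = Inr (e, t)" by (cases w) auto
  with assms have "d0 e \<in> V" "z \<in> chart (False, d0 e)"
    using endpoints_in_V by (auto simp: real_points_def chart_def)
  then show ?thesis by (intro bexI[of _ "(False, d0 e)"]) auto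
qed

lemma ray_0: "z \<in> chart c \<Longrightarrow> ray c z 0 = Inl (snd c)"
  by (erule chart_cases) (auto simp: ray_def edge_path_def)

lemma ray_1: "z \<in> chart c \<Longrightarrow> ray c z 1 = z"
  by (erule chart_cases) (auto simp: ray_def edge_path_def)

lemma continuous_map_coordinates:
  assumes "S \<subseteq> range Inr"
  shows "continuous_map (subtopology (prod_topology (subtopology R D) unit_iv) (S \<times> {0..1})) E (\<lambda>z. fst (projr (fst z)))"
    "continuous_map (subtopology (prod_topology (subtopology R D) unit_iv) (S \<times> {0..1})) euclideanreal (\<lambda>z. snd (projr (fst z)))"
    "continuous_map (subtopology (prod_topology (subtopology R D) unit_iv) (S \<times> {0..1})) euclideanreal snd"
proof -
  let ?Z = "subtopology (prod_topology (subtopology R D) unit_iv) (S \<times> {0..1})"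
  have "continuous_map ?Z R fst"
    using continuous_map_fst[of "subtopology R D" unit_iv]
    by (intro continuous_map_from_subtopology) (simp add: continuous_map_in_subtopology)
  then have "continuous_map ?Z (subtopology R (range Inr)) fst"
    by (rule continuous_map_into_subtopology) (use assms in auto)
  from continuous_map_compose[OF this continuous_map_Inr_coordinates]
  have c: "continuous_map ?Z (prod_topology E euclideanreal) (\<lambda>z. projr (fst z))" by (simp add: o_def)
  from continuous_map_compose[OF c continuous_map_fst] show "continuous_map ?Z E (\<lambda>z. fst (projr (fst z)))"
    by (simp add: o_def)
  from continuous_map_compose[OF c continuous_map_snd] show "continuous_map ?Z euclideanreal (\<lambda>z. snd (projr (fst z)))"
    by (simp add: o_def)
  show "continuous_map ?Z euclideanreal snd"
    using continuous_map_snd[of "subtopology R D" unit_iv]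
    by (intro continuous_map_from_subtopology) (simp add: unit_iv_def continuous_map_in_subtopology)
qed

lemma continuous_map_edge_path_compose:
  assumes "continuous_map Z E f" "continuous_map Z euclideanreal h" "h ` topspace Z \<subseteq> {0..1}"
  shows "continuous_map Z R (\<lambda>z. edge_path d0 d1 (f z) (h z))"
proof -
  have "continuous_map Z (prod_topology E unit_iv) (\<lambda>z. (f z, h z))"
    unfolding continuous_map_pairwise o_def fst_conv snd_conv
    using assms by (auto simp: unit_iv_def continuous_map_in_subtopology)
  from continuous_map_compose[OF this continuous_map_edge_path_pair] show ?thesis by (simp add: o_def)
qed

text \<open>At the centre of a star, continuity holds because a ray is never farther from the centre
  than its end point, so small stars are preserved. Elsewhere the near and the far points form open
  pieces, each with a single formula in edge coordinates.\<close>

lemma continuous_map_ray: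
  assumes c: "snd c \<in> V"
  shows "continuous_map (prod_topology (subtopology R (chart c)) unit_iv) R (\<lambda>(z, s). ray c z s)"
    (is "continuous_map ?Z R ?f")
proof (rule continuous_map_pointwiseI)
  fix w assume w: "w \<in> topspace ?Z"
  then obtain z s where zs: "w = (z, s)" "z \<in> chart c" "s \<in> {0..1}" by auto
  have t01: "0 \<le> t * s" "t * s \<le> t" "t * s \<le> 1" if "0 < t" "t < 1" "s \<in> {0..1}" for t s :: real
  proof -
    show "0 \<le> t * s" "t * s \<le> t" using that by (auto intro: mult_nonneg_nonneg mult_left_le)
    then show "t * s \<le> 1" using that by linarith
  qed
  have t10: "t \<le> 1 - (1 - t) * s" "0 \<le> 1 - (1 - t) * s" "1 - (1 - t) * s \<le> 1"
    if "0 < t" "t < 1" "s \<in> {0..1}" for t s :: real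
  proof -
    have "0 < 1 - t" "1 - t < 1" using that by auto
    from t01[OF this that(3)] show "t \<le> 1 - (1 - t) * s" "0 \<le> 1 - (1 - t) * s" "1 - (1 - t) * s \<le> 1"
      by linarith+
  qed
  have open_Z: "openin ?Z (S \<times> {0..1})" if "openin R S" "S \<subseteq> chart c" for S
    using that openin_topspace[of unit_iv]
    by (auto simp: openin_prod_Times_iff openin_subtopology intro!: exI[of _ S])
  show "?f w \<in> topspace R"
  proof -
    have "edge_path d0 d1 e t \<in> real_points V E" if "e \<in> topspace E" "t \<in> {0..1}" for e t
      using that funcset_mem[OF continuous_map_funspace[OF continuous_map_edge_path_pair], of "(e, t)"] by simp
    moreover have "t * s \<in> {0..1}" "1 - (1 - t) * s \<in> {0..1}" if "0 < t" "t < 1" for t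
      using t01[OF that zs(3)] t10[OF that zs(3)] by simp_all
    moreover have "Inl (snd c) \<in> real_points V E" using c by (simp add: real_points_def)
    ultimately show ?thesis
      using zs(1,3) by (rule_tac chart_cases[OF zs(2)]) (simp_all add: ray_def)
  qed
  fix W assume W: "openin R W" "?f w \<in> W"
  from zs(2) show "\<exists>N. openin ?Z N \<and> w \<in> N \<and> ?f ` N \<subseteq> W"
  proof (cases rule: chart_cases)
    case vertex
    with W zs have "Inl (snd c) \<in> W" by (simp add: ray_def)
    from vertex_nbhd_basis[OF W(1) this] obtain r where r: "0 < r" "r < 1" "B (snd c) r \<subseteq> W" .
    let ?S = "B (snd c) (min r (1/2))"
    have "openin ?Z (?S \<times> {0..1})"
      using vertex r by (intro open_Z openin_vertex_nbhd c) (auto simp: chart_def vertex_nbhd_def)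
    moreover have "w \<in> ?S \<times> {0..1}" using zs vertex by (auto simp: vertex_nbhd_def)
    moreover have "ray c z' s' \<in> B (snd c) r" if z': "z' \<in> ?S" and s': "s' \<in> {0..1}" for z' s'
    proof -
      consider "z' = Inl (snd c)" | e t where "z' = Inr (e, t)" "e \<in> topspace E" "d0 e = snd c" "0 < t" "t < r" "t < 1/2"
        | e t where "z' = Inr (e, t)" "e \<in> topspace E" "d1 e = snd c" "1 - r < t" "1/2 < t" "t < 1"
        using z' by (auto simp: vertex_nbhd_def)
      then show ?thesis
      proof cases
        case 1
        then show ?thesis using s' by (simp add: ray_def vertex_nbhd_def)
      next
        case (2 e t)
        then have "edge_path d0 d1 e (t * s') \<in> B (snd c) r"
        proof (intro edge_path_in_vertex_nbhd)
          have t: "0 < t" "t < 1" using 2 by auto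
          have "t * s' < r" using t01(2)[OF t s'] 2 by linarith
          with 2 show "d0 e = snd c \<and> t * s' < r \<or> d1 e = snd c \<and> 1 - r < t * s'" by blast
          show "t * s' \<in> {0..1}" using t01(1,3)[OF t s'] by (simp only: atLeastAtMost_iff)
        qed (use r 2 in auto)
        then show ?thesis using 2 s' by (simp add: ray_def)
      next
        case (3 e t)
        then have "edge_path d0 d1 e (1 - (1 - t) * s') \<in> B (snd c) r"
        proof (intro edge_path_in_vertex_nbhd)
          have t: "0 < t" "t < 1" using 3 by auto
          have "1 - r < 1 - (1 - t) * s'" using t10(1)[OF t s'] 3 by linarith
          with 3 show "d0 e = snd c \<and> 1 - (1 - t) * s' < r \<or> d1 e = snd c \<and> 1 - r < 1 - (1 - t) * s'" by blast
          show "1 - (1 - t) * s' \<in> {0..1}" using t10(2,3)[OF t s'] by (simp only: atLeastAtMost_iff)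
        qed (use r 3 in auto)
        then show ?thesis using 3 s' vertex by (simp add: ray_def)
      qed
    qed
    ultimately show ?thesis using r(3) by (intro exI[of _ "?S \<times> {0..1}"]) auto
  next
    case (near e t)
    \<comment> \<open>Only stars are cut at the midpoint; an out-set consists of near points up to
      parameter 1.\<close>
    let ?T = "{e \<in> topspace E. d0 e = snd c} \<times> {0<..<if fst c then 1/2 else 1}"
    let ?S = "Inr ` ?T :: ('v,'e) rpt set"
    let ?Z' = "subtopology ?Z (?S \<times> {0..1})"
    have "?S \<subseteq> chart c" by (auto simp: chart_def vertex_nbhd_def split: if_splits)
    moreover have "openin R ?S"
      by (rule openin_Inr) (auto simp: openin_prod_Times_iff openin_endpoint split: if_splits)
    ultimately have op: "openin ?Z (?S \<times> {0..1})" by (intro open_Z)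
    have cc: "continuous_map ?Z' E (\<lambda>z. fst (projr (fst z)))" "continuous_map ?Z' euclideanreal (\<lambda>z. snd (projr (fst z)))"
      "continuous_map ?Z' euclideanreal snd" by (rule continuous_map_coordinates; auto)+
    have "continuous_map ?Z' R (\<lambda>z. edge_path d0 d1 (fst (projr (fst z))) (snd (projr (fst z)) * snd z))"
    proof (rule continuous_map_edge_path_compose[OF cc(1) continuous_map_real_mult[OF cc(2,3)]])
      have "t * s \<in> {0..1}" if "t \<in> {0<..<if fst c then 1/2 else 1}" "s \<in> {0..1}" for t s :: real
      proof -
        have "0 < t" "t < 1" using that by (auto split: if_splits)
        from t01[OF this that(2)] show ?thesis by simp
      qed
      then show "(\<lambda>x. snd (projr (fst x)) * snd x) ` topspace ?Z' \<subseteq> {0..1}"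
        by (fastforce simp del: atLeastAtMost_iff)
    qed
    then have "continuous_map ?Z' R ?f"
      by (rule continuous_map_eq) (auto simp: ray_def split: if_splits)
    from continuous_map_open_subtopology_nbhd[OF op this _ W] show ?thesis
      using near zs by auto
  next
    case (far e t)
    let ?T = "{e \<in> topspace E. d1 e = snd c} \<times> {1/2<..<1}"
    let ?S = "Inr ` ?T :: ('v,'e) rpt set"
    let ?Z' = "subtopology ?Z (?S \<times> {0..1})"
    have "?S \<subseteq> chart c" using far by (auto simp: chart_def vertex_nbhd_def split: if_splits)
    moreover have "openin R ?S"
      by (rule openin_Inr) (auto simp: openin_prod_Times_iff openin_endpoint split: if_splits)
    ultimately have op: "openin ?Z (?S \<times> {0..1})" by (intro open_Z)
    have cc: "continuous_map ?Z' E (\<lambda>z. fst (projr (fst z)))" "continuous_map ?Z' euclideanreal (\<lambda>z. snd (projr (fst z)))"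
      "continuous_map ?Z' euclideanreal snd" by (rule continuous_map_coordinates; auto)+
    have "continuous_map ?Z' R (\<lambda>z. edge_path d0 d1 (fst (projr (fst z))) (1 - (1 - snd (projr (fst z))) * snd z))"
    proof (rule continuous_map_edge_path_compose[OF cc(1)])
      show "continuous_map ?Z' euclideanreal (\<lambda>x. 1 - (1 - snd (projr (fst x))) * snd x)"
        by (intro continuous_map_diff continuous_map_real_mult cc(2,3) continuous_map_const[THEN iffD2]) auto
      have "1 - (1 - t) * s \<in> {0..1}" if "t \<in> {1/2<..<1}" "s \<in> {0..1}" for t s :: real
      proof -
        have "0 < t" "t < 1" using that by auto
        from t10[OF this that(2)] show ?thesis by simp
      qed
      then show "(\<lambda>x. 1 - (1 - snd (projr (fst x))) * snd x) ` topspace ?Z' \<subseteq> {0..1}"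
        by (fastforce simp del: atLeastAtMost_iff)
    qed
    then have "continuous_map ?Z' R ?f"
      by (rule continuous_map_eq) (use far in \<open>auto simp: ray_def split: if_splits\<close>)
    from continuous_map_open_subtopology_nbhd[OF op this _ W] show ?thesis
      using far zs by auto
  qed
qed

lemma pathin_ray:
  assumes "snd c \<in> V" "z \<in> chart c"
  shows "pathin R (ray c z)"
proof -
  have "continuous_map unit_iv (prod_topology (subtopology R (chart c)) unit_iv) (\<lambda>s. (z, s))"
    unfolding continuous_map_pairwise o_def fst_conv snd_conv
    using assms chart_subset[of c] by auto
  from continuous_map_compose[OF this continuous_map_ray[OF assms(1)]] show ?thesis
    by (simp add: o_def pathin_unit_iv)
qed

section \<open>Tails of a path and their behaviour under changes of time and chart\<close>

definition tail_path :: "(real \<Rightarrow> ('v,'e) rpt) \<Rightarrow> bool \<times> 'v \<Rightarrow> real \<Rightarrow> real \<Rightarrow> ('v,'e) rpt" where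
  "tail_path p c t = join_path (\<lambda>u. p (t * u)) (rev_path (ray c (p t)))"

lemma tail_path_space_set:
  assumes "pathin R p" "p 0 = Inl x" "t \<in> {0..1}" "snd c \<in> V" "p t \<in> chart c"
  shows "tail_path p c t \<in> path_space_set R (Inl x) (Inl (snd c))"
proof -
  have "pathin R (\<lambda>u. p (t * u))" using pathin_subpath[OF assms(1), of 0 t] assms(3) by simp
  moreover have "pathin R (rev_path (ray c (p t)))" using assms by (intro pathin_rev pathin_ray)
  ultimately have "pathin R (tail_path p c t)"
    unfolding tail_path_def using assms by (intro pathin_join) (auto simp: rev_path_def ray_1)
  then show ?thesis
    using assms by (simp add: path_space_set_def) (simp add: tail_path_def join_path_def rev_path_def ray_0)
qed

text \<open>Sliding the turning point from \<open>p t\<close> to \<open>p t'\<close> is a homotopy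
  as long as it stays in the chart, by joint continuity of the rays; the end stays at the
  centre.\<close>

lemma tail_path_homotopic:
  assumes p: "pathin R p" and t: "0 \<le> t" "t \<le> t'" "t' \<le> 1" and c: "snd c \<in> V" "p ` {t..t'} \<subseteq> chart c"
  shows "homotopic_rel_ends R (tail_path p c t) (tail_path p c t')"
proof (rule homotopic_rel_endsI)
  let ?k = "\<lambda>s. t + (t' - t) * s"
  let ?h = "\<lambda>(s, u). join_path (\<lambda>u. p (?k s * u)) (\<lambda>u. ray c (p (?k s)) (1 - u)) u"
  have k: "t \<le> ?k s" "?k s \<le> t'" if "s \<in> {0..1}" for s
    using that t mult_left_le[of s "t' - t"] by (auto simp: mult_nonneg_nonneg)
  have k01: "0 \<le> ?k s \<and> ?k s \<le> 1" if "s \<in> {0..1}" for s using k[OF that] t by auto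
  have pc: "p (?k s) \<in> chart c" if "s \<in> {0..1}" for s using k[OF that] c(2) by auto
  have m: "?k s * u \<in> {0..1}" if "s \<in> {0..1}" "u \<in> {0..1}" for s u
    using k01[OF that(1)] that(2) by (auto simp: mult_nonneg_nonneg mult_le_one)
  show "continuous_map (prod_topology unit_iv unit_iv) R ?h"
  proof (rule continuous_map_join_family)
    have "continuous_map (prod_topology unit_iv unit_iv) unit_iv (\<lambda>z. ?k (fst z) * snd z)"
      using m by (subst unit_iv_def, subst continuous_map_unit_square) (auto intro!: continuous_intros)
    from continuous_map_compose[OF this p[unfolded pathin_unit_iv]]
    show "continuous_map (prod_topology unit_iv unit_iv) R (\<lambda>(s, u). p (?k s * u))"
      by (simp add: o_def case_prod_unfold)
    have "continuous_map (prod_topology unit_iv unit_iv) unit_iv (\<lambda>z. ?k (fst z))"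
      using k01 by (subst unit_iv_def, subst continuous_map_unit_square) (auto intro!: continuous_intros)
    from continuous_map_compose[OF this p[unfolded pathin_unit_iv]]
    have "continuous_map (prod_topology unit_iv unit_iv) (subtopology R (chart c)) (\<lambda>z. p (?k (fst z)))"
      using pc by (intro continuous_map_into_subtopology) (auto simp: o_def)
    moreover have "continuous_map (prod_topology unit_iv unit_iv) unit_iv (\<lambda>z. 1 - snd z)"
      by (subst unit_iv_def, subst continuous_map_unit_square) (auto intro!: continuous_intros)
    ultimately have "continuous_map (prod_topology unit_iv unit_iv) (prod_topology (subtopology R (chart c)) unit_iv)
      (\<lambda>z. (p (?k (fst z)), 1 - snd z))"
      unfolding continuous_map_pairwise o_def fst_conv snd_conv by simp
    from continuous_map_compose[OF this continuous_map_ray[OF c(1)]]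
    show "continuous_map (prod_topology unit_iv unit_iv) R (\<lambda>(s, u). ray c (p (?k s)) (1 - u))"
      by (simp add: o_def case_prod_unfold)
    show "p (?k s * 1) = ray c (p (?k s)) (1 - 0)" if "s \<in> topspace unit_iv" for s
      using pc[of s] that by (simp add: ray_1)
  qed
  have e: "p t \<in> chart c" "p t' \<in> chart c" using c t by auto
  show "?h (0, u) = tail_path p c t u" "?h (1, u) = tail_path p c t' u" if "u \<in> {0..1}" for u
    using that by (auto simp: tail_path_def join_path_def rev_path_def)
  show "?h (s, 0) = tail_path p c t 0" if "s \<in> {0..1}" for s
    by (simp add: tail_path_def join_path_def)
  show "?h (s, 1) = tail_path p c t 1" if "s \<in> {0..1}" for s
    using pc[OF that] e by (simp add: tail_path_def join_path_def rev_path_def ray_0)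
qed

text \<open>The correction is the path from one centre to the other through \<open>p t\<close>; its
  value under a functor will be the transition.\<close>

lemma tail_path_change_chart:
  assumes "pathin R p" "t \<in> {0..1}" "snd c \<in> V" "p t \<in> chart c" "snd c' \<in> V" "p t \<in> chart c'"
  shows "homotopic_rel_ends R (join_path (tail_path p c t) (join_path (ray c (p t)) (rev_path (ray c' (p t)))))
     (tail_path p c' t)"
  unfolding tail_path_def
proof (rule homotopic_rel_ends_insert)
  show "pathin R (\<lambda>u. p (t * u))" using pathin_subpath[OF assms(1), of 0 t] assms(2) by simp
qed (use assms in \<open>auto simp: ray_1 pathin_ray\<close>)

text \<open>\<open>far\<close> records from which end of its edge a chart reaches \<open>z\<close>,
  and so decides centre and ray. The opposite case, \<open>far_not_far\<close>, can only be a star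
  at the end of the edge against the out-set at its start. This dichotomy is behind
  \<open>transition\<close>.\<close>

lemma far_centre:
  assumes "z \<in> chart c" "z \<in> chart c'" "far c z \<longleftrightarrow> far c' z"
  shows "snd c = snd c'" "s \<in> {0..1} \<Longrightarrow> ray c z s = ray c' z s"
proof -
  show "snd c = snd c'"
    using assms by (auto simp: far_def elim!: chart_cases)
  show "ray c z s = ray c' z s" if "s \<in> {0..1}"
    using assms by (auto simp: far_def ray_def elim!: chart_cases)
qed

lemma far_not_far:
  assumes "z \<in> chart c" "z \<in> chart c'" "far c z" "\<not> far c' z"
  obtains e t where "z = Inr (e, t)" "e \<in> topspace E" "snd c = d1 e" "snd c' = d0 e" "1/2 < t" "t < 1"
    "fst c" "\<not> fst c'"
  using assms by (auto simp: far_def elim!: chart_cases)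

lemma ray_ray_same:
  assumes "snd c \<in> V" "snd c' \<in> V" "z \<in> chart c" "z \<in> chart c'" "far c z \<longleftrightarrow> far c' z"
  shows "homotopic_rel_ends R (join_path (ray c z) (rev_path (ray c' z))) (const_path (Inl (snd c)))"
proof -
  have "ray c' z = ray c z"
    using far_centre(2)[OF assms(3-5)] by (auto simp: fun_eq_iff ray_def)
  then show ?thesis
    using join_rev_right[OF pathin_ray[OF assms(1,3)]] ray_0[OF assms(3)] by simp
qed

text \<open>Both composites stay on the edge \<open>e\<close>, so they are reparametrisations of it.
  \<open>?u\<close> is the edge parameter of the first one: from 1 down to t along the ray of the
  star, then from t down to 0.\<close>

lemma ray_ray_far:
  assumes e: "e \<in> topspace E" and z: "z = Inr (e, t)" "1/2 < t" "t < 1" and c: "fst c" "\<not> fst c'"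
  shows "homotopic_rel_ends R (join_path (ray c z) (rev_path (ray c' z))) (rev_path (edge_path d0 d1 e))"
    and "homotopic_rel_ends R (join_path (ray c' z) (rev_path (ray c z))) (edge_path d0 d1 e)"
proof -
  let ?w = "edge_path d0 d1 e"
  let ?u = "\<lambda>s. if s \<le> 1/2 then 1 - (1 - t) * (2 * s) else t * (2 - 2 * s)"
  have u: "continuous_on {0..1} ?u"
    by (rule continuous_on_cases_le; (intro continuous_intros)?) (auto simp: algebra_simps)
  have u01: "?u s \<in> {0..1}" if s: "s \<in> {0..1}" for s
  proof (cases "s \<le> 1/2")
    case True
    then have "0 \<le> (1 - t) * (2 * s)" "(1 - t) * (2 * s) \<le> 1 * 1"
      using s z by (intro mult_nonneg_nonneg mult_mono; simp)+
    with True show ?thesis by auto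
  next
    case False
    then have "0 \<le> t * (2 - 2 * s)" "t * (2 - 2 * s) \<le> 1 * 1"
      using s z by (intro mult_nonneg_nonneg mult_mono; simp)+
    with False show ?thesis by auto
  qed
  show "homotopic_rel_ends R (join_path (ray c z) (rev_path (ray c' z))) (rev_path ?w)"
  proof (rule homotopic_rel_ends_reparam[OF pathin_edge_path[OF e] u, of "\<lambda>s. 1 - s"])
    show "join_path (ray c z) (rev_path (ray c' z)) s = ?w (?u s)" if "s \<in> {0..1}" for s
      using that z c by (auto simp: join_path_def rev_path_def ray_def)
    show "rev_path ?w s = ?w (1 - s)" if "s \<in> {0..1}" for s using that by (simp add: rev_path_def)
    show "?u ` {0..1} \<subseteq> {0..1}" using u01 by blast
    show "continuous_on {0..1} (\<lambda>s::real. 1 - s)" by (intro continuous_intros)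
  qed auto
  have u': "continuous_on {0..1} (\<lambda>s. ?u (1 - s))"
    by (rule continuous_on_compose2[OF u continuous_on_diff[OF continuous_on_const continuous_on_id]]) auto
  show "homotopic_rel_ends R (join_path (ray c' z) (rev_path (ray c z))) ?w"
  proof (rule homotopic_rel_ends_reparam[OF pathin_edge_path[OF e] u', of "\<lambda>s. s"])
    show "join_path (ray c' z) (rev_path (ray c z)) s = ?w (?u (1 - s))" if s: "s \<in> {0..1}" for s
    proof (cases "s = 1/2")
      \<comment> \<open>Reversal swaps the two branches of \<open>?u\<close>, except at s = 1/2,
        where \<open>join_path\<close> and \<open>?u\<close> both use their first branch; both give
        the parameter t.\<close>
      case True
      show ?thesis unfolding True using z c by (simp add: join_path_def ray_def)
    next
      case False
      with s z c show ?thesis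
        by (auto simp: join_path_def rev_path_def ray_def)
    qed
    show "(\<lambda>s. ?u (1 - s)) ` {0..1} \<subseteq> {0..1}"
    proof
      fix y assume "y \<in> (\<lambda>s. ?u (1 - s)) ` {0..1}"
      then obtain s where s: "s \<in> {0..1}" "y = ?u (1 - s)" by blast
      then have "1 - s \<in> {0..1}" by simp
      from u01[OF this] show "y \<in> {0..1}" unfolding s(2) .
    qed
  qed auto
qed

end

section \<open>Transport along paths in the realization\<close>

locale graph_representation = topological_graph V E d0 d1
  for V :: "'v set" and E :: "'e topology" and d0 d1 :: "'e \<Rightarrow> 'v" +
  fixes H :: "('p,'n) tgpd" and f0 :: "'v \<Rightarrow> 'p" and \<phi> :: "'e \<Rightarrow> 'n"
  assumes top_groupoid_H: "top_groupoid H"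
    and f0: "x \<in> V \<Longrightarrow> f0 x \<in> obj H"
    and \<phi>_cont: "\<lbrakk>x \<in> V; y \<in> V\<rbrakk> \<Longrightarrow>
      continuous_map (subtopology E (edges_between E d0 d1 x y)) (htop H (f0 x) (f0 y)) \<phi>"
    and \<phi>_component: "\<lbrakk>x \<in> V; y \<in> V; path_component_of (subtopology E (edges_between E d0 d1 x y)) e e'\<rbrakk> \<Longrightarrow>
      \<phi> e = \<phi> e'"
begin

lemma groupoid_H: "groupoid H"
  using top_groupoid_H by (simp add: top_groupoid_def)

lemmas gpd = groupoidD[OF groupoid_H]

lemma topspace_htop: "x \<in> V \<Longrightarrow> y \<in> V \<Longrightarrow> topspace (htop H (f0 x) (f0 y)) = hom H (f0 x) (f0 y)"
  using top_groupoid_H f0 by (simp add: top_groupoid_def)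

lemma \<phi>_hom: "e \<in> topspace E \<Longrightarrow> \<phi> e \<in> hom H (f0 (d0 e)) (f0 (d1 e))"
proof -
  assume e: "e \<in> topspace E"
  note V = endpoints_in_V[OF e]
  have "\<phi> e \<in> topspace (htop H (f0 (d0 e)) (f0 (d1 e)))"
    using e by (intro funcset_mem[OF continuous_map_funspace[OF \<phi>_cont[OF V]]]) (simp add: edges_between_def)
  then show ?thesis using topspace_htop[OF V] by simp
qed

text \<open>The intended value of the path from the centre of \<open>c\<close> to that of
  \<open>c'\<close> through \<open>z\<close>: constant if both charts reach \<open>z\<close> from
  the same end, otherwise the edge, traversed backwards when \<open>c\<close> is the far
  side.\<close>

definition transition :: "bool \<times> 'v \<Rightarrow> bool \<times> 'v \<Rightarrow> ('v,'e) rpt \<Rightarrow> 'n" where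
  "transition c c' z = (if far c z \<longleftrightarrow> far c' z then idn H (f0 (snd c))
     else if far c z then inv H (f0 (snd c')) (f0 (snd c)) (\<phi> (fst (projr z)))
     else \<phi> (fst (projr z)))"

lemma transition_hom:
  assumes "snd c \<in> V" "snd c' \<in> V" "z \<in> chart c" "z \<in> chart c'"
  shows "transition c c' z \<in> hom H (f0 (snd c)) (f0 (snd c'))"
proof (cases "far c z \<longleftrightarrow> far c' z")
  case True
  then show ?thesis using far_centre(1)[OF assms(3,4)] assms(1) by (simp add: transition_def gpd f0)
next
  case False
  show ?thesis
  proof (cases "far c z")
    case True
    with False have "\<not> far c' z" by simp
    from far_not_far[OF assms(3,4) True this] obtain e t where
      "z = Inr (e, t)" "e \<in> topspace E" "snd c = d1 e" "snd c' = d0 e" by blast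
    then show ?thesis using False True assms(1,2) \<phi>_hom[of e] by (simp add: transition_def gpd f0)
  next
    case nf: False
    with False have "far c' z" by simp
    from far_not_far[OF assms(4,3) this nf] obtain e t where
      "z = Inr (e, t)" "e \<in> topspace E" "snd c' = d1 e" "snd c = d0 e" by blast
    then show ?thesis using False nf \<phi>_hom[of e] by (simp add: transition_def)
  qed
qed

lemma transition_cocycle:
  assumes V: "snd c \<in> V" "snd c' \<in> V" "snd c'' \<in> V" and z: "z \<in> chart c" "z \<in> chart c'" "z \<in> chart c''"
  shows "comp H (f0 (snd c)) (f0 (snd c')) (f0 (snd c'')) (transition c c' z) (transition c' c'' z) = transition c c'' z"
proof -
  note t = transition_hom[OF V(1,2) z(1,2)] transition_hom[OF V(2,3) z(2,3)]
  note o = f0[OF V(1)] f0[OF V(2)] f0[OF V(3)]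
  \<comment> \<open>Of three truth values two agree. Agreement of neighbours leaves an identity
    factor; if only the outer ones agree, the two factors are inverse to each other.\<close>
  consider "far c z \<longleftrightarrow> far c' z" | "far c' z \<longleftrightarrow> far c'' z" | "far c z \<longleftrightarrow> far c'' z" "far c z \<noteq> far c' z" by blast
  then show ?thesis
  proof cases
    case 1
    then have "snd c = snd c'" "transition c c' z = idn H (f0 (snd c))" "transition c' c'' z = transition c c'' z"
      using far_centre(1)[OF z(1,2)] by (simp_all add: transition_def)
    then show ?thesis using t o by (simp add: gpd)
  next
    case 2
    then have "snd c' = snd c''" "transition c' c'' z = idn H (f0 (snd c''))" "transition c c' z = transition c c'' z"
      using far_centre(1)[OF z(2,3)] by (simp_all add: transition_def)
    then show ?thesis using t o by (simp add: gpd)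
  next
    case 3
    then have eq: "snd c = snd c''" "transition c c'' z = idn H (f0 (snd c))"
      using far_centre(1)[OF z(1,3)] by (simp_all add: transition_def)
    show ?thesis
    proof (cases "far c z")
      case True
      with 3 have nf: "\<not> far c' z" by simp
      then have "transition c c' z = inv H (f0 (snd c')) (f0 (snd c)) (transition c' c'' z)"
        using True 3 by (simp add: transition_def)
      then show ?thesis using t o eq by (simp add: gpd)
    next
      case False
      with 3 have nf: "far c' z" by simp
      then have "transition c' c'' z = inv H (f0 (snd c)) (f0 (snd c')) (transition c c' z)"
        using False 3 eq by (simp add: transition_def)
      then show ?thesis using t o eq by (simp add: gpd)
    qed
  qed
qed

text \<open>The source of flatness. The overlap contains no midpoint, so by the intermediate value
  theorem a path in it keeps to one half. In the far half its edges all start at \<open>x\<close>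
  and end at \<open>y\<close>, so they form a path in Gamma(x,y), along which \<open>\<phi>\<close>
  is constant.\<close>

lemma star_out_path:
  assumes q: "pathin R q" and im: "q ` {0..1} \<subseteq> chart (True, y) \<inter> chart (False, x)" and V: "x \<in> V" "y \<in> V"
  shows "far (True, y) (q 0) = far (True, y) (q 1)"
    and "far (True, y) (q 0) \<Longrightarrow> \<phi> (fst (projr (q 0))) = \<phi> (fst (projr (q 1)))"
proof -
  let ?e = "\<lambda>u. fst (projr (q u))" and ?t = "\<lambda>u. snd (projr (q u))"
  have qu: "q u = Inr (?e u, ?t u) \<and> ?e u \<in> topspace E \<and> d0 (?e u) = x \<and> ?t u \<noteq> 1/2 \<and> (1/2 < ?t u \<longrightarrow> d1 (?e u) = y)"
    if "u \<in> {0..1}" for u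
  proof -
    have "q u \<in> chart (True, y)" "q u \<in> chart (False, x)" using im that by blast+
    then show ?thesis by (auto elim!: chart_cases)
  qed
  have far: "far (True, y) (q u) \<longleftrightarrow> 1/2 < ?t u" if "u \<in> {0..1}" for u
    using qu[OF that] by (metis far_def fst_conv sum.inject(2) prod.inject)
  have "continuous_map unit_iv (subtopology R (range Inr)) q"
  proof (rule continuous_map_into_subtopology)
    show "q \<in> topspace unit_iv \<rightarrow> range Inr"
    proof
      fix u assume "u \<in> topspace unit_iv"
      then have "q u = Inr (?e u, ?t u)" using qu[of u] by simp
      then show "q u \<in> range Inr" by (metis rangeI)
    qed
  qed (use q in \<open>simp add: pathin_unit_iv\<close>)
  from continuous_map_compose[OF this continuous_map_Inr_coordinates]
  have c: "continuous_map unit_iv (prod_topology E euclideanreal) (\<lambda>u. projr (q u))" by (simp add: o_def)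
  from continuous_map_compose[OF c continuous_map_snd]
  have ct: "continuous_on {0..1} ?t" by (simp add: o_def unit_iv_def)
  from continuous_map_compose[OF c continuous_map_fst]
  have ce: "continuous_map unit_iv E ?e" by (simp add: o_def)
  have side: "1/2 < ?t 0 \<longleftrightarrow> 1/2 < ?t u" if u: "u \<in> {0..1}" for u
  proof -
    have cu: "continuous_on {0..u} ?t" using u by (intro continuous_on_subset[OF ct]) auto
    have no: "?t s \<noteq> 1/2" if "0 \<le> s" "s \<le> u" for s using qu[of s] u that by auto
    show ?thesis
      using IVT'[of ?t 0 "1/2" u, OF _ _ _ cu] IVT2'[of ?t u "1/2" 0, OF _ _ _ cu] no u
      by (metis atLeastAtMost_iff less_eq_real_def linorder_not_less)
  qed
  show "far (True, y) (q 0) = far (True, y) (q 1)" using side[of 1] far[of 0] far[of 1] by simp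
  assume "far (True, y) (q 0)"
  then have "1/2 < ?t u" if "u \<in> {0..1}" for u using side[OF that] far[of 0] by simp
  then have "?e u \<in> edges_between E d0 d1 x y" if "u \<in> {0..1}" for u
    using qu[OF that] that by (simp add: edges_between_def)
  then have "pathin (subtopology E (edges_between E d0 d1 x y)) ?e"
    unfolding pathin_unit_iv by (intro continuous_map_into_subtopology ce) auto
  then have "path_component_of (subtopology E (edges_between E d0 d1 x y)) (?e 0) (?e 1)"
    unfolding path_component_of_def by blast
  then show "\<phi> (?e 0) = \<phi> (?e 1)" using \<phi>_component V by blast
qed

lemma transition_same_kind: "fst c = fst c' \<Longrightarrow> transition c c' z = idn H (f0 (snd c))"
  by (simp add: transition_def far_def)

lemma transition_flat:
  assumes p: "pathin R p" and ab: "0 \<le> a" "a \<le> b" "b \<le> 1" and V: "snd c \<in> V" "snd c' \<in> V"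
    and im: "p ` {a..b} \<subseteq> chart c \<inter> chart c'"
  shows "transition c c' (p a) = transition c c' (p b)"
proof (cases "fst c = fst c'")
  case True
  then show ?thesis by (simp add: transition_same_kind)
next
  case False
  define q where "q u = p (a + (b - a) * u)" for u
  have q: "pathin R q" unfolding q_def by (rule pathin_subpath[OF p ab])
  have q01: "q 0 = p a" "q 1 = p b" by (simp_all add: q_def)
  have "a + (b - a) * u \<in> {a..b}" if "u \<in> {0..1}" for u
    using that ab mult_left_le[of u "b - a"] by (auto intro: mult_nonneg_nonneg)
  then have q_im: "q ` {0..1} \<subseteq> chart c \<inter> chart c'" using im by (auto simp: q_def)
  have nf: "\<not> far (False, x) z" for x z by (simp add: far_def)
  obtain s x s' y where c: "c = (s, x)" "c' = (s', y)" by (metis surj_pair)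
  show ?thesis
  proof (cases s)
    case True
    with False c have cc: "c = (True, x)" "c' = (False, y)" by auto
    then have "q ` {0..1} \<subseteq> chart (True, x) \<inter> chart (False, y)" using q_im by simp
    from star_out_path[OF q this] V cc show ?thesis by (auto simp: transition_def nf q01)
  next
    case False
    with \<open>fst c \<noteq> fst c'\<close> c have cc: "c = (False, x)" "c' = (True, y)" by auto
    then have "q ` {0..1} \<subseteq> chart (True, y) \<inter> chart (False, x)" using q_im by auto
    from star_out_path[OF q this] V cc show ?thesis by (auto simp: transition_def nf q01)
  qed
qed

sublocale tr: flat_cocycle R "{c. snd c \<in> V}" chart H "\<lambda>c. f0 (snd c)" transition
proof
  show "groupoid H" by (rule groupoid_H)
  show "openin R (chart c)" if "c \<in> {c. snd c \<in> V}" for c using that openin_chart by simp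
  show "\<exists>c\<in>{c. snd c \<in> V}. z \<in> chart c" if "z \<in> topspace R" for z using that chart_cover by simp
  show "f0 (snd c) \<in> obj H" if "c \<in> {c. snd c \<in> V}" for c using that f0 by simp
  show "transition c c' z \<in> hom H (f0 (snd c)) (f0 (snd c'))"
    if "c \<in> {c. snd c \<in> V}" "c' \<in> {c. snd c \<in> V}" "z \<in> chart c" "z \<in> chart c'" for c c' z
    using that transition_hom by simp
  show "transition c c z = idn H (f0 (snd c))" for c z by (simp add: transition_same_kind)
  show "comp H (f0 (snd c)) (f0 (snd c')) (f0 (snd c'')) (transition c c' z) (transition c' c'' z) = transition c c'' z"
    if "c \<in> {c. snd c \<in> V}" "c' \<in> {c. snd c \<in> V}" "c'' \<in> {c. snd c \<in> V}" "z \<in> chart c" "z \<in> chart c'" "z \<in> chart c''" for c c' c'' z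
    using that transition_cocycle by simp
  show "transition c c' (p a) = transition c c' (p b)"
    if "pathin R p" "0 \<le> a" "a \<le> b" "b \<le> 1" "c \<in> {c. snd c \<in> V}" "c' \<in> {c. snd c \<in> V}"
      "p ` {a..b} \<subseteq> chart c \<inter> chart c'" for p a b c c'
    using transition_flat[OF that(1-4) _ _ that(7)] that(5,6) by simp
qed

text \<open>Supplies \<open>g_cont\<close> for transport with the topologies of \<open>H\<close>.
  The value can vary only at far points of a star meeting an out-set, and there it is
  \<open>\<phi>\<close> or its inverse, continuous on Gamma(x,y).\<close>

lemma transition_nbhd:
  assumes V: "snd c \<in> V" "snd c' \<in> V" and z: "z \<in> chart c" "z \<in> chart c'"
    and W: "openin (htop H (f0 (snd c)) (f0 (snd c'))) W" "transition c c' z \<in> W"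
  shows "\<exists>N. openin R N \<and> z \<in> N \<and> N \<subseteq> chart c \<inter> chart c' \<and> (\<forall>w\<in>N. transition c c' w \<in> W)"
proof -
  have int: "openin R (chart c \<inter> chart c')" using openin_Int[OF V[THEN openin_chart]] .
  \<comment> \<open>Both orders of the two charts at once: the pair is given only as a set, and
    \<open>\<psi>\<close> is \<open>\<phi>\<close> or \<open>\<phi>\<close> followed by
    inversion.\<close>
  have nbhd: ?thesis
    if far: "far (True, y) z" and kinds: "{(True, y), (False, x)} = {c, c'}"
      and \<psi>: "continuous_map (subtopology E (edges_between E d0 d1 x y)) (htop H (f0 (snd c)) (f0 (snd c'))) \<psi>"
      and tr: "\<And>e t. 1/2 < t \<Longrightarrow> transition c c' (Inr (e, t)) = \<psi> e" for x y \<psi>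
  proof -
    have zz: "z \<in> chart (True, y)" "z \<in> chart (False, x)" using z kinds by (metis insertCI insertE singletonD)+
    have "\<not> far (False, x) z" by (simp add: far_def)
    from far_not_far[OF zz far this] obtain e t where e: "z = Inr (e, t)" "e \<in> topspace E" "d1 e = y" "d0 e = x" "1/2 < t" "t < 1"
      by (metis snd_conv)
    let ?X = "subtopology E (edges_between E d0 d1 x y)"
    let ?A = "{e \<in> topspace ?X. \<psi> e \<in> W}"
    have A: "openin E ?A"
      using openin_continuous_map_preimage[OF \<psi> W(1)] openin_edges_between openin_trans_full by blast
    have "openin R (Inr ` (?A \<times> {1/2<..<1}))"
      using A by (intro openin_Inr) (auto simp: openin_prod_Times_iff)
    moreover have "z \<in> Inr ` (?A \<times> {1/2<..<1})"
      using e W(2) tr[of t e] by (auto simp: edges_between_def)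
    moreover have "Inr ` (?A \<times> {1/2<..<1}) \<subseteq> chart (True, y) \<inter> chart (False, x)"
      by (auto simp: chart_def vertex_nbhd_def edges_between_def)
    moreover have "chart (True, y) \<inter> chart (False, x) = chart c \<inter> chart c'"
      using kinds unfolding doubleton_eq_iff by (elim disjE conjE) (simp_all add: Int_commute)
    ultimately have "openin R (Inr ` (?A \<times> {1/2<..<1}))" "z \<in> Inr ` (?A \<times> {1/2<..<1})"
      "Inr ` (?A \<times> {1/2<..<1}) \<subseteq> chart c \<inter> chart c'" by (simp_all only:)
    moreover have "\<forall>w\<in>Inr ` (?A \<times> {1/2<..<1}). transition c c' w \<in> W" using tr by auto
    ultimately show ?thesis by (intro exI[of _ "Inr ` (?A \<times> {1/2<..<1})"] conjI)
  qed
  show ?thesis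
  proof (cases "fst c = fst c'")
    case True
    have "transition c c' w \<in> W" for w
      using W(2) by (simp add: transition_same_kind[OF True])
    then show ?thesis using int z by (intro exI[of _ "chart c \<inter> chart c'"]) simp
  next
    case kind: False
    show ?thesis
    proof (cases "far c z \<longleftrightarrow> far c' z")
      case True
      then have nf: "\<not> far c z" "\<not> far c' z" using kind by (auto simp: far_def)
      let ?N = "chart c \<inter> chart c' \<inter> Inr ` (topspace E \<times> {0<..<1/2})"
      have "openin R (Inr ` (topspace E \<times> {0<..<1/2}))"
        by (rule openin_Inr) (auto simp: openin_prod_Times_iff)
      then have "openin R ?N" using int by blast
      moreover have "z \<in> ?N"
      proof -
        have "z \<in> Inr ` (topspace E \<times> {0<..<1/2})"
          using z kind nf by (auto simp: far_def elim!: chart_cases)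
        then show ?thesis using z by simp
      qed
      moreover have "transition c c' w \<in> W" if "w \<in> ?N" for w
      proof -
        have "\<not> far c w" "\<not> far c' w" using that by (auto simp: far_def)
        then show ?thesis using nf W(2) by (simp add: transition_def)
      qed
      moreover have "?N \<subseteq> chart c \<inter> chart c'" by (rule Int_lower1)
      ultimately show ?thesis by (intro exI[of _ ?N]) blast
    next
      case neq: False
      have nF: "\<not> far (False, x) w" for x w by (simp add: far_def)
      have fT: "far (True, y) (Inr (e, t)) \<longleftrightarrow> 1/2 < t" for y e t by (simp add: far_def)
      show ?thesis
      proof (cases "far c z")
        case True
        then have "fst c" "\<not> fst c'" using kind by (auto simp: far_def)
        then obtain y x where c: "c = (True, y)" "c' = (False, x)"
          by (cases c; cases c') auto
        have xy: "x \<in> V" "y \<in> V" using V c by auto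
        have "continuous_map (htop H (f0 x) (f0 y)) (htop H (f0 y) (f0 x)) (inv H (f0 x) (f0 y))"
          using top_groupoid_H f0 xy by (simp add: top_groupoid_def)
        from continuous_map_compose[OF \<phi>_cont[OF xy] this]
        have "continuous_map (subtopology E (edges_between E d0 d1 x y)) (htop H (f0 (snd c)) (f0 (snd c')))
           (\<lambda>e. inv H (f0 x) (f0 y) (\<phi> e))" using c by (simp add: o_def)
        then show ?thesis
          using True c by (intro nbhd[of y x]) (auto simp: transition_def nF fT)
      next
        case False
        with neq have "fst c'" "\<not> fst c" using kind by (auto simp: far_def)
        then obtain y x where c: "c' = (True, y)" "c = (False, x)"
          by (cases c; cases c') auto
        have xy: "x \<in> V" "y \<in> V" using V c by auto
        have "continuous_map (subtopology E (edges_between E d0 d1 x y)) (htop H (f0 (snd c)) (f0 (snd c'))) \<phi>"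
          using \<phi>_cont[OF xy] c by simp
        then show ?thesis
          using neq False c by (intro nbhd[of y x]) (auto simp: transition_def nF fT)
      qed
    qed
  qed
qed

section \<open>Holonomy between vertices: functoriality, continuity and homotopy invariance\<close>

abbreviation hol :: "'v \<Rightarrow> 'v \<Rightarrow> (real \<Rightarrow> ('v,'e) rpt) \<Rightarrow> 'n" where
  "hol x y p \<equiv> tr.transport p (True, x) (True, y)"

lemma vertex_in_star: "Inl x \<in> chart (True, x)"
  by (simp add: chart_def vertex_nbhd_def)

lemma hol_hom:
  assumes "x \<in> V" "y \<in> V" "p \<in> path_space_set R (Inl x) (Inl y)"
  shows "hol x y p \<in> hom H (f0 x) (f0 y)"
  using tr.transport_hom[of p "(True, x)" "(True, y)"] assms
  by (simp add: path_space_set_def vertex_in_star)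

lemma hol_join:
  assumes "x \<in> V" "y \<in> V" "z \<in> V" "p \<in> path_space_set R (Inl x) (Inl y)" "q \<in> path_space_set R (Inl y) (Inl z)"
  shows "hol x z (join_path p q) = comp H (f0 x) (f0 y) (f0 z) (hol x y p) (hol y z q)"
  using tr.transport_join[of p q "(True, x)" "(True, y)" "(True, z)"] assms
  by (simp add: path_space_set_def vertex_in_star)

lemma hol_const:
  assumes "x \<in> V"
  shows "hol x x (const_path (Inl x)) = idn H (f0 x)"
proof -
  have "pathin R (const_path (Inl x))"
    using assms by (intro pathin_const_path) (simp add: real_points_def)
  then show ?thesis
    using tr.transport_in_chart[of "const_path (Inl x)" "(True, x)" "(True, x)"] assms vertex_in_star
    by (force simp: const_path_def transition_same_kind)
qed

lemma hol_continuous: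
  assumes xy: "x \<in> V" "y \<in> V"
  shows "continuous_map (compact_open_paths R (Inl x) (Inl y)) (htop H (f0 x) (f0 y)) (hol x y)"
proof -
  have 1: "pathin R p \<and> p 0 = Inl x \<and> p 1 = Inl y" if "p \<in> topspace (compact_open_paths R (Inl x) (Inl y))" for p
    using that by (simp add: path_space_set_def)
  have joint: "\<exists>N d. openin (compact_open_paths R (Inl x) (Inl y)) N \<and> p \<in> N \<and> d > 0 \<and>
      (\<forall>q\<in>N. \<forall>t'\<in>{0..1}. \<bar>t' - t\<bar> < d \<longrightarrow> q t' \<in> W)"
    if "p \<in> topspace (compact_open_paths R (Inl x) (Inl y))" "t \<in> {0..1}" "openin R W" "p t \<in> W" for p t W
    using that by (intro compact_open_paths_evaluation) simp_all
  have "continuous_map (compact_open_paths R (Inl x) (Inl y)) (htop H (f0 (snd (True, x))) (f0 (snd (True, y)))) (hol x y)"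
  proof (rule tr.transport_family_continuous[where T="htop H" and P="\<lambda>p. p"])
    fix p t c c' W
    assume a: "p \<in> topspace (compact_open_paths R (Inl x) (Inl y))" "t \<in> {0..1}"
      "c \<in> {c. snd c \<in> V}" "c' \<in> {c. snd c \<in> V}" "p t \<in> chart c" "p t \<in> chart c'"
      "openin (htop H (f0 (snd c)) (f0 (snd c'))) W" "transition c c' (p t) \<in> W"
    then obtain N where N: "openin R N" "p t \<in> N" "N \<subseteq> chart c \<inter> chart c'" "\<forall>w\<in>N. transition c c' w \<in> W"
      using transition_nbhd[of c c' "p t" W] by auto
    obtain M d where M: "openin (compact_open_paths R (Inl x) (Inl y)) M" "p \<in> M" "d > 0"
      "\<forall>q\<in>M. \<forall>t'\<in>{0..1}. \<bar>t' - t\<bar> < d \<longrightarrow> q t' \<in> N" using joint[OF a(1,2) N(1,2)] by blast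
    have "q t \<in> N" if "q \<in> M" for q using M(3,4) that a(2) by auto
    then show "\<exists>M. openin (compact_open_paths R (Inl x) (Inl y)) M \<and> p \<in> M \<and>
      (\<forall>s'\<in>M. s' t \<in> chart c \<and> s' t \<in> chart c' \<and> transition c c' (s' t) \<in> W)"
      using N(3,4) M(1,2) by (intro exI[of _ M]) auto
  next
    show "p 0 \<in> chart (True, x)" "p 1 \<in> chart (True, y)" "pathin R p"
      if "p \<in> topspace (compact_open_paths R (Inl x) (Inl y))" for p
      using 1[OF that] vertex_in_star by simp_all
  qed (use xy joint top_groupoid_H in \<open>simp_all add: top_groupoid_def\<close>)
  then show ?thesis by simp
qed

lemma hol_homotopic:
  assumes xy: "x \<in> V" "y \<in> V" and h: "homotopic_rel_ends R p q"
    and p: "p \<in> path_space_set R (Inl x) (Inl y)" and q: "q \<in> path_space_set R (Inl x) (Inl y)"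
  shows "hol x y p = hol x y q"
proof -
  obtain k where k: "continuous_map (prod_topology unit_iv unit_iv) R k"
    "\<forall>t\<in>{0..1}. k (0, t) = p t" "\<forall>t\<in>{0..1}. k (1, t) = q t"
    "\<forall>s\<in>{0..1}. k (s, 0) = p 0" "\<forall>s\<in>{0..1}. k (s, 1) = p 1"
    using h unfolding homotopic_rel_ends_iff by blast
  \<comment> \<open>Cutting the homotopy off outside [0,1] makes its two end slices equal to
    \<open>p\<close> and \<open>q\<close> as functions.\<close>
  define P where "P s t = (if t \<in> {0..1} then k (s, t) else undefined)" for s t
  have Pp: "P 0 = p" and Pq: "P 1 = q"
    using k p q by (auto simp: P_def path_space_set_def fun_eq_iff)
  have slice1: "pathin R (P s)" if "s \<in> {0..1}" for s
  proof -
    have "continuous_map unit_iv (prod_topology unit_iv unit_iv) (\<lambda>t. (s, t))"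
      unfolding continuous_map_pairwise o_def fst_conv snd_conv using that by simp
    from continuous_map_compose[OF this k(1)] show ?thesis
      unfolding pathin_unit_iv by (rule continuous_map_eq) (simp add: P_def)
  qed
  have slice2: "pathin R (\<lambda>s. P s t)" if "t \<in> {0..1}" for t
  proof -
    have "continuous_map unit_iv (prod_topology unit_iv unit_iv) (\<lambda>s. (s, t))"
      unfolding continuous_map_pairwise o_def fst_conv snd_conv using that by simp
    from continuous_map_compose[OF this k(1)] show ?thesis
      unfolding pathin_unit_iv by (rule continuous_map_eq) (use that in \<open>simp add: P_def\<close>)
  qed
  have ends: "P s 0 = Inl x" "P s 1 = Inl y" if "s \<in> {0..1}" for s
    using k p that by (auto simp: P_def path_space_set_def)
  let ?D = "\<lambda>a b. discrete_topology (hom H a b)"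
  have "continuous_map unit_iv (?D (f0 (snd (True, x))) (f0 (snd (True, y)))) (\<lambda>s. hol x y (P s))"
  proof (rule tr.transport_family_continuous[where T="?D"])
    show "continuous_map (prod_topology (?D a b) (?D b c)) (?D a c) (\<lambda>(f, g). comp H a b c f g)"
      if "a \<in> obj H" "b \<in> obj H" "c \<in> obj H" for a b c
    proof -
      have "prod_topology (?D a b) (?D b c) = discrete_topology (hom H a b \<times> hom H b c)"
        by (simp add: prod_topology_discrete_topology)
      then show ?thesis using gpd(2)[OF that] by auto
    qed
    show "\<exists>N d. openin unit_iv N \<and> s \<in> N \<and> d > 0 \<and> (\<forall>s'\<in>N. \<forall>t'\<in>{0..1}. \<bar>t' - t\<bar> < d \<longrightarrow> P s' t' \<in> W)"
      if s: "s \<in> topspace unit_iv" and t: "t \<in> {0..1}" and W: "openin R W" "P s t \<in> W" for s t W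
    proof -
      define K where "K = {z \<in> topspace (prod_topology unit_iv unit_iv). k z \<in> W}"
      have oK: "openin (prod_topology unit_iv unit_iv) K"
        unfolding K_def by (rule openin_continuous_map_preimage[OF k(1) W(1)])
      have stK: "(s, t) \<in> K" using s t W(2) by (simp add: P_def K_def)
      obtain N M where NM: "openin unit_iv N" "openin unit_iv M" "s \<in> N" "t \<in> M" "N \<times> M \<subseteq> K"
        using oK[unfolded openin_prod_topology_alt, rule_format, OF stK] by (elim exE conjE)
      have "pathin unit_iv (\<lambda>t. t)" by (simp add: pathin_unit_iv)
      from pathin_nbhd[OF this NM(2) t NM(4)] obtain d where d: "d > 0"
        "\<And>t'. t' \<in> {0..1} \<Longrightarrow> \<bar>t' - t\<bar> < d \<Longrightarrow> t' \<in> M" by blast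
      have "P s' t' \<in> W" if "s' \<in> N" "t' \<in> {0..1}" "\<bar>t' - t\<bar> < d" for s' t'
      proof -
        have "(s', t') \<in> N \<times> M" using that d(2) by simp
        then have "(s', t') \<in> K" using NM(5) by (rule subsetD[rotated])
        then show ?thesis using that(2) by (simp add: P_def K_def)
      qed
      then show ?thesis using NM(1,3) d(1) by blast
    qed
    \<comment> \<open>For discrete hom-sets the condition on transitions is flatness in the other
      direction: with the time fixed, the homotopy parameter traces a path that stays in the overlap
      near \<open>s\<close>, so the transition is constant there.\<close>
    show "\<exists>N. openin unit_iv N \<and> s \<in> N \<and>
        (\<forall>s'\<in>N. P s' t \<in> chart c \<and> P s' t \<in> chart c' \<and> transition c c' (P s' t) \<in> W)"
      if s: "s \<in> topspace unit_iv" and t: "t \<in> {0..1}" and c: "c \<in> {c. snd c \<in> V}" "c' \<in> {c. snd c \<in> V}"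
        and z: "P s t \<in> chart c" "P s t \<in> chart c'" and W: "transition c c' (P s t) \<in> W" for s t c c' W
    proof -
      have V: "snd c \<in> V" "snd c' \<in> V" using c by auto
      have s01: "s \<in> {0..1}" using s by simp
      have int: "openin R (chart c \<inter> chart c')" using openin_Int[OF V[THEN openin_chart]] .
      obtain d where d: "d > 0" "\<And>s'. s' \<in> {0..1} \<Longrightarrow> \<bar>s' - s\<bar> < d \<Longrightarrow> P s' t \<in> chart c \<inter> chart c'"
        using pathin_nbhd[OF slice2[OF t] int s01] z by blast
      have same: "transition c c' (P s' t) = transition c c' (P s t)" if s': "s' \<in> {0..1}" "\<bar>s' - s\<bar> < d" for s'
      proof -
        have im: "(\<lambda>s. P s t) ` {min s s'..max s s'} \<subseteq> chart c \<inter> chart c'"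
        proof
          fix w assume "w \<in> (\<lambda>s. P s t) ` {min s s'..max s s'}"
          then obtain r where r: "w = P r t" "r \<in> {min s s'..max s s'}" by blast
          then have "r \<in> {0..1}" "\<bar>r - s\<bar> < d" using s' s01 by auto
          then show "w \<in> chart c \<inter> chart c'" using d(2) r(1) by blast
        qed
        have "transition c c' (P (min s s') t) = transition c c' (P (max s s') t)"
          by (rule transition_flat[OF slice2[OF t] _ _ _ V im]) (use s' s01 in auto)
        then show ?thesis by (auto simp: min_def max_def split: if_splits)
      qed
      let ?N = "{0..1} \<inter> ball s d"
      have "openin unit_iv ?N" unfolding unit_iv_def by (simp add: openin_open_Int)
      moreover have "s \<in> ?N" using s01 d(1) by simp
      moreover have "P s' t \<in> chart c \<and> P s' t \<in> chart c' \<and> transition c c' (P s' t) \<in> W" if "s' \<in> ?N" for s'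
      proof -
        have "s' \<in> {0..1}" "\<bar>s' - s\<bar> < d" using that by (auto simp: dist_real_def)
        then show ?thesis using d(2)[of s'] same[of s'] W by simp
      qed
      ultimately show ?thesis by blast
    qed
    show "pathin R (P s)" "P s 0 \<in> chart (True, x)" "P s 1 \<in> chart (True, y)" if "s \<in> topspace unit_iv" for s
      using that slice1 ends vertex_in_star by simp_all
  qed (use xy in simp_all)
  then have cont: "pathin (?D (f0 x) (f0 y)) (\<lambda>s. hol x y (P s))" by (simp add: pathin_unit_iv)
  have "hol x y (P 0) = hol x y (P 1)"
  proof (rule unit_interval_locally_constant)
    fix t :: real assume t: "t \<in> {0..1}"
    have "hol x y (P t) \<in> hom H (f0 x) (f0 y)"
      using cont t by (auto simp: pathin_unit_iv continuous_map_def)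
    then have "openin (?D (f0 x) (f0 y)) {hol x y (P t)}" by simp
    from pathin_nbhd[OF cont this t] show "\<exists>d>0. \<forall>t'\<in>{0..1}. \<bar>t' - t\<bar> < d \<longrightarrow> hol x y (P t') = hol x y (P t)"
      by (metis singletonD singletonI)
  qed
  then show ?thesis by (simp add: Pp Pq)
qed

text \<open>No star contains the midpoint of an edge, so an interval mapped into a star avoids 1/2.
  This makes the explicit section of \<open>hol_edge_path\<close> constant in each chart.\<close>

lemma far_at_interval:
  assumes "edge_path d0 d1 e ` {t..t'} \<subseteq> chart c" "fst c" "0 \<le> t" "t \<le> t'" "t' \<le> 1"
  shows "1/2 < t \<longleftrightarrow> 1/2 < t'"
proof -
  have "edge_path d0 d1 e (1/2) = Inr (e, 1/2)" by (simp add: edge_path_def)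
  moreover have "Inr (e, 1/2) \<notin> chart c" using assms(2) by (auto elim!: chart_cases)
  ultimately have "1/2 \<notin> {t..t'}" using assms(1) by (metis image_subset_iff)
  then show ?thesis using assms by auto
qed

text \<open>By \<open>transport_eq\<close> it suffices to write down one section along the edge path
  that starts at an identity and ends at \<open>\<phi> e\<close>.\<close>

lemma hol_edge_path:
  assumes e: "e \<in> topspace E"
  shows "hol (d0 e) (d1 e) (edge_path d0 d1 e) = \<phi> e"
proof -
  let ?p = "edge_path d0 d1 e"
  note V = endpoints_in_V[OF e]
  \<comment> \<open>The value jumps only for stars, when the midpoint is passed and the centre
    changes from the start to the end of the edge; in the out-set it stays the identity
    throughout.\<close>
  define S where "S c t = (if fst c \<and> 1/2 < t then \<phi> e else idn H (f0 (d0 e)))" for c :: "bool \<times> 'v" and t :: real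
  have cases: "(snd c = d0 e \<and> S c t = idn H (f0 (d0 e)) \<and> \<not> (fst c \<and> 1/2 < t)) \<or> (snd c = d1 e \<and> S c t = \<phi> e \<and> fst c \<and> 1/2 < t)"
    if "?p t \<in> chart c" "0 \<le> t" "t \<le> 1" for c t
    using that by (auto simp: edge_path_def S_def elim!: chart_cases split: if_splits)
  have far: "far c (?p t) \<longleftrightarrow> fst c \<and> 1/2 < t" if "0 < t" "t < 1" for c t
    using that by (auto simp: far_def edge_path_def)
  have S_hom: "S c t \<in> hom H (f0 (d0 e)) (f0 (snd c))" if "t \<in> {0..1}" "?p t \<in> chart c" for c t
    using cases[of t c] that \<phi>_hom[OF e] gpd(1)[OF f0[OF V(1)]] by auto
  have "tr.parallel ?p (f0 (d0 e)) 0 1 S"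
    unfolding tr.parallel_def
  proof (intro conjI ballI allI impI)
    fix c t assume "t \<in> {0..1}" "?p t \<in> chart c"
    then show "S c t \<in> hom H (f0 (d0 e)) (f0 (snd c))" by (rule S_hom)
  next
    fix c c' t assume c: "c \<in> {c. snd c \<in> V}" "c' \<in> {c. snd c \<in> V}" and t: "t \<in> {0..1}" and z: "?p t \<in> chart c" "?p t \<in> chart c'"
    note cc = cases[OF z(1)] cases[OF z(2)]
    show "S c' t = comp H (f0 (d0 e)) (f0 (snd c)) (f0 (snd c')) (S c t) (transition c c' (?p t))"
    proof (cases "t = 0 \<or> t = 1")
      case True
      then have "fst c" "fst c'" using z by (auto simp: edge_path_def elim!: chart_cases)
      then have "transition c c' (?p t) = idn H (f0 (snd c))" "S c t = S c' t" by (simp_all add: transition_same_kind S_def)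
      moreover have "snd c = snd c'" using cc t \<open>fst c\<close> \<open>fst c'\<close> by auto
      moreover have "comp H (f0 (d0 e)) (f0 (snd c)) (f0 (snd c)) (S c t) (idn H (f0 (snd c))) = S c t"
        using c(1) S_hom[OF t z(1)] by (intro gpd f0 V) simp_all
      ultimately show ?thesis by simp
    next
      case False
      then have t': "0 < t" "t < 1" using t by auto
      have pe: "fst (projr (?p t)) = e" using t' by (simp add: edge_path_def)
      have sc: "snd c = (if fst c \<and> 1/2 < t then d1 e else d0 e)"
        "snd c' = (if fst c' \<and> 1/2 < t then d1 e else d0 e)" using cc t by auto
      show ?thesis
        using \<phi>_hom[OF e] gpd(1)[OF f0[OF V(1)]] f0[OF V(1)] f0[OF V(2)]
        by (cases "fst c \<and> 1/2 < t"; cases "fst c' \<and> 1/2 < t")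
          (simp_all only: sc S_def transition_def far[OF t'] pe gpd if_True if_False simp_thms)
    qed
  next
    fix c t t' assume "0 \<le> t" "t \<le> t'" "t' \<le> 1" "?p ` {t..t'} \<subseteq> chart c"
    then show "S c t = S c t'" using far_at_interval[of e t t' c] by (auto simp: S_def)
  qed
  moreover have "?p 0 = Inl (d0 e)" "?p 1 = Inl (d1 e)" by (simp_all add: edge_path_def)
  ultimately have "S (True, d1 e) 1 = comp H (f0 (d0 e)) (f0 (snd (True, d0 e))) (f0 (snd (True, d1 e))) (S (True, d0 e) 0)
      (hol (d0 e) (d1 e) ?p)"
    using V f0 by (intro tr.transport_eq pathin_edge_path e) (simp_all add: vertex_in_star)
  moreover have "hol (d0 e) (d1 e) ?p \<in> hom H (f0 (d0 e)) (f0 (d1 e))"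
    using V e by (intro hol_hom edge_path_space_set) (auto simp: edges_between_def)
  ultimately show ?thesis using V f0 by (simp add: S_def gpd)
qed

text \<open>\<open>F\<close> is taken on paths instead of classes, so that it can be evaluated
  directly on tails and on composites of rays.\<close>

lemma functor_eq_hol:
  fixes F :: "'v \<Rightarrow> 'v \<Rightarrow> (real \<Rightarrow> ('v,'e) rpt) \<Rightarrow> 'n"
  assumes F_hom: "\<And>x y p. \<lbrakk>x \<in> V; y \<in> V; p \<in> path_space_set R (Inl x) (Inl y)\<rbrakk> \<Longrightarrow> F x y p \<in> hom H (f0 x) (f0 y)"
    and F_homotopic: "\<And>x y p q. \<lbrakk>x \<in> V; y \<in> V; p \<in> path_space_set R (Inl x) (Inl y);
        q \<in> path_space_set R (Inl x) (Inl y); homotopic_rel_ends R p q\<rbrakk> \<Longrightarrow> F x y p = F x y q"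
    and F_join: "\<And>x y z p q. \<lbrakk>x \<in> V; y \<in> V; z \<in> V; p \<in> path_space_set R (Inl x) (Inl y);
        q \<in> path_space_set R (Inl y) (Inl z)\<rbrakk> \<Longrightarrow>
        F x z (join_path p q) = comp H (f0 x) (f0 y) (f0 z) (F x y p) (F y z q)"
    and F_const: "\<And>x. x \<in> V \<Longrightarrow> F x x (const_path (Inl x)) = idn H (f0 x)"
    and F_edge: "\<And>e. e \<in> topspace E \<Longrightarrow> F (d0 e) (d1 e) (edge_path d0 d1 e) = \<phi> e"
    and xy: "x \<in> V" "y \<in> V" and p: "p \<in> path_space_set R (Inl x) (Inl y)"
  shows "F x y p = hol x y p"
proof -
  have pp: "pathin R p" "p 0 = Inl x" "p 1 = Inl y" using p by (auto simp: path_space_set_def)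
  define S where "S c t = F x (snd c) (tail_path p c t)" for c t
  have tail: "tail_path p c t \<in> path_space_set R (Inl x) (Inl (snd c))"
    if "t \<in> {0..1}" "snd c \<in> V" "p t \<in> chart c" for c t
    using tail_path_space_set[OF pp(1,2) that] .
  have rays: "join_path (ray c z) (rev_path (ray c' z)) \<in> path_space_set R (Inl (snd c)) (Inl (snd c'))"
    if "snd c \<in> V" "snd c' \<in> V" "z \<in> chart c" "z \<in> chart c'" for c c' z
  proof -
    have "pathin R (join_path (ray c z) (rev_path (ray c' z)))"
      using that by (intro pathin_join pathin_rev pathin_ray) (auto simp: ray_1 rev_path_def)
    then show ?thesis
      using that by (simp add: path_space_set_def) (simp add: join_path_def rev_path_def ray_0)
  qed
  have const: "const_path (Inl v) \<in> path_space_set R (Inl v) (Inl v)" if "v \<in> V" for v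
    using that by (intro const_path_space_set) (simp add: real_points_def)
  have F_rev: "F v u (rev_path r) = inv H (f0 u) (f0 v) (F u v r)"
    if uv: "u \<in> V" "v \<in> V" and r: "r \<in> path_space_set R (Inl u) (Inl v)" for u v r
  proof -
    have r': "rev_path r \<in> path_space_set R (Inl v) (Inl u)" by (rule rev_path_space_set[OF r])
    have e: "pathin R r" "r 1 = Inl v" using r by (auto simp: path_space_set_def)
    have "comp H (f0 v) (f0 u) (f0 v) (F v u (rev_path r)) (F u v r) = F v v (join_path (rev_path r) r)"
      using F_join[OF uv(2,1,2) r' r] by simp
    also have "\<dots> = F v v (const_path (Inl v))"
      using join_rev_left[OF e(1)] e(2) join_path_space_set[OF r' r] const uv by (intro F_homotopic) auto
    also have "\<dots> = idn H (f0 v)" using F_const uv by simp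
    finally have inv: "comp H (f0 v) (f0 u) (f0 v) (F v u (rev_path r)) (F u v r) = idn H (f0 v)" .
    note f = F_hom[OF uv r] F_hom[OF uv(2,1) r'] f0[OF uv(1)] f0[OF uv(2)]
    let ?a = "F u v r" and ?i = "F v u (rev_path r)"
    have "?i = comp H (f0 v) (f0 u) (f0 u) ?i (comp H (f0 u) (f0 v) (f0 u) ?a (inv H (f0 u) (f0 v) ?a))"
      using f by (simp add: gpd)
    also have "\<dots> = comp H (f0 v) (f0 v) (f0 u) (comp H (f0 v) (f0 u) (f0 v) ?i ?a) (inv H (f0 u) (f0 v) ?a)"
      using f gpd(6) by (intro gpd(3)[symmetric]) auto
    also have "\<dots> = inv H (f0 u) (f0 v) ?a" unfolding inv using f by (simp add: gpd)
    finally show ?thesis .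
  qed
  \<comment> \<open>Identifies the jump of \<open>S\<close> at a change of chart with the cocycle.
    The prescribed value on edge paths enters here.\<close>
  have F_rays: "F (snd c) (snd c') (join_path (ray c z) (rev_path (ray c' z))) = transition c c' z"
    if V: "snd c \<in> V" "snd c' \<in> V" and z: "z \<in> chart c" "z \<in> chart c'" for c c' z
  proof (cases "far c z \<longleftrightarrow> far c' z")
    case True
    have eq: "snd c = snd c'" using far_centre(1)[OF z True] .
    then have "F (snd c) (snd c') (join_path (ray c z) (rev_path (ray c' z))) = F (snd c) (snd c) (const_path (Inl (snd c)))"
      using ray_ray_same[OF V z True] rays[OF V z] const V by (metis F_homotopic)
    then show ?thesis using True F_const V by (simp add: transition_def)
  next
    case False
    show ?thesis
    proof (cases "far c z")
      case True
      with False have "\<not> far c' z" by simp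
      from far_not_far[OF z True this] obtain e t where e: "z = Inr (e, t)" "e \<in> topspace E"
        "snd c = d1 e" "snd c' = d0 e" "1/2 < t" "t < 1" "fst c" "\<not> fst c'" by blast
      have ep: "edge_path d0 d1 e \<in> path_space_set R (Inl (d0 e)) (Inl (d1 e))"
        using e by (intro edge_path_space_set) (simp add: edges_between_def)
      have "F (snd c) (snd c') (join_path (ray c z) (rev_path (ray c' z))) = F (snd c) (snd c') (rev_path (edge_path d0 d1 e))"
        using ray_ray_far(1)[OF e(2,1,5-8)] rays[OF V z] rev_path_space_set[OF ep] e(3,4) V by (intro F_homotopic) auto
      also have "\<dots> = inv H (f0 (d0 e)) (f0 (d1 e)) (\<phi> e)"
        using F_rev[OF _ _ ep] F_edge[OF e(2)] V e(3,4) by simp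
      finally show ?thesis using True False e by (simp add: transition_def)
    next
      case nf: False
      with False have "far c' z" by simp
      from far_not_far[OF z(2,1) this nf] obtain e t where e: "z = Inr (e, t)" "e \<in> topspace E"
        "snd c' = d1 e" "snd c = d0 e" "1/2 < t" "t < 1" "fst c'" "\<not> fst c" by blast
      have ep: "edge_path d0 d1 e \<in> path_space_set R (Inl (d0 e)) (Inl (d1 e))"
        using e by (intro edge_path_space_set) (simp add: edges_between_def)
      have "F (snd c) (snd c') (join_path (ray c z) (rev_path (ray c' z))) = F (snd c) (snd c') (edge_path d0 d1 e)"
        using ray_ray_far(2)[OF e(2,1,5-8)] rays[OF V z] ep e(3,4) V by (intro F_homotopic) auto
      also have "\<dots> = \<phi> e" using F_edge[OF e(2)] e(3,4) by simp
      finally show ?thesis using nf False e by (simp add: transition_def)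
    qed
  qed
  have "tr.parallel p (f0 x) 0 1 S"
    unfolding tr.parallel_def
  proof (intro conjI ballI allI impI)
    fix c t assume "c \<in> {c. snd c \<in> V}" "t \<in> {0..1}" "p t \<in> chart c"
    then show "S c t \<in> hom H (f0 x) (f0 (snd c))"
      unfolding S_def using xy by (intro F_hom tail) auto
  next
    fix c c' t assume c: "c \<in> {c. snd c \<in> V}" "c' \<in> {c. snd c \<in> V}" and t: "t \<in> {0..1}" and z: "p t \<in> chart c" "p t \<in> chart c'"
    have V: "snd c \<in> V" "snd c' \<in> V" using c by auto
    let ?j = "join_path (ray c (p t)) (rev_path (ray c' (p t)))"
    have "F x (snd c') (join_path (tail_path p c t) ?j) = S c' t"
      unfolding S_def
      by (rule F_homotopic[OF xy(1) V(2) join_path_space_set[OF tail[OF t V(1) z(1)] rays[OF V z]]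
          tail[OF t V(2) z(2)] tail_path_change_chart[OF pp(1) t V(1) z(1) V(2) z(2)]])
    then have "S c' t = F x (snd c') (join_path (tail_path p c t) ?j)" by (rule sym)
    also have "\<dots> = comp H (f0 x) (f0 (snd c)) (f0 (snd c')) (S c t) (F (snd c) (snd c') ?j)"
      unfolding S_def by (rule F_join[OF xy(1) V tail[OF t V(1) z(1)] rays[OF V z]])
    finally show "S c' t = comp H (f0 x) (f0 (snd c)) (f0 (snd c')) (S c t) (transition c c' (p t))"
      by (simp only: F_rays[OF V z])
  next
    fix c t t' assume c: "c \<in> {c. snd c \<in> V}" and t: "0 \<le> t" "t \<le> t'" "t' \<le> 1" and im: "p ` {t..t'} \<subseteq> chart c"
    then have V: "snd c \<in> V" and "p t \<in> chart c" "p t' \<in> chart c" by auto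
    then show "S c t = S c t'"
      unfolding S_def using tail_path_homotopic[OF pp(1) t V im] xy t by (intro F_homotopic tail) auto
  qed
  then have "S (True, y) 1 = comp H (f0 x) (f0 (snd (True, x))) (f0 (snd (True, y))) (S (True, x) 0) (hol x y p)"
    using xy f0 pp by (intro tr.transport_eq) (auto simp: vertex_in_star)
  \<comment> \<open>At both ends \<open>p\<close> sits at the centre of a star, where the ray is
    constant. So the tail is constant at time 0, and is \<open>p\<close> followed by a constant path
    at time 1.\<close>
  moreover have "S (True, x) 0 = idn H (f0 x)"
  proof -
    have "tail_path p (True, x) 0 = const_path (Inl x)"
      by (auto simp: fun_eq_iff tail_path_def join_path_def rev_path_def ray_def const_path_def pp(2))
    then show ?thesis using F_const xy by (simp add: S_def)
  qed
  moreover have "S (True, y) 1 = F x y p"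
  proof -
    have "tail_path p (True, y) 1 = join_path p (const_path (p 1))"
      by (auto simp: fun_eq_iff tail_path_def join_path_def rev_path_def ray_def const_path_def pp(3))
    moreover have "homotopic_rel_ends R (join_path p (const_path (p 1))) p" by (rule join_const_right[OF pp(1)])
    ultimately show ?thesis
      using tail[of 1 "(True, y)"] xy pp(3) vertex_in_star p by (simp add: S_def) (rule F_homotopic; simp)
  qed
  ultimately show ?thesis using hol_hom[OF xy p] f0 xy by (simp add: gpd)
qed

end

section \<open>The fundamental groupoid is free\<close>

context topological_graph
begin

abbreviation "P \<equiv> pi_qtop V E d0 d1"
abbreviation "cls x y \<equiv> path_class R (Inl x) (Inl y)"

text \<open>A path of edges inside Gamma(x,y) is itself the homotopy, since all these edges have the
  same end vertices.\<close>

lemma edge_path_homotopic: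
  assumes "path_component_of (subtopology E (edges_between E d0 d1 x y)) e e'"
  shows "homotopic_rel_ends R (edge_path d0 d1 e) (edge_path d0 d1 e')"
proof -
  from assms obtain \<gamma> where \<gamma>: "pathin (subtopology E (edges_between E d0 d1 x y)) \<gamma>" "\<gamma> 0 = e" "\<gamma> 1 = e'"
    unfolding path_component_of_def by blast
  have cE: "continuous_map unit_iv E \<gamma>"
    using \<gamma>(1) by (simp add: pathin_unit_iv continuous_map_in_subtopology)
  have mem: "\<gamma> s \<in> edges_between E d0 d1 x y" if "s \<in> {0..1}" for s
    using \<gamma>(1) that by (auto simp: pathin_unit_iv continuous_map_in_subtopology)
  show ?thesis
  proof (rule homotopic_rel_endsI)
    have "continuous_map (prod_topology unit_iv unit_iv) (prod_topology E unit_iv) (\<lambda>z. (\<gamma> (fst z), snd z))"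
      unfolding continuous_map_pairwise o_def fst_conv snd_conv
      using continuous_map_compose[OF continuous_map_fst cE, of unit_iv] by (simp add: o_def continuous_map_snd)
    from continuous_map_compose[OF this continuous_map_edge_path_pair]
    show "continuous_map (prod_topology unit_iv unit_iv) R (\<lambda>(s, t). edge_path d0 d1 (\<gamma> s) t)"
      by (simp add: o_def case_prod_unfold)
  qed (use \<gamma>(2,3) mem[of 0] mem in \<open>simp_all add: edge_path_def edges_between_def\<close>)
qed

text \<open>The \<open>SOME\<close> in \<open>canon_map\<close> may pick another edge of the
  component; the homotopy of edge paths absorbs the choice.\<close>

lemma canon_map_pi0_comp:
  assumes e: "e \<in> edges_between E d0 d1 x y"
  shows "canon_map V E d0 d1 x y (pi0_comp E d0 d1 x y e) = cls x y (edge_path d0 d1 e)"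
proof -
  let ?X = "subtopology E (edges_between E d0 d1 x y)"
  let ?e' = "SOME e'. e' \<in> pi0_comp E d0 d1 x y e"
  have "e \<in> topspace ?X" using e by (simp add: edges_between_def)
  then have "e \<in> pi0_comp E d0 d1 x y e" by (simp add: pi0_comp_def path_component_of_refl)
  then have "?e' \<in> pi0_comp E d0 d1 x y e" by (rule someI[of "\<lambda>e'. e' \<in> pi0_comp E d0 d1 x y e"])
  then have "path_component_of ?X e ?e'" by (simp add: pi0_comp_def)
  from path_class_eqI[OF edge_path_homotopic[OF this]] show ?thesis by (simp add: canon_map_def)
qed

lemma groupoid_P: "groupoid P"
  by (rule groupoid_pi_qtop) (simp add: real_points_def)

sublocale tau: tau_reflection P
proof
  show "groupoid P" by (rule groupoid_P)
  show "topspace (htop P x y) = hom P x y" for x y by (simp add: pi_qtop_sel)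
qed

lemma continuous_map_cls:
  assumes "x \<in> V" "y \<in> V"
  shows "continuous_map (compact_open_paths R (Inl x) (Inl y)) (htop (tau P) x y) (cls x y)"
proof -
  have "continuous_map (compact_open_paths R (Inl x) (Inl y)) (htop P x y) (cls x y)"
    by (simp add: pi_qtop_sel continuous_map_quotient_top)
  moreover have "continuous_map (htop P x y) (htop (tau P) x y) id"
    using assms by (intro tau.continuous_map_htop_tau) (simp_all add: pi_qtop_sel)
  ultimately show ?thesis using continuous_map_compose by fastforce
qed

text \<open>Currying the canonical map gives a continuous map from Gamma(x,y) to the path space;
  followed by \<open>cls\<close> it depends only on the path component, so it descends to the
  quotient.\<close>

lemma graph_morphism_canon_map:
  "graph_morphism_to V (pi0_edges E d0 d1) (tau P) id (canon_map V E d0 d1)"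
  unfolding graph_morphism_to_def
proof (intro conjI ballI)
  show "id x \<in> obj (tau P)" if "x \<in> V" for x using that by (simp add: tau_def pi_qtop_sel)
  fix x y assume xy: "x \<in> V" "y \<in> V"
  let ?X = "subtopology E (edges_between E d0 d1 x y)"
  have top: "topspace ?X = edges_between E d0 d1 x y" by (auto simp: edges_between_def)
  have "continuous_map (prod_topology ?X unit_iv) (prod_topology E unit_iv) (\<lambda>z. (fst z, snd z))"
    unfolding continuous_map_pairwise o_def fst_conv snd_conv
    using continuous_map_fst[of ?X unit_iv] by (simp add: continuous_map_in_subtopology continuous_map_snd)
  from continuous_map_compose[OF this continuous_map_edge_path_pair]
  have "continuous_map (prod_topology ?X unit_iv) R (\<lambda>(e, t). edge_path d0 d1 e t)"
    by (simp add: o_def case_prod_unfold)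
  then have "continuous_map ?X (compact_open_paths R (Inl x) (Inl y)) (edge_path d0 d1)"
    using edge_path_space_set top by (intro continuous_map_into_compact_open_paths) auto
  from continuous_map_compose[OF this continuous_map_cls[OF xy]]
  have "continuous_map ?X (htop (tau P) x y) (\<lambda>e. canon_map V E d0 d1 x y (pi0_comp E d0 d1 x y e))"
    by (rule continuous_map_eq) (use top canon_map_pi0_comp in auto)
  then show "continuous_map (pi0_edges E d0 d1 x y) (htop (tau P) (id x) (id y)) (canon_map V E d0 d1 x y)"
    unfolding pi0_edges_def by (simp add: continuous_map_from_quotient_top)
qed

lemma free_wrt_tau:
  "free_wrt V (pi0_edges E d0 d1) (tau P) (canon_map V E d0 d1) H"
  unfolding free_wrt_def
proof (intro impI allI)
  fix f0 f1 assume H: "top_groupoid H" and f: "graph_morphism_to V (pi0_edges E d0 d1) H f0 f1"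
  \<comment> \<open>The end vertices are read off the edge, so that one function on the edge space
    serves all the maps \<open>f1 x y\<close>.\<close>
  define \<phi> where "\<phi> e = f1 (d0 e) (d1 e) (pi0_comp E d0 d1 (d0 e) (d1 e) e)" for e
  interpret graph_representation V E d0 d1 H f0 \<phi>
  proof
    show "top_groupoid H" by (rule H)
    show "f0 x \<in> obj H" if "x \<in> V" for x using f that by (simp add: graph_morphism_to_def)
    fix x y assume xy: "x \<in> V" "y \<in> V"
    let ?X = "subtopology E (edges_between E d0 d1 x y)"
    have "continuous_map (pi0_edges E d0 d1 x y) (htop H (f0 x) (f0 y)) (f1 x y)"
      using f xy by (simp add: graph_morphism_to_def)
    moreover have "continuous_map ?X (pi0_edges E d0 d1 x y) (pi0_comp E d0 d1 x y)"
      unfolding pi0_edges_def by (rule continuous_map_quotient_top)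
    ultimately have "continuous_map ?X (htop H (f0 x) (f0 y)) (f1 x y \<circ> pi0_comp E d0 d1 x y)"
      by (rule continuous_map_compose[rotated])
    then show "continuous_map ?X (htop H (f0 x) (f0 y)) \<phi>"
      by (rule continuous_map_eq) (auto simp: \<phi>_def edges_between_def)
    fix e e' assume pc: "path_component_of ?X e e'"
    then have "e \<in> edges_between E d0 d1 x y" "e' \<in> edges_between E d0 d1 x y"
      using path_component_in_topspace[OF pc] by auto
    moreover have "pi0_comp E d0 d1 x y e = pi0_comp E d0 d1 x y e'"
      using pc path_component_of_equiv[of ?X e e'] by (simp add: pi0_comp_def)
    ultimately show "\<phi> e = \<phi> e'" by (simp add: \<phi>_def edges_between_def)
  qed
  define F1 where "F1 x y m = hol x y (SOME p. p \<in> m)" for x y m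
  have F1: "F1 x y (cls x y p) = hol x y p"
    if "x \<in> V" "y \<in> V" "p \<in> path_space_set R (Inl x) (Inl y)" for x y p
    unfolding F1_def
    using hol_homotopic[OF that(1,2) some_path_class(2)[OF that(3)] that(3) some_path_class(1)[OF that(3)]] by simp
  have hom_P: "hom P x y = cls x y ` path_space_set R (Inl x) (Inl y)" for x y by (simp add: pi_qtop_sel)
  have const: "const_path (Inl x) \<in> path_space_set R (Inl x) (Inl x)" if "x \<in> V" for x
    using that by (intro const_path_space_set) (simp add: real_points_def)
  have "cont_functor P H f0 F1"
    unfolding cont_functor_def pi_qtop_sel(1)
  proof (intro conjI ballI)
    show "f0 x \<in> obj H" if "x \<in> V" for x using f0 that by simp
    show "continuous_map (htop P x y) (htop H (f0 x) (f0 y)) (F1 x y)" if "x \<in> V" "y \<in> V" for x y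
      unfolding pi_qtop_sel
    proof (rule continuous_map_from_quotient_top)
      show "continuous_map (compact_open_paths R (Inl x) (Inl y)) (htop H (f0 x) (f0 y)) (\<lambda>p. F1 x y (cls x y p))"
        by (rule continuous_map_eq[OF hol_continuous[OF that]]) (simp add: F1 that)
    qed
    show "F1 x x (idn P x) = idn H (f0 x)" if "x \<in> V" for x
      using F1[OF that that const[OF that]] hol_const[OF that] by (simp add: pi_qtop_sel)
    fix x y z m n assume xyz: "x \<in> V" "y \<in> V" "z \<in> V" and mn: "m \<in> hom P x y" "n \<in> hom P y z"
    from mn obtain p q where p: "p \<in> path_space_set R (Inl x) (Inl y)" "m = cls x y p"
      and q: "q \<in> path_space_set R (Inl y) (Inl z)" "n = cls y z q" unfolding hom_P by blast
    have "F1 x z (comp P x y z m n) = hol x z (join_path p q)"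
      using F1[OF xyz(1,3) join_path_space_set[OF p(1) q(1)]] pi_qtop_comp[OF p(1) q(1)] p(2) q(2) by simp
    also have "\<dots> = comp H (f0 x) (f0 y) (f0 z) (F1 x y m) (F1 y z n)"
      using hol_join[OF xyz p(1) q(1)] F1[OF xyz(1,2) p(1)] F1[OF xyz(2,3) q(1)] p(2) q(2) by simp
    finally show "F1 x z (comp P x y z m n) = comp H (f0 x) (f0 y) (f0 z) (F1 x y m) (F1 y z n)" .
  qed
  then have cont: "cont_functor (tau P) H f0 F1" by (rule tau.cont_functor_tau[OF _ H])
  have pi0: "topspace (pi0_edges E d0 d1 x y) = pi0_comp E d0 d1 x y ` edges_between E d0 d1 x y" for x y
    by (auto simp: pi0_edges_def edges_between_def)
  have extends: "F1 x y (canon_map V E d0 d1 x y d) = f1 x y d"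
    if "x \<in> V" "y \<in> V" "d \<in> topspace (pi0_edges E d0 d1 x y)" for x y d
  proof -
    from that(3) obtain e where e: "e \<in> edges_between E d0 d1 x y" "d = pi0_comp E d0 d1 x y e"
      unfolding pi0 by blast
    then have "e \<in> topspace E" "d0 e = x" "d1 e = y" by (auto simp: edges_between_def)
    then show ?thesis
      using F1[OF that(1,2) edge_path_space_set[OF e(1)]] hol_edge_path[of e] e canon_map_pi0_comp[OF e(1)]
      by (simp add: \<phi>_def)
  qed
  have unique: "F1' x y m = F1 x y m"
    if F': "cont_functor (tau P) H f0 F1'"
      and ext: "\<forall>x\<in>V. \<forall>y\<in>V. \<forall>d\<in>topspace (pi0_edges E d0 d1 x y). F1' x y (canon_map V E d0 d1 x y d) = f1 x y d"
      and xy: "x \<in> V" "y \<in> V" and m: "m \<in> hom (tau P) x y" for F1' x y m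
  proof -
    have sel: "obj (tau P) = V" "hom (tau P) = hom P" "comp (tau P) = comp P" "idn (tau P) = idn P"
      by (simp_all add: tau_def pi_qtop_sel)
    obtain p where p: "p \<in> path_space_set R (Inl x) (Inl y)" "m = cls x y p"
      using m unfolding sel hom_P by blast
    have "F1' x y (cls x y p) = hol x y p"
    proof (rule functor_eq_hol[where F="\<lambda>x y p. F1' x y (cls x y p)"])
      fix x y p assume xy: "x \<in> V" "y \<in> V" and p: "p \<in> path_space_set R (Inl x) (Inl y)"
      have "continuous_map (htop (tau P) x y) (htop H (f0 x) (f0 y)) (F1' x y)"
        using F' xy unfolding cont_functor_def sel by blast
      moreover have "cls x y p \<in> topspace (htop (tau P) x y)"
        using continuous_map_funspace[OF continuous_map_cls[OF xy]] p by auto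
      ultimately have "F1' x y (cls x y p) \<in> topspace (htop H (f0 x) (f0 y))"
        using continuous_map_funspace by blast
      then show "F1' x y (cls x y p) \<in> hom H (f0 x) (f0 y)" using topspace_htop xy by simp
    next
      fix x y p q assume "homotopic_rel_ends R p q"
      then show "F1' x y (cls x y p) = F1' x y (cls x y q)" using path_class_eqI by metis
    next
      fix x y z p q assume a: "x \<in> V" "y \<in> V" "z \<in> V" "p \<in> path_space_set R (Inl x) (Inl y)" "q \<in> path_space_set R (Inl y) (Inl z)"
      have "F1' x z (comp P x y z (cls x y p) (cls y z q)) =
        comp H (f0 x) (f0 y) (f0 z) (F1' x y (cls x y p)) (F1' y z (cls y z q))"
        using F' a unfolding cont_functor_def sel hom_P by blast
      then show "F1' x z (cls x z (join_path p q)) =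
        comp H (f0 x) (f0 y) (f0 z) (F1' x y (cls x y p)) (F1' y z (cls y z q))"
        by (simp add: pi_qtop_comp[OF a(4,5)])
    next
      fix x assume "x \<in> V"
      then have "F1' x x (idn P x) = idn H (f0 x)" using F' unfolding cont_functor_def sel by blast
      then show "F1' x x (cls x x (const_path (Inl x))) = idn H (f0 x)" by (simp add: pi_qtop_sel)
    next
      fix e assume e: "e \<in> topspace E"
      have eb: "e \<in> edges_between E d0 d1 (d0 e) (d1 e)" using e by (simp add: edges_between_def)
      have "F1' (d0 e) (d1 e) (canon_map V E d0 d1 (d0 e) (d1 e) (pi0_comp E d0 d1 (d0 e) (d1 e) e)) = \<phi> e"
        using ext endpoints_in_V[OF e] eb unfolding pi0 \<phi>_def by blast
      then show "F1' (d0 e) (d1 e) (cls (d0 e) (d1 e) (edge_path d0 d1 e)) = \<phi> e"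
        by (simp add: canon_map_pi0_comp[OF eb])
    qed (use xy p in auto)
    then show ?thesis using F1[OF xy p(1)] p(2) by simp
  qed
  show "\<exists>F1. cont_functor (tau P) H f0 F1 \<and>
      (\<forall>x\<in>V. \<forall>y\<in>V. \<forall>d\<in>topspace (pi0_edges E d0 d1 x y). F1 x y (canon_map V E d0 d1 x y d) = f1 x y d) \<and>
      (\<forall>F1'. cont_functor (tau P) H f0 F1' \<and>
        (\<forall>x\<in>V. \<forall>y\<in>V. \<forall>d\<in>topspace (pi0_edges E d0 d1 x y). F1' x y (canon_map V E d0 d1 x y d) = f1 x y d) \<longrightarrow>
        (\<forall>x\<in>V. \<forall>y\<in>V. \<forall>m\<in>hom (tau P) x y. F1' x y m = F1 x y m))"
  proof (intro exI[of _ F1] conjI allI impI ballI cont)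
    show "F1 x y (canon_map V E d0 d1 x y d) = f1 x y d"
      if "x \<in> V" "y \<in> V" "d \<in> topspace (pi0_edges E d0 d1 x y)" for x y d
      using that by (rule extends)
    show "F1' x y m = F1 x y m"
      if "cont_functor (tau P) H f0 F1' \<and>
          (\<forall>x\<in>V. \<forall>y\<in>V. \<forall>d\<in>topspace (pi0_edges E d0 d1 x y). F1' x y (canon_map V E d0 d1 x y d) = f1 x y d)"
        "x \<in> V" "y \<in> V" "m \<in> hom (tau P) x y" for F1' x y m
      by (rule unique[OF conjunct1[OF that(1)] conjunct2[OF that(1)] that(2-4)])
  qed
qed

end

text \<open>The isomorphism is expressed by the universal property. \<open>H\<close> has its own
  type variables, so it can be any other free Top-groupoid on pi_0(Gamma), or \<open>pi_tau\<close>
  itself, and the usual comparison of universal objects gives the isomorphism induced by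
  \<open>canon_map\<close>.\<close>

theorem theorem4p8:
  fixes V :: "'v set" and E :: "'e topology" and d0 d1 :: "'e \<Rightarrow> 'v"
    and H :: "('p,'n) tgpd"
  assumes "top_graph V E d0 d1"
  shows "top_groupoid (pi_tau V E d0 d1)
    \<and> obj (pi_tau V E d0 d1) = V
    \<and> (\<forall>x\<in>V. \<forall>y\<in>V. \<forall>e\<in>edges_between E d0 d1 x y.
          canon_map V E d0 d1 x y (pi0_comp E d0 d1 x y e)
          = path_class (realization V E d0 d1) (Inl x) (Inl y) (edge_path d0 d1 e))
    \<and> graph_morphism_to V (pi0_edges E d0 d1) (pi_tau V E d0 d1) id (canon_map V E d0 d1)
    \<and> free_wrt V (pi0_edges E d0 d1) (pi_tau V E d0 d1) (canon_map V E d0 d1) H"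
proof -
  interpret topological_graph V E d0 d1 by standard (rule assms)
  have "obj (tau P) = V" by (simp add: tau_def pi_qtop_sel)
  then show ?thesis
    unfolding pi_tau_def
    by (intro conjI ballI tau.top_groupoid_tau canon_map_pi0_comp graph_morphism_canon_map free_wrt_tau)
qed

end
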